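(* Let $\theta\in\mathbb R\setminus\mathbb Q$ and let $\Gamma$ be one of the cyclic subgroups $\mathbb Z_3,\mathbb Z_4,\mathbb Z_6$ of $SL(2,\mathbb Z)$ described in the context, acting on $\mathcal A_\theta^{alg}$. Then the Hochschild cohomology of $B=\mathcal A_\theta^{alg}\rtimes\Gamma$ with coefficients in its dual bimodule $B^\ast$ satisfies: $H^0(B,B^\ast)\cong\mathbb C^7$ for $\Gamma=\mathbb Z_3$, $\cong\mathbb C^8$ for $\Gamma=\mathbb Z_4$, $\cong\mathbb C^9$ for $\Gamma=\mathbb Z_6$; $H^1(B,B^\ast)\cong 0$ for $\Gamma=\mathbb Z_3,\mathbb Z_4,\mathbb Z_6$; $H^2(B,B^\ast)\cong\mathbb C$ for $\Gamma=\mathbb Z_3,\mathbb Z_4,\mathbb Z_6$; $H^k(B,B^\ast)\cong 0$ for all $k>3$ and $\Gamma=\mathbb Z_3,\mathbb Z_4,\mathbb Z_6$.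
   Context: Let $\lambda=e^{2\pi i\theta}$ and for $s\in\mathbb R$ write $\lambda^s:=e^{2\pi i\theta s}$. The algebraic noncommutative torus $\mathcal A_\theta^{alg}$ is the complex algebra of finite sums $\sum_{(n,m)\in\mathbb Z^2}a_{n,m}U_1^nU_2^m$, where $U_1,U_2$ are invertible (unitary) generators with $U_2U_1=\lambda U_1U_2$. An element $g=\begin{pmatrix}g_{11}&g_{12}\\ g_{21}&g_{22}\end{pmatrix}\in SL(2,\mathbb Z)$ acts by the automorphism determined by $g\cdot U_1=e^{\pi i g_{11}g_{21}\theta}U_1^{g_{11}}U_2^{g_{21}}$, $g\cdot U_2=e^{\pi i g_{12}g_{22}\theta}U_1^{g_{12}}U_2^{g_{22}}$. The subgroup $\mathbb Z_3$ is generated by $\omega=\begin{pmatrix}0&1\\-1&-1\end{pmatrix}$ (so $U_1\mapsto U_2^{-1}$, $U_2\mapsto\lambda^{-1/2}U_1U_2^{-1}$); $\mathbb Z_4$ is generated by an element acting by $U_1\mapsto U_2^{-1}$, $U_2\mapsto U_1$; $\mathbb Z_6$ is generated by $-\omega=\begin{pmatrix}0&-1\\1&1\end{pmatrix}$ (so $U_1\mapsto U_2$, $U_2\mapsto\lambda^{-1/2}U_1^{-1}U_2$). The crossed product $\mathcal A_\theta^{alg}\rtimes\Gamma$ is $\mathcal A_\theta^{alg}\otimes\mathbb C\Gamma$ with product $(a\otimes g)(b\otimes h)=a(g\cdot b)\otimes gh$. For an algebra $B$, $B^\ast=\mathrm{Hom}_{\mathbb C}(B,\mathbb C)$ is the $B$-bimodule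 with $(b\cdot f\cdot c)(x)=f(cxb)$, and $H^\bullet(B,B^\ast)$ denotes Hochschild cohomology. *)

theory Defs
  imports Complex_Main
begin

type_synonym mat2 = "int \<times> int \<times> int \<times> int"

definition mmul :: "mat2 \<Rightarrow> mat2 \<Rightarrow> mat2" where
  "mmul A B = (case A of (a11, a12, a21, a22) \<Rightarrow> case B of (b11, b12, b21, b22) \<Rightarrow>
     (a11*b11 + a12*b21, a11*b12 + a12*b22, a21*b11 + a22*b21, a21*b12 + a22*b22))"

definition mone :: mat2 where "mone = (1, 0, 0, 1)"

primrec mpow :: "mat2 \<Rightarrow> nat \<Rightarrow> mat2" where
  "mpow g 0 = mone"
| "mpow g (Suc k) = mmul g (mpow g k)"

definition cyc_group :: "mat2 \<Rightarrow> mat2 set" where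
  "cyc_group g = range (mpow g)"

text \<open>Generators: omega for Z3, the order-4 element U1 -> U2^-1, U2 -> U1, and -omega for Z6.\<close>
definition gen_Z3 :: mat2 where "gen_Z3 = (0, 1, -1, -1)"
definition gen_Z4 :: mat2 where "gen_Z4 = (0, 1, -1, 0)"
definition gen_Z6 :: mat2 where "gen_Z6 = (0, -1, 1, 1)"

definition mapply :: "mat2 \<Rightarrow> int \<times> int \<Rightarrow> int \<times> int" where
  "mapply g v = (case g of (g11, g12, g21, g22) \<Rightarrow> case v of (a, b) \<Rightarrow>
     (g11*a + g12*b, g21*a + g22*b))"

definition lam_pow :: "real \<Rightarrow> real \<Rightarrow> complex" where
  "lam_pow \<theta> s = cis (2 * pi * \<theta> * s)"

text \<open>Action on monomials U1^a U2^b: g.(U1^a U2^b) = (g.U1)^a (g.U2)^b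
  = lambda^((a'b' - ab)/2) U1^a' U2^b' with (a',b') = g(a,b).\<close>
definition act_phase :: "real \<Rightarrow> mat2 \<Rightarrow> int \<times> int \<Rightarrow> complex" where
  "act_phase \<theta> g v = (case mapply g v of (a', b') \<Rightarrow>
      lam_pow \<theta> ((real_of_int (a' * b') - real_of_int (fst v * snd v)) / 2))"

text \<open>Basis elements (U1^v1 U2^v2) (x) g of the crossed product.\<close>
type_synonym bidx = "(int \<times> int) \<times> mat2"

text \<open>(U^v (x) g)(U^w (x) h) = U^v (g.U^w) (x) gh, using U2^b U1^c = lambda^(bc) U1^c U2^b.\<close>
definition bmul_idx :: "bidx \<Rightarrow> bidx \<Rightarrow> bidx" where
  "bmul_idx p q = (case p of (v, g) \<Rightarrow> case q of (w, h) \<Rightarrow>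
     (case mapply g w of (c', d') \<Rightarrow> ((fst v + c', snd v + d'), mmul g h)))"

definition bmul_coeff :: "real \<Rightarrow> bidx \<Rightarrow> bidx \<Rightarrow> complex" where
  "bmul_coeff \<theta> p q = (case p of (v, g) \<Rightarrow> case q of (w, h) \<Rightarrow>
     act_phase \<theta> g w * lam_pow \<theta> (real_of_int (snd v * fst (mapply g w))))"

definition cp_carrier :: "mat2 \<Rightarrow> (bidx \<Rightarrow> complex) set" where
  "cp_carrier \<gamma> = {x. finite {p. x p \<noteq> 0} \<and> (\<forall>p. x p \<noteq> 0 \<longrightarrow> snd p \<in> cyc_group \<gamma>)}"

definition cp_mult :: "real \<Rightarrow> (bidx \<Rightarrow> complex) \<Rightarrow> (bidx \<Rightarrow> complex) \<Rightarrow> (bidx \<Rightarrow> complex)" where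
  "cp_mult \<theta> x y = (\<lambda>r. \<Sum>p\<in>{p. x p \<noteq> 0}. \<Sum>q\<in>{q. y q \<noteq> 0}.
      if bmul_idx p q = r then x p * y q * bmul_coeff \<theta> p q else 0)"

text \<open>C^n(B,B*) = Hom(B^(x)n, B*) = Hom(B^(x)(n+1), C): multilinear functionals
  phi(b0, b1, ..., bn) = f(b1,...,bn)(b0), extended by 0 off B^(n+1).\<close>
definition cochains :: "mat2 \<Rightarrow> nat \<Rightarrow> ((bidx \<Rightarrow> complex) list \<Rightarrow> complex) set" where
  "cochains \<gamma> n = {\<phi>.
     (\<forall>xs. \<not> (length xs = Suc n \<and> set xs \<subseteq> cp_carrier \<gamma>) \<longrightarrow> \<phi> xs = 0) \<and>
     (\<forall>xs i x y a b. length xs = Suc n \<and> set xs \<subseteq> cp_carrier \<gamma> \<and> i \<le> n \<and>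
        x \<in> cp_carrier \<gamma> \<and> y \<in> cp_carrier \<gamma> \<longrightarrow>
        \<phi> (xs[i := (\<lambda>p. a * x p + b * y p)]) = a * \<phi> (xs[i := x]) + b * \<phi> (xs[i := y]))}"

text \<open>Hochschild differential d : C^n -> C^(n+1) for the bimodule B*, where
  (b.f.c)(x) = f(c x b):
  (d phi)(b0,...,b(n+1)) = sum_(i=0..n) (-1)^i phi(b0,...,bi b(i+1),...,b(n+1))
                          + (-1)^(n+1) phi(b(n+1) b0, b1, ..., bn).\<close>
definition hoch_d :: "real \<Rightarrow> mat2 \<Rightarrow> nat \<Rightarrow> ((bidx \<Rightarrow> complex) list \<Rightarrow> complex)
    \<Rightarrow> ((bidx \<Rightarrow> complex) list \<Rightarrow> complex)" where
  "hoch_d \<theta> \<gamma> n \<phi> = (\<lambda>xs. if length xs = n + 2 \<and> set xs \<subseteq> cp_carrier \<gamma> then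
      (\<Sum>i\<le>n. (-1) ^ i * \<phi> (take i xs @ [cp_mult \<theta> (xs ! i) (xs ! (i + 1))] @ drop (i + 2) xs))
      + (-1) ^ (n + 1) * \<phi> (cp_mult \<theta> (xs ! (n + 1)) (xs ! 0) # take n (drop 1 xs))
    else 0)"

definition cocycles :: "real \<Rightarrow> mat2 \<Rightarrow> nat \<Rightarrow> ((bidx \<Rightarrow> complex) list \<Rightarrow> complex) set" where
  "cocycles \<theta> \<gamma> n = {\<phi> \<in> cochains \<gamma> n. hoch_d \<theta> \<gamma> n \<phi> = (\<lambda>_. 0)}"

fun coboundaries :: "real \<Rightarrow> mat2 \<Rightarrow> nat \<Rightarrow> ((bidx \<Rightarrow> complex) list \<Rightarrow> complex) set" where
  "coboundaries \<theta> \<gamma> 0 = {\<lambda>_. 0}"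
| "coboundaries \<theta> \<gamma> (Suc n) = hoch_d \<theta> \<gamma> n ` cochains \<gamma> n"

definition quot_dim :: "('a \<Rightarrow> complex) set \<Rightarrow> ('a \<Rightarrow> complex) set \<Rightarrow> nat \<Rightarrow> bool" where
  "quot_dim Z Bd k = (\<exists>f :: nat \<Rightarrow> 'a \<Rightarrow> complex.
      (\<forall>i<k. f i \<in> Z) \<and>
      (\<forall>z\<in>Z. \<exists>c. (\<lambda>xs. z xs - (\<Sum>i<k. c i * f i xs)) \<in> Bd) \<and>
      (\<forall>c. (\<lambda>xs. \<Sum>i<k. c i * f i xs) \<in> Bd \<longrightarrow> (\<forall>i<k. c i = 0)))"

definition HH_dim :: "real \<Rightarrow> mat2 \<Rightarrow> nat \<Rightarrow> nat \<Rightarrow> bool" where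
  "HH_dim \<theta> \<gamma> n k = quot_dim (cocycles \<theta> \<gamma> n) (coboundaries \<theta> \<gamma> n) k"

end

theory Submission
  imports Defs "HOL-Library.Function_Algebras" "HOL-Library.Product_Plus"
begin

text \<open>In the basis \<open>W\<^sub>v \<otimes> g\<close>, with symmetrically ordered monomials \<open>W\<^sub>v\<close>, the crossed product is a
  twisted group algebra of the semidirect product \<open>G\<close> of \<open>\<int>\<^sup>2\<close> and \<open>\<Gamma>\<close>, with cocycle \<open>\<lambda>\<close> to the power \<open>-(v \<and> g w)/2\<close>. Evaluating a Hochschild
  cochain \<open>\<phi>\<close> at \<open>(e\<^sub>n\<^sup>-\<^sup>1 e\<^sub>x e\<^sub>0, e\<^sub>0\<^sup>-\<^sup>1 e\<^sub>1, \<dots>)\<close>, for basis elements \<open>e\<^sub>i\<close> with indices \<open>g\<^sub>0, \<dots>, g\<^sub>n\<close> in \<open>G\<close>,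
  turns the Hochschild differential into the simplicial coboundary on tuples of vertices \<open>g\<^sub>0, \<dots>, g\<^sub>n\<close> and identifies
  Hochschild cochains with \<open>G\<close>-equivariant simplicial cochains (\<open>x\<close> carries the twisted conjugation action). Without
  equivariance the simplicial complex is exact. Equivariance under the two generators of \<open>\<int>\<^sup>2\<close> is imposed one at a
  time: \<open>1 - T\<^sub>i\<close> is surjective on simplicial cochains because \<open>\<int>\<^sup>2\<close> acts freely on vertices, so a diagram
  chase gives exactness up to an obstruction living on functions of \<open>x\<close> alone. There \<open>\<int>\<^sup>2\<close> acts freely when the
  component of \<open>x\<close> in \<open>\<Gamma>\<close> is not \<open>1\<close>, and by a nontrivial character (as \<open>\<theta>\<close> is irrational) when \<open>x = (v, 1)\<close> with
  \<open>v \<noteq> 0\<close>; only \<open>x = 1\<close> contributes. Finally one averages over the finite group \<open>\<Gamma>\<close>. In degree 1 the surviving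
  obstruction is a \<open>\<Gamma>\<close>-invariant homomorphism \<open>\<int>\<^sup>2 \<rightarrow> \<complex>\<close>, hence zero; in degree 2 it is spanned by the area cocycle;
  in degree 0 one counts the conjugacy classes of \<open>G\<close> made of \<open>(0, 1)\<close> and of the \<open>(v, g)\<close> with \<open>g \<noteq> 1\<close>.\<close>

section \<open>A diagram chase\<close>

text \<open>The operators \<open>S1\<close> and \<open>S2\<close> will be \<open>1 - T\<close> for
  two generating translations, so their common kernel consists of the translation invariants.
  Surjectivity is demanded in positive degree only: degree 0 is the augmentation, where it can fail
  and where the obstructions live.\<close>

locale bicomplex_chase =
  fixes L :: "nat \<Rightarrow> 'e::ab_group_add set" and d S1 S2 :: "'e \<Rightarrow> 'e"
  assumes L_zero: "0 \<in> L n"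
    and L_diff: "x \<in> L n \<Longrightarrow> y \<in> L n \<Longrightarrow> x - y \<in> L n"
    and d_diff: "d (x - y) = d x - d y"
    and S1_diff: "S1 (x - y) = S1 x - S1 y"
    and S2_diff: "S2 (x - y) = S2 x - S2 y"
    and d_L: "x \<in> L n \<Longrightarrow> d x \<in> L (Suc n)"
    and S1_L: "x \<in> L n \<Longrightarrow> S1 x \<in> L n"
    and S2_L: "x \<in> L n \<Longrightarrow> S2 x \<in> L n"
    and d_d: "d (d x) = 0"
    and d_S1: "d (S1 x) = S1 (d x)"
    and d_S2: "d (S2 x) = S2 (d x)"
    and S1_S2: "S1 (S2 x) = S2 (S1 x)"
    and exact: "x \<in> L (Suc n) \<Longrightarrow> d x = 0 \<Longrightarrow> \<exists>y\<in>L n. d y = x"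
    and inj: "x \<in> L 0 \<Longrightarrow> d x = 0 \<Longrightarrow> x = 0"
    and surj1: "x \<in> L (Suc n) \<Longrightarrow> \<exists>y\<in>L (Suc n). S1 y = x"
    and surj2: "x \<in> L (Suc n) \<Longrightarrow> S1 x = 0 \<Longrightarrow> \<exists>y\<in>L (Suc n). S2 y = x \<and> S1 y = 0"
begin

lemma zero_simps [simp]: "d 0 = 0" "S1 0 = 0" "S2 0 = 0"
  using d_diff[of 0 0] S1_diff[of 0 0] S2_diff[of 0 0] by simp_all

lemma L_add: "x \<in> L n \<Longrightarrow> y \<in> L n \<Longrightarrow> x + y \<in> L n"
  using L_diff[of x n "0 - y"] L_diff[of 0 n y] L_zero by simp

lemma d_add: "d (x + y) = d x + d y"
  using d_diff[of x "0 - y"] d_diff[of 0 y] by simp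

lemma S1_add: "S1 (x + y) = S1 x + S1 y"
  using S1_diff[of x "0 - y"] S1_diff[of 0 y] by simp

lemma S2_add: "S2 (x + y) = S2 x + S2 y"
  using S2_diff[of x "0 - y"] S2_diff[of 0 y] by simp

text \<open>Two steps below degree \<open>n + 3\<close> the degree is still positive. Hence the
  \<open>k\<close> that measures the failure of \<open>S1 h = 0\<close> lifts through
  \<open>S1\<close>, and \<open>d l\<close> corrects the primitive \<open>h\<close>.\<close>

lemma exact_ker_S1:
  assumes "x \<in> L (n + 3)" "d x = 0" "S1 x = 0"
  shows "\<exists>y\<in>L (n + 2). d y = x \<and> S1 y = 0"
proof -
  obtain h where h: "h \<in> L (n + 2)" "d h = x"
    using exact[of x "n + 2"] assms by (auto simp: eval_nat_numeral)
  have "d (S1 h) = 0" using h assms by (simp add: d_S1)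
  then obtain k where k: "k \<in> L (n + 1)" "d k = S1 h"
    using exact[of "S1 h" "n + 1"] S1_L[OF h(1)] by (auto simp: eval_nat_numeral)
  obtain l where l: "l \<in> L (n + 1)" "S1 l = k" using surj1[of k n] k by auto
  show ?thesis
  proof (intro bexI conjI)
    show "h - d l \<in> L (n + 2)" using L_diff[OF h(1)] d_L[OF l(1)] by simp
    show "d (h - d l) = x" by (simp add: d_diff d_d h)
    show "S1 (h - d l) = 0" by (simp add: S1_diff d_S1[symmetric] l k)
  qed
qed

text \<open>The same correction inside the kernel of \<open>S1\<close>, where exactness is the
  previous lemma and lifting through \<open>S2\<close> is \<open>surj2\<close>.\<close>

lemma exact_ker_S1_S2:
  assumes "x \<in> L (n + 4)" "d x = 0" "S1 x = 0" "S2 x = 0"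
  shows "\<exists>y. d y = x \<and> S1 y = 0 \<and> S2 y = 0"
proof -
  obtain h where h: "h \<in> L (n + 3)" "d h = x" "S1 h = 0"
    using exact_ker_S1[of x "n + 1"] assms by (auto simp: eval_nat_numeral)
  have "d (S2 h) = 0" "S1 (S2 h) = 0" using h assms by (simp_all add: d_S2 S1_S2)
  then obtain l where l: "l \<in> L (n + 2)" "d l = S2 h" "S1 l = 0"
    using exact_ker_S1[of "S2 h" n] S2_L[OF h(1)] by auto
  obtain p where p: "S2 p = l" "S1 p = 0" using surj2[of l "n + 1"] l by auto
  have "d (h - d p) = x \<and> S1 (h - d p) = 0 \<and> S2 (h - d p) = 0"
    by (simp add: d_diff S1_diff S2_diff d_d d_S1[symmetric] d_S2[symmetric] h l p)
  then show ?thesis by blast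
qed

text \<open>A relation rather than a function, because the zigzag \<open>h\<close>,
  \<open>l\<close>, \<open>m\<close> involves choices. It concerns \<open>x\<close> in degree 3,
  where the last lift through \<open>S1\<close> would have to happen in degree 0.\<close>

definition obstruction :: "'e \<Rightarrow> 'e \<Rightarrow> bool" where
  "obstruction x m \<longleftrightarrow> m \<in> L 0 \<and>
     (\<exists>h\<in>L 2. \<exists>l\<in>L 1. d h = x \<and> S1 h = 0 \<and> d l = S2 h \<and> S1 l = d m)"

lemma obstruction_exists:
  assumes "x \<in> L 3" "d x = 0" "S1 x = 0" "S2 x = 0"
  shows "\<exists>m. obstruction x m"
proof -
  obtain h where h: "h \<in> L 2" "d h = x" "S1 h = 0"
    using exact_ker_S1[of x 0] assms by (auto simp: numeral_2_eq_2)
  have "d (S2 h) = 0" using h assms by (simp add: d_S2)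
  then obtain l where l: "l \<in> L 1" "d l = S2 h"
    using exact[of "S2 h" 1] S2_L[OF h(1)] by (auto simp: eval_nat_numeral)
  have "d (S1 l) = 0" using h l by (simp add: d_S1 S1_S2)
  then obtain m where "m \<in> L 0" "d m = S1 l"
    using exact[of "S1 l" 0] S1_L[OF l(1)] by auto
  with h l have "obstruction x m" unfolding obstruction_def by auto
  then show ?thesis ..
qed

lemma obstruction_diff:
  assumes "obstruction x m" "obstruction y k"
  shows "obstruction (x - y) (m - k)"
proof -
  obtain h l where 1: "h \<in> L 2" "l \<in> L 1" "d h = x" "S1 h = 0" "d l = S2 h" "S1 l = d m" "m \<in> L 0"
    using assms(1) unfolding obstruction_def by blast
  obtain h' l' where 2: "h' \<in> L 2" "l' \<in> L 1" "d h' = y" "S1 h' = 0" "d l' = S2 h'" "S1 l' = d k" "k \<in> L 0"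
    using assms(2) unfolding obstruction_def by blast
  have "h - h' \<in> L 2" "l - l' \<in> L 1" "d (h - h') = x - y" "S1 (h - h') = 0"
    "d (l - l') = S2 (h - h')" "S1 (l - l') = d (m - k)" "m - k \<in> L 0"
    using 1 2 by (simp_all add: L_diff d_diff S1_diff S2_diff)
  then show ?thesis unfolding obstruction_def by blast
qed

lemma obstruction_map:
  assumes "obstruction x m"
    and "\<And>n y. y \<in> L n \<Longrightarrow> f y \<in> L n" "\<And>y. d (f y) = f (d y)"
    and "\<And>y. S1 (f y) = f (S1 y)" "\<And>y. S2 (f y) = f (S2 y)" "f 0 = 0"
  shows "obstruction (f x) (f m)"
proof -
  obtain h l where 1: "h \<in> L 2" "l \<in> L 1" "d h = x" "S1 h = 0" "d l = S2 h" "S1 l = d m" "m \<in> L 0"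
    using assms(1) unfolding obstruction_def by blast
  have "f h \<in> L 2" "f l \<in> L 1" "d (f h) = f x" "S1 (f h) = 0"
    "d (f l) = S2 (f h)" "S1 (f l) = d (f m)" "f m \<in> L 0"
    using 1 assms by simp_all
  then show ?thesis unfolding obstruction_def by blast
qed

text \<open>The part \<open>S1 a\<close> is absorbed by changing \<open>l\<close> by
  \<open>d a\<close>. The part \<open>S2 b\<close> is absorbed by changing \<open>h\<close> by
  \<open>d p\<close> with \<open>S1 p = d b\<close>, which preserves \<open>S1 h = 0\<close> because
  \<open>d (d b) = 0\<close>. What remains of \<open>l\<close> lifts through \<open>S2\<close>
  within the kernel of \<open>S1\<close>.\<close>

lemma exact_if_obstruction_trivial:
  assumes "obstruction x (S1 a + S2 b)" "a \<in> L 0" "b \<in> L 0"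
  shows "\<exists>y. d y = x \<and> S1 y = 0 \<and> S2 y = 0"
proof -
  obtain h l where hl: "h \<in> L 2" "l \<in> L 1" "d h = x" "S1 h = 0" "d l = S2 h" "S1 l = d (S1 a + S2 b)"
    using assms(1) unfolding obstruction_def by blast
  obtain p where p: "p \<in> L 1" "S1 p = d b" using surj1[of "d b" 0] d_L[OF assms(3)] by auto
  define l' where "l' = l - d a - S2 p"
  have l'L: "l' \<in> L 1" unfolding l'_def
    using L_diff[OF L_diff[OF hl(2)] S2_L[OF p(1)]] d_L[OF assms(2)] by simp
  have S1l': "S1 l' = 0"
    by (simp add: l'_def S1_diff hl p S1_S2 d_add d_S1 d_S2)
  have dl': "d l' = S2 (h - d p)"
    by (simp add: l'_def d_diff S2_diff d_d hl d_S2)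
  obtain q where q: "S2 q = l'" "S1 q = 0" using surj2[of l' 0] l'L S1l' by auto
  have "d (h - d p - d q) = x" by (simp add: d_diff d_d hl)
  moreover have "S1 (h - d p - d q) = 0"
    by (simp add: S1_diff hl d_S1[symmetric] p q d_d)
  moreover have "S2 (h - d p - d q) = 0"
    using dl' by (simp add: S2_diff[of _ "d q"] d_S2[symmetric] q)
  ultimately show ?thesis by blast
qed

text \<open>The pair \<open>m1\<close>, \<open>m2\<close> is a 1-cocycle of the lattice with
  coefficients in degree 0. Its compatibility holds because both sides have the same image under the
  injective \<open>d\<close>.\<close>

lemma degree_one_primitive:
  assumes "x \<in> L 2" "d x = 0" "S1 x = 0" "S2 x = 0"
  obtains h m1 m2 where "h \<in> L 1" "d h = x" "m1 \<in> L 0" "m2 \<in> L 0"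
    "d m1 = S1 h" "d m2 = S2 h" "S2 m1 = S1 m2"
proof -
  obtain h where h: "h \<in> L 1" "d h = x"
    using exact[of x 1] assms by (auto simp: eval_nat_numeral)
  have "d (S1 h) = 0" "d (S2 h) = 0" using h assms by (simp_all add: d_S1 d_S2)
  then obtain m1 m2 where m: "m1 \<in> L 0" "d m1 = S1 h" "m2 \<in> L 0" "d m2 = S2 h"
    using exact[of "S1 h" 0] exact[of "S2 h" 0] S1_L[OF h(1)] S2_L[OF h(1)] by auto
  have "d (S2 m1 - S1 m2) = 0" by (simp add: d_diff d_S1 d_S2 m S1_S2)
  then have "S2 m1 - S1 m2 = 0" using inj[OF L_diff[OF S2_L[OF m(1)] S1_L[OF m(3)]]] by blast
  then show thesis using that h m by simp
qed

text \<open>If that cocycle is principal, given by \<open>a\<close>, then \<open>h - d a\<close> is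
  an invariant primitive.\<close>

lemma degree_one_exact:
  assumes "d h = x" "d (S1 a) = S1 h" "d (S2 a) = S2 h"
  shows "\<exists>y. d y = x \<and> S1 y = 0 \<and> S2 y = 0"
  by (rule exI[of _ "h - d a"]) (use assms in \<open>simp add: d_diff S1_diff S2_diff d_d d_S1 d_S2\<close>)

end

section \<open>Simplicial coboundary on tuples of vertices\<close>

primrec bd :: "('s list \<Rightarrow> complex) \<Rightarrow> 's list \<Rightarrow> complex" where
  "bd f [] = 0"
| "bd f (g # gs) = f gs - bd (\<lambda>l. f (g # l)) gs"

lemma bd_diff: "bd (\<lambda>l. f l - f' l) gs = bd f gs - bd f' gs"
  by (induction gs arbitrary: f f') simp_all

lemma bd_add: "bd (\<lambda>l. f l + f' l) gs = bd f gs + bd f' gs"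
  by (induction gs arbitrary: f f') simp_all

lemma bd_mult: "bd (\<lambda>l. c * f l) gs = c * bd f gs"
  by (induction gs arbitrary: f) (simp_all add: algebra_simps)

lemma bd_zero [simp]: "bd (\<lambda>l. 0) gs = 0"
  using bd_mult[of 0 "\<lambda>_. 0"] by simp

lemma bd_sum: "bd (\<lambda>l. \<Sum>i\<in>A. f i l) gs = (\<Sum>i\<in>A. bd (f i) gs)"
  by (induction A rule: infinite_finite_induct) (simp_all add: bd_add)

lemma bd_bd: "bd (bd f) gs = 0"
proof (induction gs arbitrary: f)
  case (Cons g gs)
  have "bd (bd f) (g # gs) = bd f gs - bd (\<lambda>l. f l - bd (\<lambda>l'. f (g # l')) l) gs" by simp
  also have "\<dots> = bd (bd (\<lambda>l'. f (g # l'))) gs" by (subst bd_diff) simp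
  finally show ?case using Cons by simp
qed simp

lemma bd_map: "bd (\<lambda>l. f (map t l)) gs = bd f (map t gs)"
  by (induction gs arbitrary: f) simp_all

text \<open>Allows a cochain to be replaced by one that agrees with it in a single degree and on
  vertices of \<open>G\<close> only.\<close>

lemma bd_cong:
  assumes "\<And>l. set l \<subseteq> set gs \<Longrightarrow> Suc (length l) = length gs \<Longrightarrow> f l = f' l"
  shows "bd f gs = bd f' gs"
  using assms
proof (induction gs arbitrary: f f')
  case (Cons g gs)
  have "bd (\<lambda>l. f (g # l)) gs = bd (\<lambda>l. f' (g # l)) gs"
    by (rule Cons.IH, rule Cons.prems) auto
  moreover have "f gs = f' gs" using Cons.prems[of gs] by auto
  ultimately show ?case by simp
qed simp

lemma bd_eq_sum: "bd f gs = (\<Sum>i<length gs. (-1) ^ i * f (take i gs @ drop (Suc i) gs))"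
proof (induction gs arbitrary: f)
  case (Cons g gs)
  show ?case
    by (simp add: Cons sum.lessThan_Suc_shift sum_negf del: sum.lessThan_Suc)
qed simp

section \<open>Basis monomials and cochains\<close>

definition wedge :: "int \<times> int \<Rightarrow> int \<times> int \<Rightarrow> int" where
  "wedge v w = fst v * snd w - snd v * fst w"

definition mdet :: "mat2 \<Rightarrow> int" where
  "mdet g = (case g of (a, b, c, d) \<Rightarrow> a * d - b * c)"

definition mtrace :: "mat2 \<Rightarrow> int" where
  "mtrace g = (case g of (a, b, c, d) \<Rightarrow> a + d)"

text \<open>The adjugate; it is a two-sided inverse once the determinant is 1.\<close>

definition minv :: "mat2 \<Rightarrow> mat2" where
  "minv g = (case g of (a, b, c, d) \<Rightarrow> (d, - b, - c, a))"

notation mapply (infixr "\<odot>" 75)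

lemma wedge_linear [simp]:
  "wedge (u + v) w = wedge u w + wedge v w" "wedge w (u + v) = wedge w u + wedge w v"
  "wedge (u - v) w = wedge u w - wedge v w" "wedge w (u - v) = wedge w u - wedge w v"
  "wedge (- u) w = - wedge u w" "wedge w (- u) = - wedge w u"
  "wedge 0 w = 0" "wedge w 0 = 0" "wedge w w = 0"
  by (simp_all add: wedge_def algebra_simps)

lemma wedge_commute: "wedge v w = - wedge w v"
  by (simp add: wedge_def)

lemma mapply_linear [simp]:
  "g \<odot> (u + v) = g \<odot> u + g \<odot> v" "g \<odot> (u - v) = g \<odot> u - g \<odot> v" "g \<odot> (- u) = - (g \<odot> u)" "g \<odot> 0 = 0"
  by (auto simp: mapply_def algebra_simps zero_prod_def split: prod.splits)

lemma mapply_mone [simp]: "mone \<odot> v = v"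
  by (simp add: mapply_def mone_def split: prod.splits)

lemma mapply_mmul: "mmul g h \<odot> v = g \<odot> h \<odot> v"
  by (simp add: mapply_def mmul_def algebra_simps split: prod.splits)

lemma wedge_mapply: "wedge (g \<odot> v) (g \<odot> w) = mdet g * wedge v w"
  by (simp add: wedge_def mapply_def mdet_def algebra_simps split: prod.splits)

lemma mmul_assoc: "mmul (mmul g h) k = mmul g (mmul h k)"
  by (simp add: mmul_def algebra_simps split: prod.splits)

lemma mmul_mone [simp]: "mmul mone g = g" "mmul g mone = g"
  by (simp_all add: mmul_def mone_def split: prod.splits)

lemma mmul_minv:
  assumes "mdet g = 1"
  shows "mmul g (minv g) = mone" "mmul (minv g) g = mone"
  using assms by (auto simp: mmul_def minv_def mone_def mdet_def algebra_simps split: prod.splits)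

text \<open>Cayley-Hamilton in the form \<open>g + g^-1 = tr g\<close>. It later forces
  \<open>\<Gamma>\<close>-invariant homomorphisms on the lattice to vanish.\<close>

lemma mapply_cayley_hamilton:
  assumes "mdet g = 1"
  shows "g \<odot> u + minv g \<odot> u = (mtrace g * fst u, mtrace g * snd u)"
  using assms by (auto simp: mapply_def minv_def mtrace_def algebra_simps split: prod.splits)

lemma mpow_add: "mpow g (m + n) = mmul (mpow g m) (mpow g n)"
  by (induction m) (simp_all add: mmul_assoc)

lemma lam_pow_add: "lam_pow \<theta> (s + t) = lam_pow \<theta> s * lam_pow \<theta> t"
  by (simp add: lam_pow_def cis_mult distrib_left)

lemma lam_pow_zero [simp]: "lam_pow \<theta> 0 = 1"
  by (simp add: lam_pow_def)

lemma lam_pow_nonzero [simp]: "lam_pow \<theta> s \<noteq> 0"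
  by (simp add: lam_pow_def)

lemma lam_pow_minus: "lam_pow \<theta> (- s) * lam_pow \<theta> s = 1" "lam_pow \<theta> s * lam_pow \<theta> (- s) = 1"
  using lam_pow_add[of \<theta> "-s" s] lam_pow_add[of \<theta> s "-s"] by simp_all

text \<open>Irrationality of \<open>\<theta>\<close> enters here: \<open>\<lambda>\<close> is not a
  root of unity.\<close>

lemma lam_pow_int_neq_1:
  assumes "\<theta> \<notin> \<rat>" "k \<noteq> 0"
  shows "lam_pow \<theta> (real_of_int k) \<noteq> 1"
proof
  assume "lam_pow \<theta> (real_of_int k) = 1"
  then have "cos (2 * pi * \<theta> * real_of_int k) = 1"
    by (simp add: lam_pow_def complex_eq_iff)
  then obtain m :: int where "2 * pi * \<theta> * real_of_int k = real_of_int m * 2 * pi"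
    by (auto simp: cos_one_2pi_int)
  then have "pi * (\<theta> * real_of_int k) = pi * real_of_int m" by (simp add: mult_ac)
  then have "\<theta> * real_of_int k = real_of_int m" by simp
  then have "\<theta> = real_of_int m / real_of_int k" using assms(2) by (simp add: field_simps)
  with assms(1) show False by simp
qed

text \<open>The product of scaled symmetric monomials with the phase kept as a real exponent, so
  that phase identities are checked by linear arithmetic on exponents.\<close>

definition ext_mult :: "real \<times> bidx \<Rightarrow> real \<times> bidx \<Rightarrow> real \<times> bidx" where
  "ext_mult A B = (fst A + fst B - real_of_int (wedge (fst (snd A)) (snd (snd A) \<odot> fst (snd B))) / 2,
     fst (snd A) + snd (snd A) \<odot> fst (snd B), mmul (snd (snd A)) (snd (snd B)))"

lemma bmul_idx_eq: "bmul_idx p q = (fst p + snd p \<odot> fst q, mmul (snd p) (snd q))"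
  by (auto simp: bmul_idx_def split: prod.splits)

definition half_phase :: "bidx \<Rightarrow> real" where
  "half_phase p = real_of_int (fst (fst p) * snd (fst p)) / 2"

text \<open>\<open>mon \<theta> (s, (v, g))\<close> is \<open>\<lambda>\<close> to the power \<open>s\<close>, times the symmetrically ordered monomial
  \<open>W\<^sub>v\<close> (\<open>\<lambda>\<close> to the power \<open>v\<^sub>1 v\<^sub>2 / 2\<close> times \<open>U\<^sub>1\<^sup>v\<^sup>1 U\<^sub>2\<^sup>v\<^sup>2\<close>), tensored with \<open>g\<close>.\<close>

definition mon :: "real \<Rightarrow> real \<times> bidx \<Rightarrow> bidx \<Rightarrow> complex" where
  "mon \<theta> A = (\<lambda>r. if r = snd A then lam_pow \<theta> (fst A + half_phase (snd A)) else 0)"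

lemma mon_support: "{p. mon \<theta> A p \<noteq> 0} = {snd A}"
  by (auto simp: mon_def)

lemma mon_scale: "mon \<theta> (s, p) = (\<lambda>r. lam_pow \<theta> s * mon \<theta> (0, p) r)"
  by (auto simp: mon_def lam_pow_add)

text \<open>Symmetric ordering absorbs \<open>act_phase\<close>: the matrix \<open>g\<close> carries
  \<open>W_w\<close> to \<open>W_(g w)\<close> without a phase. The reordering factor and the half
  phases then combine to half of a wedge.\<close>

lemma cp_mult_mon: "cp_mult \<theta> (mon \<theta> A) (mon \<theta> B) = mon \<theta> (ext_mult A B)"
proof
  fix r
  obtain s v1 v2 g where A: "A = (s, (v1, v2), g)" by (metis prod.exhaust)
  obtain t w h where B: "B = (t, w, h)" by (metis prod.exhaust)
  obtain w1 w2 where w: "w = (w1, w2)" by fastforce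
  obtain c d where cd: "g \<odot> (w1, w2) = (c, d)" by fastforce
  have 1: "s + half_phase ((v1, v2), g) + (t + half_phase (w, h)) +
      ((real_of_int (c * d) - real_of_int (w1 * w2)) / 2 + real_of_int (v2 * c)) =
      fst (ext_mult A B) + half_phase (snd (ext_mult A B))"
    by (simp add: A B cd w ext_mult_def half_phase_def wedge_def field_simps)
  have 2: "bmul_idx (snd A) (snd B) = snd (ext_mult A B)"
    by (simp add: A B bmul_idx_eq ext_mult_def)
  have 3: "mon \<theta> A (snd A) * mon \<theta> B (snd B) * bmul_coeff \<theta> (snd A) (snd B)
      = lam_pow \<theta> (fst (ext_mult A B) + half_phase (snd (ext_mult A B)))"
    unfolding 1[symmetric]
    by (simp add: lam_pow_add) (simp add: mon_def A B bmul_coeff_def act_phase_def cd w lam_pow_add)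
  show "cp_mult \<theta> (mon \<theta> A) (mon \<theta> B) r = mon \<theta> (ext_mult A B) r"
    unfolding cp_mult_def mon_support using 3 by (simp add: 2 mon_def)
qed

text \<open>The support of a linear combination may be smaller than the union of the supports.
  Summing over a common finite superset makes bilinearity of the product visible.\<close>

lemma cp_mult_superset:
  assumes "finite X" "finite Y" "{p. x p \<noteq> 0} \<subseteq> X" "{q. y q \<noteq> 0} \<subseteq> Y"
  shows "cp_mult \<theta> x y r = (\<Sum>p\<in>X. \<Sum>q\<in>Y. if bmul_idx p q = r then x p * y q * bmul_coeff \<theta> p q else 0)"
proof -
  have "(\<Sum>q\<in>{q. y q \<noteq> 0}. if bmul_idx p q = r then x p * y q * bmul_coeff \<theta> p q else 0)
      = (\<Sum>q\<in>Y. if bmul_idx p q = r then x p * y q * bmul_coeff \<theta> p q else 0)" for p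
    by (rule sum.mono_neutral_left) (use assms in auto)
  then have "cp_mult \<theta> x y r =
      (\<Sum>p\<in>{p. x p \<noteq> 0}. \<Sum>q\<in>Y. if bmul_idx p q = r then x p * y q * bmul_coeff \<theta> p q else 0)"
    unfolding cp_mult_def by (rule sum.cong[OF refl])
  also have "\<dots> = (\<Sum>p\<in>X. \<Sum>q\<in>Y. if bmul_idx p q = r then x p * y q * bmul_coeff \<theta> p q else 0)"
    by (rule sum.mono_neutral_left[OF assms(1,3)], intro ballI sum.neutral) simp
  finally show ?thesis .
qed

lemma cp_mult_linear_left:
  assumes "finite {p. x p \<noteq> 0}" "finite {p. y p \<noteq> 0}" "finite {p. z p \<noteq> 0}"
  shows "cp_mult \<theta> (\<lambda>p. a * x p + b * y p) z = (\<lambda>p. a * cp_mult \<theta> x z p + b * cp_mult \<theta> y z p)"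
proof
  fix r
  let ?X = "{p. x p \<noteq> 0} \<union> {p. y p \<noteq> 0}" and ?Z = "{p. z p \<noteq> 0}"
  have X: "finite ?X" using assms by auto
  note * = cp_mult_superset[OF X assms(3), where y = z and \<theta> = \<theta> and r = r]
  have "cp_mult \<theta> (\<lambda>p. a * x p + b * y p) z r =
    (\<Sum>p\<in>?X. \<Sum>q\<in>?Z. a * (if bmul_idx p q = r then x p * z q * bmul_coeff \<theta> p q else 0) +
      b * (if bmul_idx p q = r then y p * z q * bmul_coeff \<theta> p q else 0))"
    by (subst *) (auto intro!: sum.cong simp: distrib_left distrib_right mult.assoc)
  also have "\<dots> = a * cp_mult \<theta> x z r + b * cp_mult \<theta> y z r"
    unfolding *[of x, OF Un_upper1 order_refl] *[of y, OF Un_upper2 order_refl]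
    by (simp only: sum.distrib sum_distrib_left)
  finally show "cp_mult \<theta> (\<lambda>p. a * x p + b * y p) z r = a * cp_mult \<theta> x z r + b * cp_mult \<theta> y z r" .
qed

lemma cp_mult_linear_right:
  assumes "finite {p. x p \<noteq> 0}" "finite {p. y p \<noteq> 0}" "finite {p. z p \<noteq> 0}"
  shows "cp_mult \<theta> z (\<lambda>p. a * x p + b * y p) = (\<lambda>p. a * cp_mult \<theta> z x p + b * cp_mult \<theta> z y p)"
proof
  fix r
  let ?X = "{p. x p \<noteq> 0} \<union> {p. y p \<noteq> 0}" and ?Z = "{p. z p \<noteq> 0}"
  have X: "finite ?X" using assms by auto
  note * = cp_mult_superset[OF assms(3) X, where x = z and \<theta> = \<theta> and r = r]
  have "cp_mult \<theta> z (\<lambda>p. a * x p + b * y p) r =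
    (\<Sum>p\<in>?Z. \<Sum>q\<in>?X. a * (if bmul_idx p q = r then z p * x q * bmul_coeff \<theta> p q else 0) +
      b * (if bmul_idx p q = r then z p * y q * bmul_coeff \<theta> p q else 0))"
    by (subst *) (auto intro!: sum.cong simp: distrib_left distrib_right mult_ac)
  also have "\<dots> = a * cp_mult \<theta> z x r + b * cp_mult \<theta> z y r"
    unfolding *[of x, OF order_refl Un_upper1] *[of y, OF order_refl Un_upper2]
    by (simp only: sum.distrib sum_distrib_left)
  finally show "cp_mult \<theta> z (\<lambda>p. a * x p + b * y p) r = a * cp_mult \<theta> z x r + b * cp_mult \<theta> z y r" .
qed

lemma mmul_cyc_group: "g \<in> cyc_group \<gamma> \<Longrightarrow> h \<in> cyc_group \<gamma> \<Longrightarrow> mmul g h \<in> cyc_group \<gamma>"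
  by (auto simp: cyc_group_def mpow_add[symmetric])

lemma mone_cyc_group [simp]: "mone \<in> cyc_group \<gamma>"
  by (auto simp: cyc_group_def intro: range_eqI[of _ _ 0])

lemma mmul_commute: "g \<in> cyc_group \<gamma> \<Longrightarrow> h \<in> cyc_group \<gamma> \<Longrightarrow> mmul g h = mmul h g"
  by (auto simp: cyc_group_def mpow_add[symmetric] add.commute)

lemma cp_carrierD:
  "x \<in> cp_carrier \<gamma> \<Longrightarrow> finite {p. x p \<noteq> 0}" "x \<in> cp_carrier \<gamma> \<Longrightarrow> x p \<noteq> 0 \<Longrightarrow> snd p \<in> cyc_group \<gamma>"
  unfolding cp_carrier_def by blast+

lemma cp_mult_closed:
  assumes "x \<in> cp_carrier \<gamma>" "y \<in> cp_carrier \<gamma>"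
  shows "cp_mult \<theta> x y \<in> cp_carrier \<gamma>"
proof -
  have *: "\<exists>p q. x p \<noteq> 0 \<and> y q \<noteq> 0 \<and> r = bmul_idx p q" if "cp_mult \<theta> x y r \<noteq> 0" for r
  proof (rule ccontr)
    assume "\<not> ?thesis"
    then have "bmul_idx p q \<noteq> r" if "x p \<noteq> 0" "y q \<noteq> 0" for p q using that by blast
    then have "cp_mult \<theta> x y r = 0" unfolding cp_mult_def by simp
    with that show False by simp
  qed
  then have "{r. cp_mult \<theta> x y r \<noteq> 0} \<subseteq> (\<lambda>(p, q). bmul_idx p q) ` ({p. x p \<noteq> 0} \<times> {q. y q \<noteq> 0})"
    by fastforce
  then have "finite {r. cp_mult \<theta> x y r \<noteq> 0}"
    by (rule finite_subset) (use assms in \<open>auto simp: cp_carrier_def\<close>)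
  moreover have "snd r \<in> cyc_group \<gamma>" if "cp_mult \<theta> x y r \<noteq> 0" for r
  proof -
    from *[OF that] obtain p q where "x p \<noteq> 0" "y q \<noteq> 0" "r = bmul_idx p q" by blast
    then show ?thesis using cp_carrierD(2)[OF assms(1)] cp_carrierD(2)[OF assms(2)]
      by (simp add: bmul_idx_eq mmul_cyc_group del: split_paired_All)
  qed
  ultimately show ?thesis by (simp add: cp_carrier_def del: split_paired_All)
qed

lemma cp_carrier_linear:
  assumes "x \<in> cp_carrier \<gamma>" "y \<in> cp_carrier \<gamma>"
  shows "(\<lambda>p. a * x p + b * y p) \<in> cp_carrier \<gamma>"
proof -
  have "{p. a * x p + b * y p \<noteq> 0} \<subseteq> {p. x p \<noteq> 0} \<union> {p. y p \<noteq> 0}" by auto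
  then have "finite {p. a * x p + b * y p \<noteq> 0}"
    by (rule finite_subset) (use assms in \<open>auto simp: cp_carrier_def\<close>)
  moreover have "snd p \<in> cyc_group \<gamma>" if "a * x p + b * y p \<noteq> 0" for p
    using that cp_carrierD(2)[OF assms(1), of p] cp_carrierD(2)[OF assms(2), of p] by fastforce
  ultimately show ?thesis by (simp add: cp_carrier_def del: split_paired_All)
qed

lemma mon_carrier: "snd (snd A) \<in> cyc_group \<gamma> \<Longrightarrow> mon \<theta> A \<in> cp_carrier \<gamma>"
  unfolding cp_carrier_def mon_support by (simp add: mon_def del: split_paired_All)

section \<open>Multilinear cochains and their values on basis monomials\<close>

lemma cochains_off: "\<phi> \<in> cochains \<gamma> n \<Longrightarrow> \<not> (length xs = Suc n \<and> set xs \<subseteq> cp_carrier \<gamma>) \<Longrightarrow> \<phi> xs = 0"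
  unfolding cochains_def by blast

lemma cochains_linear:
  assumes "\<phi> \<in> cochains \<gamma> n" "length xs = Suc n" "set xs \<subseteq> cp_carrier \<gamma>" "i \<le> n"
    "x \<in> cp_carrier \<gamma>" "y \<in> cp_carrier \<gamma>"
  shows "\<phi> (xs[i := (\<lambda>p. a * x p + b * y p)]) = a * \<phi> (xs[i := x]) + b * \<phi> (xs[i := y])"
  using assms unfolding cochains_def by blast

lemma linear_eqI:
  assumes f: "\<And>x y a b. x \<in> cp_carrier \<gamma> \<Longrightarrow> y \<in> cp_carrier \<gamma> \<Longrightarrow>
      f (\<lambda>p. a * x p + b * y p) = a * f x + b * f y"
    and g: "\<And>x y a b. x \<in> cp_carrier \<gamma> \<Longrightarrow> y \<in> cp_carrier \<gamma> \<Longrightarrow>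
      g (\<lambda>p. a * x p + b * y p) = a * g x + b * g y"
    and eq: "\<And>p. snd p \<in> cyc_group \<gamma> \<Longrightarrow> f (mon \<theta> (0, p)) = g (mon \<theta> (0, p))"
    and x: "x \<in> cp_carrier \<gamma>"
  shows "f x = (g x :: complex)"
proof -
  have "finite S \<Longrightarrow> \<forall>x. x \<in> cp_carrier \<gamma> \<longrightarrow> {p. x p \<noteq> 0} \<subseteq> S \<longrightarrow> f x = g x" for S
  proof (induction S rule: finite_induct)
    case empty
    show ?case
    proof (intro allI impI)
      fix x assume x: "x \<in> cp_carrier \<gamma>" and "{p. x p \<noteq> 0} \<subseteq> {}"
      then have "x = (\<lambda>p. 0 * x p + 0 * x p)" by auto
      then show "f x = g x" using f[OF x x, of 0 0] g[OF x x, of 0 0] by simp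
    qed
  next
    case (insert p S)
    show ?case
    proof (intro allI impI)
      fix x assume x: "x \<in> cp_carrier \<gamma>" and sub: "{p. x p \<noteq> 0} \<subseteq> insert p S"
      show "f x = g x"
      proof (cases "x p = 0")
        case True
        then have "{p. x p \<noteq> 0} \<subseteq> S" using sub by auto
        then show ?thesis using insert x by blast
      next
        case False
        then have p: "snd p \<in> cyc_group \<gamma>" using x cp_carrierD by blast
        have m: "mon \<theta> (0, p) \<in> cp_carrier \<gamma>" using p by (simp add: mon_carrier)
        let ?y = "x(p := 0)"
        have "{q. ?y q \<noteq> 0} \<subseteq> {q. x q \<noteq> 0}" by auto
        then have y: "?y \<in> cp_carrier \<gamma>" using x
          by (auto simp: cp_carrier_def intro: finite_subset)
        have "{q. ?y q \<noteq> 0} \<subseteq> S" using sub by auto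
        then have fg: "f ?y = g ?y" using insert y by blast
        \<comment> \<open>The monomial \<open>mon \<theta> (0, p)\<close> has the coefficient
          \<open>lam_pow \<theta> (half_phase p)\<close> at \<open>p\<close>, which is divided
          out.\<close>
        define c where "c = x p * lam_pow \<theta> (- half_phase p)"
        have x_eq: "(\<lambda>q. 1 * ?y q + c * mon \<theta> (0, p) q) = x"
          by (rule ext) (simp add: mon_def c_def lam_pow_minus mult.assoc)
        show ?thesis using f[OF y m, of 1 c] g[OF y m, of 1 c] fg eq[OF p] unfolding x_eq by simp
      qed
    qed
  qed
  then show ?thesis using x cp_carrierD(1) by blast
qed

definition basis_list :: "real \<Rightarrow> bidx list \<Rightarrow> (bidx \<Rightarrow> complex) list" where
  "basis_list \<theta> ps = map (\<lambda>p. mon \<theta> (0, p)) ps"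

lemma cochains_eqI:
  assumes \<phi>: "\<phi> \<in> cochains \<gamma> n" and \<psi>: "\<psi> \<in> cochains \<gamma> n"
    and eq: "\<And>ps. length ps = Suc n \<Longrightarrow> snd ` set ps \<subseteq> cyc_group \<gamma> \<Longrightarrow>
      \<phi> (basis_list \<theta> ps) = \<psi> (basis_list \<theta> ps)"
  shows "\<phi> = \<psi>"
proof
  fix xs
  let ?b = "(\<lambda>p. mon \<theta> (0, p)) ` {p. snd p \<in> cyc_group \<gamma>}"
  have bc: "?b \<subseteq> cp_carrier \<gamma>" by (auto intro: mon_carrier)
  \<comment> \<open>The first \<open>j\<close> slots are arbitrary, the later ones hold basis
    monomials. Each induction step frees one more slot by linearity.\<close>
  have *: "\<forall>xs. length xs = Suc n \<longrightarrow> set xs \<subseteq> cp_carrier \<gamma> \<longrightarrow>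
      (\<forall>i<Suc n. j \<le> i \<longrightarrow> xs ! i \<in> ?b) \<longrightarrow> \<phi> xs = \<psi> xs" for j
  proof (induction j)
    case 0
    show ?case
    proof (intro allI impI)
      fix xs assume l: "length xs = Suc n" and "\<forall>i<Suc n. 0 \<le> i \<longrightarrow> xs ! i \<in> ?b"
      then have "xs \<in> lists ?b" by (auto simp: in_set_conv_nth)
      then obtain ps where "ps \<in> lists {p. snd p \<in> cyc_group \<gamma>}" "xs = basis_list \<theta> ps"
        unfolding lists_image basis_list_def by blast
      then show "\<phi> xs = \<psi> xs" using eq[of ps] l by (auto simp: basis_list_def)
    qed
  next
    case (Suc j)
    show ?case
    proof (intro allI impI)
      fix xs assume l: "length xs = Suc n" and c: "set xs \<subseteq> cp_carrier \<gamma>"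
        and b: "\<forall>i<Suc n. Suc j \<le> i \<longrightarrow> xs ! i \<in> ?b"
      show "\<phi> xs = \<psi> xs"
      proof (cases "j \<le> n")
        case False
        then show ?thesis using Suc l c by auto
      next
        case True
        have "\<phi> (xs[j := xs ! j]) = \<psi> (xs[j := xs ! j])"
        proof (rule linear_eqI[where f = "\<lambda>x. \<phi> (xs[j := x])" and g = "\<lambda>x. \<psi> (xs[j := x])" and \<gamma> = \<gamma> and \<theta> = \<theta>])
          show "xs ! j \<in> cp_carrier \<gamma>" using c l True by (simp add: subsetD)
        next
          fix p :: bidx assume p: "snd p \<in> cyc_group \<gamma>"
          have "set (xs[j := mon \<theta> (0, p)]) \<subseteq> cp_carrier \<gamma>"
            using c p by (intro set_update_subsetI mon_carrier) auto
          moreover have "xs[j := mon \<theta> (0, p)] ! i \<in> ?b" if "i < Suc n" "j \<le> i" for i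
            using b p l that by (cases "i = j") simp_all
          ultimately show "\<phi> (xs[j := mon \<theta> (0, p)]) = \<psi> (xs[j := mon \<theta> (0, p)])"
            using Suc l by simp
        qed (use cochains_linear[OF \<phi> l c True] cochains_linear[OF \<psi> l c True] in blast)+
        then show ?thesis by simp
      qed
    qed
  qed
  show "\<phi> xs = \<psi> xs"
  proof (cases "length xs = Suc n \<and> set xs \<subseteq> cp_carrier \<gamma>")
    case True
    then show ?thesis using *[of "Suc n"] by auto
  next
    case False
    then show ?thesis using cochains_off[OF \<phi>] cochains_off[OF \<psi>] by metis
  qed
qed

text \<open>Multilinear extension of values \<open>K\<close> prescribed on basis tuples. The factor
  with \<open>half_phase\<close> converts coordinates with respect to the \<open>U^v\<close> into
  coordinates with respect to the symmetric monomials.\<close>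

primrec multilin :: "real \<Rightarrow> (bidx list \<Rightarrow> complex) \<Rightarrow> (bidx \<Rightarrow> complex) list \<Rightarrow> complex" where
  "multilin \<theta> K [] = K []"
| "multilin \<theta> K (x # xs) =
    (\<Sum>p\<in>{p. x p \<noteq> 0}. x p * (lam_pow \<theta> (- half_phase p) * multilin \<theta> (\<lambda>ps. K (p # ps)) xs))"

lemma sum_support_linear:
  assumes "finite {p. x p \<noteq> 0}" "finite {p. y p \<noteq> 0}"
  shows "(\<Sum>p\<in>{p. a * x p + b * y p \<noteq> 0}. (a * x p + b * y p) * c p) =
    a * (\<Sum>p\<in>{p. x p \<noteq> 0}. x p * c p) + b * (\<Sum>p\<in>{p. y p \<noteq> (0::complex)}. y p * c p)"
proof -
  let ?S = "{p. x p \<noteq> 0} \<union> {p. y p \<noteq> 0}"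
  have S: "finite ?S" using assms by simp
  have 1: "(\<Sum>p\<in>{p. a * x p + b * y p \<noteq> 0}. (a * x p + b * y p) * c p) = (\<Sum>p\<in>?S. (a * x p + b * y p) * c p)"
    by (rule sum.mono_neutral_left[OF S]) auto
  have 2: "(\<Sum>p\<in>{p. x p \<noteq> 0}. x p * c p) = (\<Sum>p\<in>?S. x p * c p)"
    by (rule sum.mono_neutral_left[OF S]) auto
  have 3: "(\<Sum>p\<in>{p. y p \<noteq> 0}. y p * c p) = (\<Sum>p\<in>?S. y p * c p)"
    by (rule sum.mono_neutral_left[OF S]) auto
  show ?thesis unfolding 1 2 3 by (simp add: algebra_simps sum.distrib sum_distrib_left)
qed

lemma multilin_linear:
  assumes "i < length xs" "finite {p. x p \<noteq> 0}" "finite {p. y p \<noteq> 0}"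
  shows "multilin \<theta> K (xs[i := (\<lambda>p. a * x p + b * y p)]) =
    a * multilin \<theta> K (xs[i := x]) + b * multilin \<theta> K (xs[i := y])"
  using assms(1)
proof (induction xs arbitrary: i K)
  case (Cons z zs)
  show ?case
  proof (cases i)
    case 0
    show ?thesis using sum_support_linear[OF assms(2,3)] by (simp add: 0)
  next
    case (Suc j)
    then have "j < length zs" using Cons by simp
    from Cons.IH[OF this] show ?thesis
      by (simp add: Suc algebra_simps sum.distrib sum_distrib_left)
  qed
qed simp

lemma multilin_basis: "multilin \<theta> K (basis_list \<theta> ps) = K ps"
proof (induction ps arbitrary: K)
  case (Cons p ps)
  show ?case using Cons
    by (simp add: basis_list_def mon_support, simp add: mon_def mult.assoc[symmetric] lam_pow_minus)
qed (simp add: basis_list_def)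

lemma cochains_exists:
  obtains \<phi> where "\<phi> \<in> cochains \<gamma> n"
    "\<And>ps. length ps = Suc n \<Longrightarrow> snd ` set ps \<subseteq> cyc_group \<gamma> \<Longrightarrow> \<phi> (basis_list \<theta> ps) = K ps"
proof
  let ?\<phi> = "\<lambda>xs. if length xs = Suc n \<and> set xs \<subseteq> cp_carrier \<gamma> then multilin \<theta> K xs else 0"
  show "?\<phi> \<in> cochains \<gamma> n"
    unfolding cochains_def
  proof (intro CollectI conjI allI impI)
    fix xs i x y and a b :: complex
    assume *: "length xs = Suc n \<and> set xs \<subseteq> cp_carrier \<gamma> \<and> i \<le> n \<and> x \<in> cp_carrier \<gamma> \<and> y \<in> cp_carrier \<gamma>"
    then have "set (xs[i := x]) \<subseteq> cp_carrier \<gamma>" "set (xs[i := y]) \<subseteq> cp_carrier \<gamma>"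
      "set (xs[i := (\<lambda>p. a * x p + b * y p)]) \<subseteq> cp_carrier \<gamma>"
      by (intro set_update_subsetI cp_carrier_linear; simp)+
    then show "?\<phi> (xs[i := (\<lambda>p. a * x p + b * y p)]) = a * ?\<phi> (xs[i := x]) + b * ?\<phi> (xs[i := y])"
      using * multilin_linear[of i xs x y \<theta> K a b] cp_carrierD(1)[of x \<gamma>] cp_carrierD(1)[of y \<gamma>] by simp
  qed auto
  fix ps :: "bidx list" assume "length ps = Suc n" "snd ` set ps \<subseteq> cyc_group \<gamma>"
  then show "?\<phi> (basis_list \<theta> ps) = K ps"
    using multilin_basis[of \<theta> K ps] by (auto simp: basis_list_def intro!: mon_carrier)
qed

lemma cochains_mon:
  assumes \<phi>: "\<phi> \<in> cochains \<gamma> n" and l: "length As = Suc n"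
    and G: "(snd \<circ> snd) ` set As \<subseteq> cyc_group \<gamma>"
  shows "\<phi> (map (mon \<theta>) As) = lam_pow \<theta> (sum_list (map fst As)) * \<phi> (basis_list \<theta> (map snd As))"
proof -
  \<comment> \<open>The slots of \<open>Bs\<close> have been stripped of their phases, those of
    \<open>Cs\<close> still carry them. The induction moves one slot at a time across the
    boundary.\<close>
  have "\<phi> (map (mon \<theta>) (map (\<lambda>A. (0, snd A)) Bs @ Cs)) * lam_pow \<theta> (sum_list (map fst Bs)) =
      \<phi> (map (mon \<theta>) (Bs @ Cs))" if "Bs @ Cs = As" for Bs Cs
    using that
  proof (induction Bs arbitrary: Cs rule: rev_induct)
    case (snoc B Bs)
    let ?xs = "map (mon \<theta>) (map (\<lambda>A. (0, snd A)) Bs @ (B # Cs))"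
    let ?i = "length Bs"
    have i: "?i \<le> n" using l snoc.prems by auto
    have m: "mon \<theta> (0, snd B) \<in> cp_carrier \<gamma>" using G snoc.prems by (intro mon_carrier) auto
    have "snd (snd A) \<in> cyc_group \<gamma>" if "A \<in> set Bs \<union> set (B # Cs)" for A
      using G that unfolding snoc.prems[symmetric] by (simp add: image_subset_iff) blast
    then have c: "set ?xs \<subseteq> cp_carrier \<gamma>" by (simp add: image_subset_iff mon_carrier)
    have len: "length ?xs = Suc n" using l snoc.prems by auto
    have "\<phi> (?xs[?i := (\<lambda>p. lam_pow \<theta> (fst B) * mon \<theta> (0, snd B) p + 0 * mon \<theta> (0, snd B) p)]) =
       lam_pow \<theta> (fst B) * \<phi> (?xs[?i := mon \<theta> (0, snd B)])"
      by (subst cochains_linear[OF \<phi> len c i m m]) simp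
    moreover have "(\<lambda>p. lam_pow \<theta> (fst B) * mon \<theta> (0, snd B) p + 0 * mon \<theta> (0, snd B) p) = mon \<theta> B"
      using mon_scale[of \<theta> "fst B" "snd B"] by simp
    ultimately have "\<phi> ?xs = lam_pow \<theta> (fst B) * \<phi> (map (mon \<theta>) (map (\<lambda>A. (0, snd A)) (Bs @ [B]) @ Cs))"
      by (simp add: list_update_append)
    moreover have "\<phi> ?xs * lam_pow \<theta> (sum_list (map fst Bs)) = \<phi> (map (mon \<theta>) (Bs @ B # Cs))"
      using snoc.IH[of "B # Cs"] snoc.prems by simp
    ultimately show ?case by (simp add: lam_pow_add mult_ac)
  qed simp
  from this[of As "[]"] show ?thesis by (simp add: basis_list_def o_def mult.commute)
qed

text \<open>Each face in \<open>hoch_d\<close>, seen as a function of one argument, is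
  \<open>\<phi>\<close> after a linear map \<open>T\<close> in a single slot: the identity or
  multiplication by a fixed element.\<close>

lemma cochains_linear_slot:
  assumes \<phi>: "\<phi> \<in> cochains \<gamma> n" and l: "length ys = Suc n" and c: "set ys \<subseteq> cp_carrier \<gamma>" and j: "j \<le> n"
    and T: "\<And>z. z \<in> cp_carrier \<gamma> \<Longrightarrow> T z \<in> cp_carrier \<gamma>"
    and TL: "T (\<lambda>p. a * x p + b * y p) = (\<lambda>p. a * T x p + b * T y p)"
    and x: "x \<in> cp_carrier \<gamma>" and y: "y \<in> cp_carrier \<gamma>"
    and f: "\<And>z. z \<in> cp_carrier \<gamma> \<Longrightarrow> f z = \<phi> (ys[j := T z])"
  shows "f (\<lambda>p. a * x p + b * y p) = a * f x + b * f y"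
  using cochains_linear[OF \<phi> l c j T[OF x] T[OF y], of a b] f[OF x] f[OF y]
    f[OF cp_carrier_linear[OF x y, of a b]] TL by simp

lemma hoch_d_cochains:
  assumes \<phi>: "\<phi> \<in> cochains \<gamma> n"
  shows "hoch_d \<theta> \<gamma> n \<phi> \<in> cochains \<gamma> (Suc n)"
  unfolding cochains_def
proof (intro CollectI conjI allI impI)
  fix xs assume "\<not> (length xs = Suc (Suc n) \<and> set xs \<subseteq> cp_carrier \<gamma>)"
  then show "hoch_d \<theta> \<gamma> n \<phi> xs = 0" by (auto simp: hoch_d_def)
next
  fix xs i x y and a b :: complex
  assume *: "length xs = Suc (Suc n) \<and> set xs \<subseteq> cp_carrier \<gamma> \<and> i \<le> Suc n \<and> x \<in> cp_carrier \<gamma> \<and> y \<in> cp_carrier \<gamma>"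
  let ?B = "cp_carrier \<gamma>"
  from * have l: "length xs = Suc (Suc n)" and c: "set xs \<subseteq> ?B" and i: "i \<le> Suc n"
    and x: "x \<in> ?B" and y: "y \<in> ?B" by auto
  have nth: "xs ! k \<in> ?B" if "k < Suc (Suc n)" for k using l c that by (auto intro: subsetD[OF _ nth_mem])
  define M where "M k xs = take k xs @ [cp_mult \<theta> (xs ! k) (xs ! (k + 1))] @ drop (k + 2) xs" for k and xs :: "(bidx \<Rightarrow> complex) list"
  define C where "C xs = cp_mult \<theta> (xs ! (n + 1)) (xs ! 0) # take n (drop 1 xs)" for xs :: "(bidx \<Rightarrow> complex) list"
  note lin = cp_mult_linear_left[OF cp_carrierD(1)[OF x] cp_carrierD(1)[OF y] cp_carrierD(1)[OF nth], of _ \<theta> a b]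
     cp_mult_linear_right[OF cp_carrierD(1)[OF x] cp_carrierD(1)[OF y] cp_carrierD(1)[OF nth], of _ \<theta> a b]
  have Mk: "length (M k xs) = Suc n" "set (M k xs) \<subseteq> ?B" if "k \<le> n" for k
    using l c that by (auto simp: M_def intro!: cp_mult_closed nth dest: in_set_takeD in_set_dropD)
  have Mlin: "\<phi> (M k (xs[i := (\<lambda>p. a * x p + b * y p)])) = a * \<phi> (M k (xs[i := x])) + b * \<phi> (M k (xs[i := y]))"
    if k: "k \<le> n" for k
  proof -
    \<comment> \<open>Argument \<open>i\<close> lies before the merged pair, is its left or its
      right factor, or lies after it. In the last case it moves to position
      \<open>i - 1\<close>.\<close>
    consider "i < k" | "i = k" | "i = k + 1" | "i > k + 1" by linarith
    then show ?thesis
    proof cases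
      case 1
      show ?thesis
        by (rule cochains_linear_slot[OF \<phi> Mk[OF k], where j = i and T = "\<lambda>z. z" and f = "\<lambda>z. \<phi> (M k (xs[i := z]))"])
          (use 1 k x y l in \<open>auto simp: M_def take_update_swap list_update_append\<close>)
    next
      case 2
      show ?thesis
        by (rule cochains_linear_slot[OF \<phi> Mk[OF k], where j = k and T = "\<lambda>z. cp_mult \<theta> z (xs ! (k + 1))" and f = "\<lambda>z. \<phi> (M k (xs[i := z]))"])
          (use 2 k x y l lin(1)[of "k + 1"] in \<open>auto simp: M_def list_update_append intro!: cp_mult_closed nth\<close>)
    next
      case 3
      show ?thesis
        by (rule cochains_linear_slot[OF \<phi> Mk[OF k], where j = k and T = "\<lambda>z. cp_mult \<theta> (xs ! k) z" and f = "\<lambda>z. \<phi> (M k (xs[i := z]))"])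
          (use 3 k x y l lin(2)[of k] in \<open>auto simp: M_def list_update_append intro!: cp_mult_closed nth\<close>)
    next
      case 4
      from less_imp_Suc_add[OF 4] obtain j where j: "i = Suc (Suc (k + j))" by auto
      show ?thesis
        by (rule cochains_linear_slot[OF \<phi> Mk[OF k], where j = "i - 1" and T = "\<lambda>z. z" and f = "\<lambda>z. \<phi> (M k (xs[i := z]))"])
          (use j k i x y l in \<open>auto simp: M_def drop_update_swap list_update_append Suc_diff_le\<close>)
    qed
  qed
  have CL: "length (C xs) = Suc n" "set (C xs) \<subseteq> ?B"
    using l c by (auto simp: C_def intro!: cp_mult_closed nth dest: in_set_takeD in_set_dropD)
  have Clin: "\<phi> (C (xs[i := (\<lambda>p. a * x p + b * y p)])) = a * \<phi> (C (xs[i := x])) + b * \<phi> (C (xs[i := y]))"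
  proof -
    \<comment> \<open>In the cyclic face the arguments \<open>n + 1\<close> and \<open>0\<close> are
      the left and the right factor of slot 0.\<close>
    consider "i = 0" | "i = n + 1" | "0 < i" "i < n + 1" using i by linarith
    then show ?thesis
    proof cases
      case 1
      show ?thesis
        by (rule cochains_linear_slot[OF \<phi> CL, where j = 0 and T = "\<lambda>z. cp_mult \<theta> (xs ! (n + 1)) z" and f = "\<lambda>z. \<phi> (C (xs[i := z]))"])
          (use 1 x y l lin(2)[of "n + 1"] in \<open>auto simp: C_def drop_update_swap intro!: cp_mult_closed nth\<close>)
    next
      case 2
      show ?thesis
        by (rule cochains_linear_slot[OF \<phi> CL, where j = 0 and T = "\<lambda>z. cp_mult \<theta> z (xs ! 0)" and f = "\<lambda>z. \<phi> (C (xs[i := z]))"])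
          (use 2 x y l lin(1)[of 0] in \<open>auto simp: C_def drop_update_swap take_update_swap list_update_beyond intro!: cp_mult_closed nth\<close>)
    next
      case 3
      show ?thesis
        by (rule cochains_linear_slot[OF \<phi> CL, where j = i and T = "\<lambda>z. z" and f = "\<lambda>z. \<phi> (C (xs[i := z]))"])
          (use 3 x y l in \<open>auto simp: C_def drop_update_swap take_update_swap split: nat.splits\<close>)
    qed
  qed
  have H: "hoch_d \<theta> \<gamma> n \<phi> (xs[i := z]) = (\<Sum>k\<le>n. (-1) ^ k * \<phi> (M k (xs[i := z]))) + (-1) ^ (n + 1) * \<phi> (C (xs[i := z]))"
    if "z \<in> ?B" for z
    using l set_update_subsetI[OF c that] by (simp add: hoch_d_def M_def C_def)
  show "hoch_d \<theta> \<gamma> n \<phi> (xs[i := (\<lambda>p. a * x p + b * y p)]) = a * hoch_d \<theta> \<gamma> n \<phi> (xs[i := x]) + b * hoch_d \<theta> \<gamma> n \<phi> (xs[i := y])"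
  proof -
    have "(\<Sum>k\<le>n. (-1) ^ k * \<phi> (M k (xs[i := (\<lambda>p. a * x p + b * y p)]))) =
        (\<Sum>k\<le>n. a * ((-1) ^ k * \<phi> (M k (xs[i := x]))) + b * ((-1) ^ k * \<phi> (M k (xs[i := y]))))"
      by (rule sum.cong[OF refl]) (simp only: atMost_iff Mlin, simp add: distrib_left mult_ac)
    then show ?thesis
      unfolding H[OF x] H[OF y] H[OF cp_carrier_linear[OF x y]] Clin
      by (simp only: sum.distrib sum_distrib_left[symmetric]) (simp add: algebra_simps)
  qed
qed

lemma cochains_lincomb:
  assumes "\<phi> \<in> cochains \<gamma> n" "\<psi> \<in> cochains \<gamma> n"
  shows "(\<lambda>xs. a * \<phi> xs + b * \<psi> xs) \<in> cochains \<gamma> n"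
proof -
  have "a * \<phi> (xs[i := \<lambda>p. a' * x p + b' * y p]) + b * \<psi> (xs[i := \<lambda>p. a' * x p + b' * y p]) =
      a' * (a * \<phi> (xs[i := x]) + b * \<psi> (xs[i := x])) + b' * (a * \<phi> (xs[i := y]) + b * \<psi> (xs[i := y]))"
    if "length xs = Suc n \<and> set xs \<subseteq> cp_carrier \<gamma> \<and> i \<le> n \<and> x \<in> cp_carrier \<gamma> \<and> y \<in> cp_carrier \<gamma>"
    for xs i x y a' b'
    using that cochains_linear[OF assms(1), of xs i x y a' b'] cochains_linear[OF assms(2), of xs i x y a' b']
    by (simp add: distrib_left mult_ac)
  moreover have "a * \<phi> xs + b * \<psi> xs = 0" if "\<not> (length xs = Suc n \<and> set xs \<subseteq> cp_carrier \<gamma>)" for xs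
    using cochains_off[OF assms(1) that] cochains_off[OF assms(2) that] by simp
  ultimately show ?thesis unfolding cochains_def by blast
qed

lemma hoch_d_lincomb:
  "hoch_d \<theta> \<gamma> n (\<lambda>xs. a * \<phi> xs + b * \<psi> xs) = (\<lambda>xs. a * hoch_d \<theta> \<gamma> n \<phi> xs + b * hoch_d \<theta> \<gamma> n \<psi> xs)"
  by (rule ext) (simp add: hoch_d_def algebra_simps sum.distrib sum_distrib_left)

section \<open>From Hochschild cochains to equivariant simplicial cochains\<close>

lemma mdet_minv [simp]: "mdet (minv g) = mdet g"
  by (simp add: mdet_def minv_def algebra_simps split: prod.splits)

lemma minv_mmul: "minv (mmul g h) = mmul (minv h) (minv g)"
  by (simp add: minv_def mmul_def algebra_simps split: prod.splits)

text \<open>For determinant 1 one has \<open>det (g - 1) = 2 - tr g\<close>, so \<open>trace\<close>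
  says that elements other than \<open>mone\<close> fix no nonzero vector. The assumption
  \<open>nontrivial\<close> excludes invariant homomorphisms in degree 1.\<close>

locale finite_sl2 =
  fixes \<theta> :: real and \<gamma> :: mat2
  assumes irrational: "\<theta> \<notin> \<rat>"
    and fin: "finite (cyc_group \<gamma>)"
    and det: "g \<in> cyc_group \<gamma> \<Longrightarrow> mdet g = 1"
    and minv_closed: "g \<in> cyc_group \<gamma> \<Longrightarrow> minv g \<in> cyc_group \<gamma>"
    and trace: "g \<in> cyc_group \<gamma> \<Longrightarrow> mtrace g = 2 \<Longrightarrow> g = mone"
    and nontrivial: "\<exists>g\<in>cyc_group \<gamma>. g \<noteq> mone"
begin

abbreviation "\<Gamma> \<equiv> cyc_group \<gamma>"
abbreviation "lam \<equiv> lam_pow \<theta>"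

definition G :: "bidx set" where "G = {p. snd p \<in> \<Gamma>}"

text \<open>Exponent and index of \<open>e_p^-1 e_q\<close>, where \<open>e_p\<close> is the
  symmetric monomial with index \<open>p\<close>. Likewise \<open>head x p q\<close> below belongs
  to \<open>e_p^-1 e_x e_q\<close>.\<close>

definition step :: "bidx \<Rightarrow> bidx \<Rightarrow> real \<times> bidx" where
  "step p q = (real_of_int (wedge (fst p) (fst q)) / 2,
     minv (snd p) \<odot> (fst q - fst p), mmul (minv (snd p)) (snd q))"

definition head :: "bidx \<Rightarrow> bidx \<Rightarrow> bidx \<Rightarrow> real \<times> bidx" where
  "head x p q = (real_of_int (wedge (fst p) (fst x + snd x \<odot> fst q) - wedge (fst x) (snd x \<odot> fst q)) / 2,
     minv (snd p) \<odot> (fst x + snd x \<odot> fst q - fst p), mmul (minv (snd p)) (mmul (snd x) (snd q)))"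

lemma mapply_minv [simp]:
  assumes "g \<in> \<Gamma>"
  shows "g \<odot> minv g \<odot> v = v" "minv g \<odot> g \<odot> v = v"
  using mmul_minv[OF det[OF assms]] by (simp_all add: mapply_mmul[symmetric])

lemma mmul_minv_cancel [simp]:
  assumes "g \<in> \<Gamma>"
  shows "mmul g (mmul (minv g) h) = h" "mmul (minv g) (mmul g h) = h"
  using mmul_minv[OF det[OF assms]] by (simp_all add: mmul_assoc[symmetric])

lemma wedge_mapply_cyc [simp]:
  assumes "g \<in> \<Gamma>"
  shows "wedge (g \<odot> v) (g \<odot> w) = wedge v w" "wedge (minv g \<odot> v) (minv g \<odot> w) = wedge v w"
  using det[OF assms] by (simp_all add: wedge_mapply)

lemma mapply_commute: "g \<in> \<Gamma> \<Longrightarrow> h \<in> \<Gamma> \<Longrightarrow> g \<odot> h \<odot> v = h \<odot> g \<odot> v"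
  using mmul_commute[of g \<gamma> h] by (simp add: mapply_mmul[symmetric])

text \<open>Here and in the next two lemmas an inner pair such as \<open>e_q e_q^-1\<close> cancels,
  so the product of two neighbours forgets the vertex between them.\<close>

lemma ext_mult_step_step:
  assumes "p \<in> G" "q \<in> G" "r \<in> G"
  shows "ext_mult (step p q) (step q r) = step p r"
  using assms unfolding ext_mult_def step_def G_def
  by (simp del: mapply_linear wedge_linear add: mapply_mmul mmul_assoc)
     (simp add: field_simps wedge_commute[of "fst q" "fst p"])

lemma ext_mult_head_step:
  assumes "p \<in> G" "q \<in> G" "r \<in> G" "x \<in> G"
  shows "ext_mult (head x p q) (step q r) = head x p r"
  using assms unfolding ext_mult_def step_def head_def G_def
  by (simp del: mapply_linear wedge_linear add: mapply_mmul mmul_assoc)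
     (simp add: field_simps)

lemma ext_mult_step_head:
  assumes "p \<in> G" "q \<in> G" "r \<in> G" "x \<in> G"
  shows "ext_mult (step r p) (head x p q) = head x r q"
  using assms unfolding ext_mult_def step_def head_def G_def
  by (simp del: mapply_linear wedge_linear add: mapply_mmul mmul_assoc)
     (simp add: field_simps)

definition bar :: "bidx \<Rightarrow> bidx list \<Rightarrow> (real \<times> bidx) list" where
  "bar x gs = head x (gs ! (length gs - 1)) (gs ! 0) #
     map (\<lambda>i. step (gs ! i) (gs ! Suc i)) [0..<length gs - 1]"

lemma length_bar [simp]: "gs \<noteq> [] \<Longrightarrow> length (bar x gs) = length gs"
  by (cases gs) (simp_all add: bar_def)

lemma bar_nth:
  "bar x gs ! 0 = head x (gs ! (length gs - 1)) (gs ! 0)"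
  "Suc j < length gs \<Longrightarrow> bar x gs ! Suc j = step (gs ! j) (gs ! Suc j)"
  using nth_upt[of 0 j "length gs - 1"] by (simp_all add: bar_def)

lemma bar_closed:
  assumes "x \<in> G" "set gs \<subseteq> G" "gs \<noteq> []" "A \<in> set (bar x gs)"
  shows "snd A \<in> G"
proof -
  have "snd (gs ! i) \<in> \<Gamma>" if "i < length gs" for i using assms that nth_mem G_def by blast
  then show ?thesis using assms
    by (auto simp: bar_def head_def step_def G_def intro!: mmul_cyc_group minv_closed)
qed

text \<open>Entries \<open>i\<close> and \<open>i + 1\<close> of \<open>bar\<close> meet at vertex
  \<open>i\<close>, so multiplying them cancels exactly this vertex. For \<open>i = 0\<close> the
  left one is the head.\<close>

lemma bar_delete:
  assumes len: "length gs = n + 2" and i: "i \<le> n" and x: "x \<in> G" and gs: "set gs \<subseteq> G"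
  shows "take i (bar x gs) @ [ext_mult (bar x gs ! i) (bar x gs ! (i + 1))] @ drop (i + 2) (bar x gs)
    = bar x (take i gs @ drop (Suc i) gs)" (is "?l = bar x ?d")
proof (rule nth_equalityI)
  have ne: "gs \<noteq> []" "?d \<noteq> []" using len by auto
  show l: "length ?l = length (bar x ?d)" using len i ne by simp
  have G: "gs ! j \<in> G" if "j < n + 2" for j using gs len that by auto
  have d: "?d ! j = (if j < i then gs ! j else gs ! Suc j)" if "j < n + 1" for j
    using len i that by (simp add: nth_append min_absorb2)
  have ld: "length ?d = n + 1" using len i by simp
  fix j assume "j < length ?l"
  then have j: "j < n + 1" using len ne i by simp
  have lj: "?l ! j = (if j < i then bar x gs ! j else if j = i then ext_mult (bar x gs ! i) (bar x gs ! (i + 1))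
      else bar x gs ! Suc j)"
    using len ne i j by (auto simp: nth_append min_absorb2 nth_Cons')
  show "?l ! j = bar x ?d ! j"
  proof (cases j)
    case 0
    show ?thesis
    proof (cases "i = 0")
      case True
      then show ?thesis unfolding lj unfolding 0
        using len d[of 0] d[of n] G[of 0] G[of 1] G[of "n + 1"] x
        by (simp add: bar_nth ld ext_mult_head_step)
    next
      case False
      then show ?thesis unfolding lj unfolding 0
        using len i d[of 0] d[of n] by (simp add: bar_nth ld)
    qed
  next
    case (Suc m)
    then have m: "m < n" using j by simp
    have r: "bar x ?d ! j = step (?d ! m) (?d ! Suc m)"
      unfolding Suc by (rule bar_nth(2)) (use m ld in simp)
    consider "j < i" | "j = i" | "i < j" by linarith
    then show ?thesis
    proof cases
      case 1
      then show ?thesis unfolding lj r using Suc m len d[of m] d[of "Suc m"] by (simp add: bar_nth)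
    next
      case 2
      then have im: "i = Suc m" using Suc by simp
      show ?thesis unfolding lj r
        using im Suc m len d[of m] d[of "Suc m"] G[of m] G[of "Suc m"] G[of "Suc (Suc m)"]
        by (simp add: bar_nth ext_mult_step_step)
    next
      case 3
      then show ?thesis unfolding lj r using Suc m len d[of m] d[of "Suc m"] by (simp add: bar_nth)
    qed
  qed
qed

text \<open>The cyclic face multiplies the last step by the head. They meet at the last vertex,
  which cancels.\<close>

lemma bar_delete_last:
  assumes len: "length gs = n + 2" and x: "x \<in> G" and gs: "set gs \<subseteq> G"
  shows "ext_mult (bar x gs ! (n + 1)) (bar x gs ! 0) # take n (drop 1 (bar x gs))
    = bar x (take (n + 1) gs @ drop (Suc (n + 1)) gs)" (is "?l = bar x ?d")
proof (rule nth_equalityI)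
  have ne: "gs \<noteq> []" "?d \<noteq> []" using len by auto
  have ld: "length ?d = n + 1" using len by simp
  show "length ?l = length (bar x ?d)" using len ne by simp
  have G: "gs ! j \<in> G" if "j < n + 2" for j using gs len that by auto
  fix j assume "j < length ?l"
  then have j: "j < n + 1" using len ne by simp
  show "?l ! j = bar x ?d ! j"
  proof (cases j)
    case 0
    show ?thesis using len G[of 0] G[of n] G[of "n + 1"] x
      by (simp add: 0 bar_nth ext_mult_step_head)
  next
    case (Suc m)
    then show ?thesis using len ne j by (simp add: bar_nth)
  qed
qed

definition hom :: "((bidx \<Rightarrow> complex) list \<Rightarrow> complex) \<Rightarrow> bidx \<Rightarrow> bidx list \<Rightarrow> complex" where
  "hom \<phi> x gs = (if gs = [] then 0 else \<phi> (map (mon \<theta>) (bar x gs)))"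

lemma hom_off:
  assumes "\<phi> \<in> cochains \<gamma> n" "length gs \<noteq> Suc n"
  shows "hom \<phi> x gs = 0"
  using assms cochains_off[OF assms(1)] by (auto simp: hom_def)

text \<open>The inner faces delete the vertices \<open>0\<close> to \<open>n\<close>, and the cyclic
  face deletes vertex \<open>n + 1\<close> with the sign \<open>(-1) ^ (n + 1)\<close>, which is the
  simplicial one. For lists of any other length both sides vanish.\<close>

lemma hom_hoch_d:
  assumes \<phi>: "\<phi> \<in> cochains \<gamma> n" and x: "x \<in> G" and gs: "set gs \<subseteq> G"
  shows "hom (hoch_d \<theta> \<gamma> n \<phi>) x gs = bd (hom \<phi> x) gs"
proof (cases "length gs = n + 2")
  case False
  have "bd (hom \<phi> x) gs = bd (\<lambda>_. 0) gs"
    by (rule bd_cong) (use hom_off[OF \<phi>] False in auto)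
  moreover have "hom (hoch_d \<theta> \<gamma> n \<phi>) x gs = 0"
    by (rule hom_off[OF hoch_d_cochains[OF \<phi>]]) (use False in auto)
  ultimately show ?thesis by simp
next
  case True
  then have ne: "gs \<noteq> []" by auto
  let ?xs = "map (mon \<theta>) (bar x gs)"
  have "mon \<theta> A \<in> cp_carrier \<gamma>" if "A \<in> set (bar x gs)" for A
    using bar_closed[OF x gs ne that] by (simp add: G_def mon_carrier)
  then have "set ?xs \<subseteq> cp_carrier \<gamma>" by (simp add: image_subset_iff)
  then have "hom (hoch_d \<theta> \<gamma> n \<phi>) x gs =
     (\<Sum>i\<le>n. (-1) ^ i * \<phi> (take i ?xs @ [cp_mult \<theta> (?xs ! i) (?xs ! (i + 1))] @ drop (i + 2) ?xs))
      + (-1) ^ (n + 1) * \<phi> (cp_mult \<theta> (?xs ! (n + 1)) (?xs ! 0) # take n (drop 1 ?xs))"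
    using ne True by (simp add: hom_def hoch_d_def)
  also have "(\<Sum>i\<le>n. (-1) ^ i * \<phi> (take i ?xs @ [cp_mult \<theta> (?xs ! i) (?xs ! (i + 1))] @ drop (i + 2) ?xs)) =
      (\<Sum>i\<le>n. (-1) ^ i * hom \<phi> x (take i gs @ drop (Suc i) gs))"
  proof (rule sum.cong[OF refl])
    fix i assume "i \<in> {..n}"
    then have i: "i \<le> n" by simp
    have "take i ?xs @ [cp_mult \<theta> (?xs ! i) (?xs ! (i + 1))] @ drop (i + 2) ?xs =
        map (mon \<theta>) (bar x (take i gs @ drop (Suc i) gs))"
      unfolding bar_delete[OF True i x gs, symmetric]
      using i True ne by (simp add: take_map drop_map cp_mult_mon)
    moreover have "take i gs @ drop (Suc i) gs \<noteq> []" using i True by auto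
    then have "hom \<phi> x (take i gs @ drop (Suc i) gs) = \<phi> (map (mon \<theta>) (bar x (take i gs @ drop (Suc i) gs)))"
      unfolding hom_def by (rule if_not_P)
    ultimately show "(-1) ^ i * \<phi> (take i ?xs @ [cp_mult \<theta> (?xs ! i) (?xs ! (i + 1))] @ drop (i + 2) ?xs) =
      (-1) ^ i * hom \<phi> x (take i gs @ drop (Suc i) gs)" by simp
  qed
  also have "cp_mult \<theta> (?xs ! (n + 1)) (?xs ! 0) # take n (drop 1 ?xs) =
      map (mon \<theta>) (bar x (take (n + 1) gs @ drop (Suc (n + 1)) gs))"
    unfolding bar_delete_last[OF True x gs, symmetric]
    using True ne by (simp add: take_map drop_map cp_mult_mon)
  also have "\<phi> \<dots> = hom \<phi> x (take (n + 1) gs @ drop (Suc (n + 1)) gs)"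
    using True by (auto simp: hom_def)
  also have "(\<Sum>i\<le>n. (-1) ^ i * hom \<phi> x (take i gs @ drop (Suc i) gs)) +
     (-1) ^ (n + 1) * hom \<phi> x (take (n + 1) gs @ drop (Suc (n + 1)) gs) = bd (hom \<phi> x) gs"
    unfolding bd_eq_sum True by (simp add: lessThan_Suc_atMost)
  finally show ?thesis .
qed

section \<open>Equivariance under the lattice and the finite group\<close>

definition tr :: "int \<times> int \<Rightarrow> bidx \<Rightarrow> bidx" where "tr u p = (u + fst p, snd p)"

definition gl :: "mat2 \<Rightarrow> bidx \<Rightarrow> bidx" where "gl h p = (h \<odot> fst p, mmul h (snd p))"

text \<open>The phase of \<open>e_u^-1 e_x e_u\<close> for a translation \<open>u\<close> and
  \<open>x = (v, g)\<close>, that is, \<open>fst (head (v, g) (u, mone) (u, mone))\<close>.\<close>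

definition tau :: "int \<times> int \<Rightarrow> int \<times> int \<Rightarrow> mat2 \<Rightarrow> real" where
  "tau u v g = real_of_int (wedge u (v + g \<odot> u) - wedge v (g \<odot> u)) / 2"

text \<open>Left multiplication of all vertices by one group element amounts to conjugating
  \<open>x\<close>. This is imposed on the two factors of the semidirect product separately. Since
  \<open>\<Gamma>\<close> is abelian, the component \<open>g\<close> never changes, and conjugation
  by \<open>\<Gamma>\<close> carries no phase.\<close>

definition equivariant :: "(bidx \<Rightarrow> bidx list \<Rightarrow> complex) \<Rightarrow> bool" where
  "equivariant \<Psi> \<longleftrightarrow>
    (\<forall>u v g gs. g \<in> \<Gamma> \<longrightarrow> set gs \<subseteq> G \<longrightarrow>
       \<Psi> (v, g) (map (tr u) gs) = lam (tau u v g) * \<Psi> (v + g \<odot> u - u, g) gs) \<and>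
    (\<forall>h v g gs. h \<in> \<Gamma> \<longrightarrow> g \<in> \<Gamma> \<longrightarrow> set gs \<subseteq> G \<longrightarrow> \<Psi> (h \<odot> v, g) (map (gl h) gs) = \<Psi> (v, g) gs)"

lemma equivariantD:
  assumes "equivariant \<Psi>" "g \<in> \<Gamma>" "set gs \<subseteq> G"
  shows "\<Psi> (v, g) (map (tr u) gs) = lam (tau u v g) * \<Psi> (v + g \<odot> u - u, g) gs"
    "h \<in> \<Gamma> \<Longrightarrow> \<Psi> (h \<odot> v, g) (map (gl h) gs) = \<Psi> (v, g) gs"
  using assms unfolding equivariant_def by blast+

lemma step_gl: "h \<in> \<Gamma> \<Longrightarrow> step (gl h p) (gl h q) = step p q"
  by (simp add: step_def gl_def minv_mmul mapply_mmul mmul_assoc del: mapply_linear(2))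
     (simp add: mapply_linear(2)[symmetric] del: mapply_linear(2))

lemma head_gl:
  assumes "h \<in> \<Gamma>" "g \<in> \<Gamma>"
  shows "head (h \<odot> v, g) (gl h p) (gl h q) = head (v, g) p q"
proof -
  have 1: "g \<odot> h \<odot> fst q = h \<odot> g \<odot> fst q" by (rule mapply_commute[OF assms(2,1)])
  have 2: "mmul g (mmul h (snd q)) = mmul h (mmul g (snd q))"
    using mmul_commute[OF assms] by (simp add: mmul_assoc[symmetric])
  show ?thesis using assms
    by (simp add: head_def gl_def 1 2 minv_mmul mapply_mmul mmul_assoc
        mapply_linear(1,2)[symmetric] del: mapply_linear wedge_linear)
qed

lemma bar_gl:
  assumes "h \<in> \<Gamma>" "g \<in> \<Gamma>" "gs \<noteq> []"
  shows "bar (h \<odot> v, g) (map (gl h) gs) = bar (v, g) gs"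
  using assms by (auto simp: bar_def head_gl step_gl)

definition tot :: "bidx \<Rightarrow> bidx list \<Rightarrow> real" where
  "tot x gs = sum_list (map fst (bar x gs))"

definition idx :: "bidx \<Rightarrow> bidx list \<Rightarrow> bidx list" where
  "idx x gs = map snd (bar x gs)"

lemma hom_eq:
  assumes "\<phi> \<in> cochains \<gamma> n" "length gs = Suc n" "x \<in> G" "set gs \<subseteq> G"
  shows "hom \<phi> x gs = lam (tot x gs) * \<phi> (basis_list \<theta> (idx x gs))"
proof -
  have ne: "gs \<noteq> []" using assms by auto
  have "(snd \<circ> snd) ` set (bar x gs) \<subseteq> \<Gamma>"
    using bar_closed[OF assms(3,4) ne] by (simp add: image_subset_iff G_def)
  then show ?thesis
    using cochains_mon[OF assms(1), of "bar x gs" \<theta>] assms(2) ne by (simp add: hom_def tot_def idx_def)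
qed

lemma idx_tr:
  assumes "gs \<noteq> []"
  shows "idx (v, g) (map (tr u) gs) = idx (v + g \<odot> u - u, g) gs"
  using assms by (simp add: idx_def bar_def head_def step_def tr_def algebra_simps)

lemma tot_tr:
  assumes "gs \<noteq> []" "g \<in> \<Gamma>"
  shows "tot (v, g) (map (tr u) gs) = tau u v g + tot (v + g \<odot> u - u, g) gs"
proof -
  let ?m = "length gs - 1"
  \<comment> \<open>A translation changes the exponents of the steps by differences of
    \<open>?a\<close>. Their sum telescopes, and its boundary terms cancel against those of the
    head.\<close>
  let ?a = "\<lambda>i. real_of_int (wedge u (fst (gs ! i))) / 2"
  have "fst (step (tr u (gs ! i)) (tr u (gs ! Suc i))) =
      (?a (Suc i) - ?a i) + fst (step (gs ! i) (gs ! Suc i))" for i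
    by (simp add: step_def tr_def wedge_commute[of _ u] field_simps)
  then have "(\<Sum>i<?m. fst (step (tr u (gs ! i)) (tr u (gs ! Suc i)))) =
      (?a ?m - ?a 0) + (\<Sum>i<?m. fst (step (gs ! i) (gs ! Suc i)))"
    by (simp only: sum.distrib sum_lessThan_telescope[where f = ?a])
  moreover have "fst (head (v, g) (tr u (gs ! ?m)) (tr u (gs ! 0))) =
      tau u v g + (?a 0 - ?a ?m) + fst (head (v + g \<odot> u - u, g) (gs ! ?m) (gs ! 0))"
    using assms by (simp add: head_def tr_def tau_def wedge_commute[of "fst (gs ! (length gs - Suc 0))" u] field_simps)
  moreover have "tot x gs = fst (head x (gs ! (length gs - 1)) (gs ! 0)) +
      (\<Sum>i<length gs - 1. fst (step (gs ! i) (gs ! Suc i)))" for x gs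
    by (simp add: tot_def bar_def o_def interv_sum_list_conv_sum_set_nat atLeast0LessThan)
  ultimately show ?thesis using assms by simp
qed

lemma tr_G: "set gs \<subseteq> G \<Longrightarrow> set (map (tr u) gs) \<subseteq> G"
  by (auto simp: tr_def G_def)

lemma gl_G: "h \<in> \<Gamma> \<Longrightarrow> set gs \<subseteq> G \<Longrightarrow> set (map (gl h) gs) \<subseteq> G"
  by (auto simp: gl_def G_def intro!: mmul_cyc_group)

lemma equivariant_hom:
  assumes \<phi>: "\<phi> \<in> cochains \<gamma> n"
  shows "equivariant (hom \<phi>)"
  unfolding equivariant_def
proof (intro conjI allI impI)
  fix u v g gs assume g: "g \<in> \<Gamma>" and gs: "set gs \<subseteq> G"
  show "hom \<phi> (v, g) (map (tr u) gs) = lam (tau u v g) * hom \<phi> (v + g \<odot> u - u, g) gs"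
  proof (cases "length gs = Suc n")
    case True
    then have ne: "gs \<noteq> []" by auto
    have "(w, g) \<in> G" for w using g by (simp add: G_def)
    then show ?thesis using True
      by (simp add: hom_eq[OF \<phi> _ _ gs] hom_eq[OF \<phi> _ _ tr_G[OF gs]] idx_tr[OF ne] tot_tr[OF ne g] lam_pow_add
        del: set_map)
  next
    case False
    then show ?thesis using hom_off[OF \<phi>] by simp
  qed
next
  fix h v g gs assume "h \<in> \<Gamma>" "g \<in> \<Gamma>" "set gs \<subseteq> G"
  then show "hom \<phi> (h \<odot> v, g) (map (gl h) gs) = hom \<phi> (v, g) gs"
    by (cases "gs = []") (simp_all add: hom_def bar_gl)
qed

text \<open>A translation followed by an element of \<open>\<Gamma>\<close> moves any tuple to one
  whose first vertex is the identity, at the price of conjugating \<open>x\<close>.\<close>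

lemma equivariant_eqI:
  assumes \<Psi>: "equivariant \<Psi>" and \<Psi>': "equivariant \<Psi>'"
    and eq: "\<And>x gs. x \<in> G \<Longrightarrow> set gs \<subseteq> G \<Longrightarrow> length gs = Suc n \<Longrightarrow> gs ! 0 = (0, mone) \<Longrightarrow> \<Psi> x gs = \<Psi>' x gs"
    and x: "x \<in> G" and gs: "set gs \<subseteq> G" and len: "length gs = Suc n"
  shows "\<Psi> x gs = \<Psi>' x gs"
proof -
  obtain u h where uh: "gs ! 0 = (u, h)" by (rule prod.exhaust)
  have "gs ! 0 \<in> set gs" using len by simp
  then have h: "h \<in> \<Gamma>" using gs uh by (auto simp: G_def)
  obtain v g where vg: "x = (v, g)" by (rule prod.exhaust)
  have g: "g \<in> \<Gamma>" using x vg by (simp add: G_def)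
  define gs1 where "gs1 = map (gl (minv h)) (map (tr (- u)) gs)"
  have gs1: "set gs1 \<subseteq> G" unfolding gs1_def by (intro gl_G tr_G gs minv_closed h)
  have "tr u (gl h (gl (minv h) (tr (- u) p))) = p" for p
    using h by (simp add: tr_def gl_def)
  then have gs_eq: "gs = map (tr u) (map (gl h) gs1)"
    by (simp add: gs1_def o_def)
  have gs10: "gs1 ! 0 = (0, mone)" using len uh h
    by (simp add: gs1_def tr_def gl_def mmul_minv det)
  define v' where "v' = minv h \<odot> (v + g \<odot> u - u)"
  have v': "v + g \<odot> u - u = h \<odot> v'" unfolding v'_def using h by (simp del: mapply_linear)
  have red: "\<Xi> x gs = lam (tau u v g) * \<Xi> (v', g) gs1" if "equivariant \<Xi>" for \<Xi>
    unfolding vg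
    by (subst gs_eq) (simp only: equivariantD(1)[OF that g gl_G[OF h gs1]] v' equivariantD(2)[OF that g gs1 h])
  have "(v', g) \<in> G" using g by (simp add: G_def)
  then show ?thesis unfolding red[OF \<Psi>] red[OF \<Psi>']
    using eq[OF _ gs1 _ gs10, of "(v', g)"] len by (simp add: gs1_def)
qed

text \<open>With the first vertex fixed, the successive steps recover all other vertices, and the
  head then recovers \<open>x\<close>.\<close>

lemma idx_inj:
  assumes x: "x \<in> G" "x' \<in> G" and gs: "set gs \<subseteq> G" "set gs' \<subseteq> G"
    and len: "length gs = Suc n" "length gs' = Suc n"
    and z: "gs ! 0 = (0, mone)" "gs' ! 0 = (0, mone)" and eq: "idx x gs = idx x' gs'"
  shows "x = x' \<and> gs = gs'"
proof -
  have nth: "snd (bar x gs ! j) = snd (bar x' gs' ! j)" if "j < Suc n" for j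
  proof -
    have "idx x gs ! j = idx x' gs' ! j" using eq by simp
    moreover have "gs \<noteq> []" "gs' \<noteq> []" using len by auto
    ultimately show ?thesis using that len by (simp add: idx_def)
  qed
  have G: "snd (gs ! j) \<in> \<Gamma>" "snd (gs' ! j) \<in> \<Gamma>" if "j < Suc n" for j
    using gs len that nth_mem G_def by (metis (mono_tags, lifting) mem_Collect_eq subset_iff)+
  have cancel: "b = c \<and> k = l" if "h \<in> \<Gamma>" "(minv h \<odot> (b - a), mmul (minv h) k) = (minv h \<odot> (c - a), mmul (minv h) l)"
    for a b c h k l
  proof -
    have "h \<odot> minv h \<odot> (b - a) = h \<odot> minv h \<odot> (c - a)" "mmul h (mmul (minv h) k) = mmul h (mmul (minv h) l)"
      using that(2) by auto
    then show ?thesis using that(1) by (simp del: mapply_linear)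
  qed
  have *: "j < Suc n \<Longrightarrow> gs ! j = gs' ! j" for j
  proof (induction j)
    case 0
    then show ?case using z by simp
  next
    case (Suc j)
    then have IH: "gs ! j = gs' ! j" by simp
    have "snd (step (gs ! j) (gs ! Suc j)) = snd (step (gs' ! j) (gs' ! Suc j))"
      using nth[of "Suc j"] Suc.prems len by (simp add: bar_nth)
    then have "(minv (snd (gs ! j)) \<odot> (fst (gs ! Suc j) - fst (gs ! j)), mmul (minv (snd (gs ! j))) (snd (gs ! Suc j)))
      = (minv (snd (gs ! j)) \<odot> (fst (gs' ! Suc j) - fst (gs ! j)), mmul (minv (snd (gs ! j))) (snd (gs' ! Suc j)))"
      unfolding step_def IH by (simp only: snd_conv)
    from cancel[OF G(1) this] show ?case using Suc.prems by (simp add: prod_eq_iff)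
  qed
  then have gg: "gs = gs'" using len by (intro nth_equalityI) auto
  have "snd (head x (gs ! n) (gs ! 0)) = snd (head x' (gs ! n) (gs ! 0))"
    using nth[of 0] len gg by (simp add: bar_nth)
  then have "(minv (snd (gs ! n)) \<odot> (fst x - fst (gs ! n)), mmul (minv (snd (gs ! n))) (snd x))
      = (minv (snd (gs ! n)) \<odot> (fst x' - fst (gs ! n)), mmul (minv (snd (gs ! n))) (snd x'))"
    unfolding head_def z by (simp only: snd_conv fst_conv mmul_mone mapply_linear(4) add_0_right)
  from cancel[OF G(1) this] gg show ?thesis by (simp add: prod_eq_iff)
qed

lemma idx_surj:
  assumes len: "length ps = Suc n" and ps: "snd ` set ps \<subseteq> \<Gamma>"
  obtains x gs where "x \<in> G" "set gs \<subseteq> G" "length gs = Suc n" "gs ! 0 = (0, mone)" "idx x gs = ps"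
proof -
  \<comment> \<open>The vertices are the partial products of the entries after the first. Then
    \<open>x\<close> is forced, because entry 0 must be \<open>(P n)^-1 x\<close>.\<close>
  define P where "P = rec_nat (0, mone) (\<lambda>i p. bmul_idx p (ps ! Suc i))"
  have P0: "P 0 = (0, mone)" and PS: "P (Suc i) = bmul_idx (P i) (ps ! Suc i)" for i
    by (simp_all add: P_def)
  have psG: "snd (ps ! i) \<in> \<Gamma>" if "i < Suc n" for i using ps len that by (simp add: image_subset_iff)
  have PG: "i < Suc n \<Longrightarrow> snd (P i) \<in> \<Gamma>" for i
    by (induction i) (simp_all add: P0 PS bmul_idx_eq mmul_cyc_group psG)
  let ?gs = "map P [0..<Suc n]" and ?x = "bmul_idx (P n) (ps ! 0)"
  have nth: "?gs ! i = P i" if "i < Suc n" for i using that by (metis diff_zero length_upt nth_map nth_upt add_0)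
  show thesis
  proof
    show "?x \<in> G" using PG[of n] psG[of 0] by (simp add: G_def bmul_idx_eq mmul_cyc_group)
    show "set ?gs \<subseteq> G" using PG by (auto simp: G_def simp del: upt_Suc)
    show "length ?gs = Suc n" by simp
    show "?gs ! 0 = (0, mone)" using nth[of 0] P0 by simp
    show "idx ?x ?gs = ps"
    proof (rule nth_equalityI)
      show "length (idx ?x ?gs) = length ps" using len by (simp add: idx_def)
      fix j assume "j < length (idx ?x ?gs)"
      then have j: "j < Suc n" by (simp add: idx_def)
      then have i: "idx ?x ?gs ! j = snd (bar ?x ?gs ! j)" by (simp add: idx_def)
      show "idx ?x ?gs ! j = ps ! j"
      proof (cases j)
        case 0
        show ?thesis unfolding i unfolding 0 bar_nth using nth[of 0] nth[of n] PG[of n]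
          by (simp add: P0 head_def bmul_idx_eq mmul_assoc del: upt_Suc)
      next
        case (Suc m)
        show ?thesis unfolding i unfolding Suc using j Suc nth[of m] nth[of "Suc m"] PG[of m]
          by (simp add: bar_nth PS step_def bmul_idx_eq del: upt_Suc)
      qed
    qed
  qed
qed

lemma hom_inj:
  assumes \<phi>: "\<phi> \<in> cochains \<gamma> n" and \<psi>: "\<psi> \<in> cochains \<gamma> n"
    and eq: "\<And>x gs. x \<in> G \<Longrightarrow> set gs \<subseteq> G \<Longrightarrow> length gs = Suc n \<Longrightarrow> hom \<phi> x gs = hom \<psi> x gs"
  shows "\<phi> = \<psi>"
proof (rule cochains_eqI[OF \<phi> \<psi>, where \<theta> = \<theta>])
  fix ps :: "bidx list" assume "length ps = Suc n" "snd ` set ps \<subseteq> \<Gamma>"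
  then obtain x gs where *: "x \<in> G" "set gs \<subseteq> G" "length gs = Suc n" "idx x gs = ps"
    using idx_surj by metis
  show "\<phi> (basis_list \<theta> ps) = \<psi> (basis_list \<theta> ps)"
    using eq[OF *(1-3)] hom_eq[OF \<phi> *(3,1,2)] hom_eq[OF \<psi> *(3,1,2)] *(4) by simp
qed

text \<open>Pairs \<open>(x, gs)\<close> with \<open>gs\<close> starting at the identity correspond
  bijectively to basis tuples under \<open>idx\<close>, so values on them may be prescribed freely;
  \<open>lam (- tot x gs)\<close> compensates the phase in \<open>hom_eq\<close>. Equivariance
  carries the equality to all tuples.\<close>

lemma hom_surj:
  assumes \<Psi>: "equivariant \<Psi>"
  obtains \<phi> where "\<phi> \<in> cochains \<gamma> n"
    "\<And>x gs. x \<in> G \<Longrightarrow> set gs \<subseteq> G \<Longrightarrow> length gs = Suc n \<Longrightarrow> hom \<phi> x gs = \<Psi> x gs"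
proof -
  define N where "N = {(x, gs). x \<in> G \<and> set gs \<subseteq> G \<and> length gs = Suc n \<and> gs ! 0 = (0, mone)}"
  define K where "K ps = (case (SOME a. a \<in> N \<and> idx (fst a) (snd a) = ps) of (x, gs) \<Rightarrow>
     lam (- tot x gs) * \<Psi> x gs)" for ps
  have K: "K (idx x gs) = lam (- tot x gs) * \<Psi> x gs" if N: "(x, gs) \<in> N" for x gs
  proof -
    have "(SOME a. a \<in> N \<and> idx (fst a) (snd a) = idx x gs) = (x, gs)"
    proof (rule some_equality)
      fix a assume "a \<in> N \<and> idx (fst a) (snd a) = idx x gs"
      then show "a = (x, gs)" using N idx_inj[of "fst a" x "snd a" gs n]
        by (auto simp: N_def prod_eq_iff)
    qed (use N in simp)
    then show ?thesis by (simp add: K_def)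
  qed
  obtain \<phi> where \<phi>: "\<phi> \<in> cochains \<gamma> n"
    "\<And>ps. length ps = Suc n \<Longrightarrow> snd ` set ps \<subseteq> \<Gamma> \<Longrightarrow> \<phi> (basis_list \<theta> ps) = K ps"
    by (rule cochains_exists[of \<gamma> n \<theta> K]) blast
  show thesis
  proof (rule that[OF \<phi>(1)])
    show "hom \<phi> x gs = \<Psi> x gs" if "x \<in> G" "set gs \<subseteq> G" "length gs = Suc n" for x gs
    proof (rule equivariant_eqI[OF equivariant_hom[OF \<phi>(1)] \<Psi> _ that])
      fix x gs assume *: "x \<in> G" "set gs \<subseteq> G" "length gs = Suc n" "gs ! 0 = (0, mone)"
      then have ne: "gs \<noteq> []" by auto
      have "snd ` set (idx x gs) \<subseteq> \<Gamma>"
        using bar_closed[OF *(1,2) ne] by (simp add: idx_def image_subset_iff G_def)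
      then have "\<phi> (basis_list \<theta> (idx x gs)) = lam (- tot x gs) * \<Psi> x gs"
        using \<phi>(2)[of "idx x gs"] K[of x gs] * ne by (simp add: N_def idx_def)
      then show "hom \<phi> x gs = \<Psi> x gs"
        using hom_eq[OF \<phi>(1) *(3,1,2)] by (simp add: mult.assoc[symmetric] lam_pow_minus)
    qed
  qed
qed

end

section \<open>The action of the lattice\<close>

declare split_paired_All [simp del] split_paired_Ex [simp del]

text \<open>Only the lattice part of \<open>x\<close> is an argument. The component \<open>g\<close>
  is preserved by both kinds of conjugation and becomes a parameter.\<close>

type_synonym hcochain = "int \<times> int \<Rightarrow> bidx list \<Rightarrow> complex"

definition sc :: "int \<Rightarrow> int \<times> int \<Rightarrow> int \<times> int" where "sc k u = (k * fst u, k * snd u)"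

text \<open>Hochschild degree \<open>n\<close> corresponds to lists of \<open>n + 1\<close> vertices; the empty list is the augmentation.\<close>

definition graded :: "nat \<Rightarrow> hcochain set" where
  "graded n = {\<Phi>. \<forall>v gs. length gs \<noteq> n \<longrightarrow> \<Phi> v gs = 0}"

definition dd :: "hcochain \<Rightarrow> hcochain" where "dd \<Phi> = (\<lambda>v. bd (\<Phi> v))"

lemma sc_simps [simp]: "sc 0 u = 0" "sc 1 u = u"
  by (simp_all add: sc_def zero_prod_def)

lemma sc_add: "sc (j + k) u = sc j u + sc k u"
  by (simp add: sc_def prod_eq_iff algebra_simps)

context finite_sl2
begin

text \<open>The action for which invariance is the translation half of
  \<open>equivariant\<close>.\<close>

definition T :: "mat2 \<Rightarrow> int \<times> int \<Rightarrow> hcochain \<Rightarrow> hcochain" where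
  "T g u \<Phi> = (\<lambda>v gs. lam (tau u v g) * \<Phi> (v + g \<odot> u - u) (map (tr (- u)) gs))"

text \<open>The cocycle identity that makes \<open>T g\<close> an action of the lattice.\<close>

lemma tau_add: "g \<in> \<Gamma> \<Longrightarrow> tau (u + u') v g = tau u v g + tau u' (v + g \<odot> u - u) g"
  by (simp add: tau_def field_simps wedge_commute[of u' u])

lemma tau_zero [simp]: "tau 0 v g = 0" "tau u 0 mone = 0"
  by (simp_all add: tau_def)

lemma tr_tr: "tr u (tr u' p) = tr (u + u') p"
  by (simp add: tr_def add.assoc)

lemma tr_zero [simp]: "tr 0 p = p"
  by (simp add: tr_def)

lemma T_T: "g \<in> \<Gamma> \<Longrightarrow> T g u (T g u' \<Phi>) = T g (u + u') \<Phi>"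
  by (intro ext) (simp add: T_def tau_add lam_pow_add mult.assoc o_def tr_tr algebra_simps)

lemma T_zero [simp]: "T g 0 \<Phi> = \<Phi>"
  by (intro ext) (simp add: T_def cong: map_cong)

lemma T_diff: "T g u (\<Phi> - \<Psi>) = T g u \<Phi> - T g u \<Psi>"
  by (intro ext) (simp add: T_def algebra_simps)

lemma T_fun: "T g u (\<lambda>v gs. c * \<Phi> v gs) = (\<lambda>v gs. c * T g u \<Phi> v gs)"
  by (intro ext) (simp add: T_def)

lemma T_graded: "\<Phi> \<in> graded n \<Longrightarrow> T g u \<Phi> \<in> graded n"
  by (simp add: graded_def T_def)

definition S :: "mat2 \<Rightarrow> int \<times> int \<Rightarrow> hcochain \<Rightarrow> hcochain" where "S g u \<Phi> = \<Phi> - T g u \<Phi>"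

text \<open>Solves \<open>\<Phi> - T g u \<Phi> = \<Psi>\<close> by summing \<open>\<Psi>\<close> along each orbit from height \<open>0\<close>, where \<open>K\<close> is the height.\<close>

definition resolve :: "mat2 \<Rightarrow> int \<times> int \<Rightarrow> (int \<times> int \<Rightarrow> bidx list \<Rightarrow> int) \<Rightarrow> hcochain \<Rightarrow> hcochain" where
  "resolve g u K \<Psi> = (\<lambda>v gs. if K v gs < 0 then (\<Sum>j<nat (- K v gs). T g (sc (int j) u) \<Psi> v gs)
     else - (\<Sum>j<nat (K v gs). T g (sc (- int (Suc j)) u) \<Psi> v gs))"

lemma resolve_graded: "\<Psi> \<in> graded n \<Longrightarrow> resolve g u K \<Psi> \<in> graded n"
  using T_graded[of \<Psi> n] by (auto simp: graded_def resolve_def)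

lemma T_apply_T:
  "g \<in> \<Gamma> \<Longrightarrow> lam (tau u v g) * T g u' \<Psi> (v + g \<odot> u - u) (map (tr (- u)) gs) = T g (u + u') \<Psi> v gs"
  by (subst T_T[symmetric], assumption) (simp only: T_def[of g u])

text \<open>Applying \<open>T g u\<close> evaluates at the next orbit point, one unit higher. The
  two finite orbit sums then differ in one summand, which is \<open>\<Psi>\<close> itself.\<close>

lemma S_resolve:
  assumes g: "g \<in> \<Gamma>" and \<Psi>: "\<Psi> \<in> graded n"
    and K: "\<And>v gs. length gs = n \<Longrightarrow> K (v + g \<odot> u - u) (map (tr (- u)) gs) = K v gs + 1"
  shows "S g u (resolve g u K \<Psi>) = \<Psi>"
proof (intro ext)
  fix v gs
  let ?R = "resolve g u K \<Psi>"
  let ?t = "\<lambda>j. T g (sc j u) \<Psi> v gs"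
  show "S g u ?R v gs = \<Psi> v gs"
  proof (cases "length gs = n")
    case False
    have "S g u ?R \<in> graded n"
      using resolve_graded[OF \<Psi>] T_graded[OF resolve_graded[OF \<Psi>]] unfolding S_def by (auto simp: graded_def)
    then show ?thesis using False \<Psi> by (simp add: graded_def)
  next
    case True
    let ?v = "v + g \<odot> u - u" and ?gs = "map (tr (- u)) gs" and ?k = "K v gs"
    note K' = K[OF True, of v]
    have "lam (tau u v g) * T g (sc j u) \<Psi> ?v ?gs = ?t (1 + j)" for j
      using T_apply_T[OF g, of u v "sc j u" \<Psi> gs] by (simp add: sc_add)
    then have shift: "lam (tau u v g) * (\<Sum>j\<in>A. T g (sc (f j) u) \<Psi> ?v ?gs) = (\<Sum>j\<in>A. ?t (1 + f j))" for A :: "nat set" and f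
      by (simp add: sum_distrib_left)
    have TR: "T g u ?R v gs = (if ?k + 1 < 0 then (\<Sum>j<nat (- (?k + 1)). ?t (1 + int j))
       else - (\<Sum>j<nat (?k + 1). ?t (1 + (- int (Suc j)))))"
    proof -
      have "T g u ?R v gs = (if ?k + 1 < 0 then lam (tau u v g) * (\<Sum>j<nat (- (?k + 1)). T g (sc (int j) u) \<Psi> ?v ?gs)
         else - (lam (tau u v g) * (\<Sum>j<nat (?k + 1). T g (sc (- int (Suc j)) u) \<Psi> ?v ?gs)))"
        unfolding T_def[of g u ?R] unfolding resolve_def K' by simp
      then show ?thesis by (simp only: shift)
    qed
    have t0: "?t 0 = \<Psi> v gs" by simp
    \<comment> \<open>Both heights are negative, the height passes from \<open>-1\<close> to
      \<open>0\<close>, or both are nonnegative.\<close>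
    consider "?k + 1 < 0" | "?k = -1" | "?k \<ge> 0" by linarith
    then show ?thesis
    proof cases
      case 1
      define m where "m = nat (- (?k + 1))"
      have m: "nat (- ?k) = Suc m" using 1 by (simp add: m_def)
      have R: "?R v gs = (\<Sum>j<Suc m. ?t (int j))" unfolding resolve_def m[symmetric] using 1 by simp
      have "T g u ?R v gs = (\<Sum>j<m. ?t (1 + int j))" unfolding TR m_def using 1 by simp
      moreover have "?R v gs = ?t 0 + (\<Sum>j<m. ?t (1 + int j))"
        unfolding R sum.lessThan_Suc_shift by simp
      ultimately show ?thesis by (simp add: S_def t0)
    next
      case 2
      then show ?thesis unfolding S_def minus_apply TR by (simp add: resolve_def t0)
    next
      case 3
      define m where "m = nat ?k"
      have m: "nat (?k + 1) = Suc m" using 3 by (simp add: m_def)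
      have R: "?R v gs = - (\<Sum>j<m. ?t (- int (Suc j)))" unfolding resolve_def m_def using 3 by simp
      have "T g u ?R v gs = - (\<Sum>j<Suc m. ?t (1 + (- int (Suc j))))" unfolding TR m using 3 by simp
      also have "\<dots> = - (?t 0 + (\<Sum>j<m. ?t (- int (Suc j))))"
        unfolding sum.lessThan_Suc_shift by simp
      finally show ?thesis by (simp add: S_def t0 R)
    qed
  qed
qed

text \<open>Translation by \<open>u'\<close> preserves the height, hence the range of summation, and
  it commutes with translation by \<open>u\<close>.\<close>

lemma T_resolve:
  assumes g: "g \<in> \<Gamma>" and \<Psi>: "\<Psi> \<in> graded n" and inv: "T g u' \<Psi> = \<Psi>"
    and K: "\<And>v gs. length gs = n \<Longrightarrow> K (v + g \<odot> u' - u') (map (tr (- u')) gs) = K v gs"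
  shows "T g u' (resolve g u K \<Psi>) = resolve g u K \<Psi>"
proof (intro ext)
  fix v gs
  show "T g u' (resolve g u K \<Psi>) v gs = resolve g u K \<Psi> v gs"
  proof (cases "length gs = n")
    case False
    then show ?thesis
      using resolve_graded[OF \<Psi>] T_graded[OF resolve_graded[OF \<Psi>]] by (simp add: graded_def)
  next
    case True
    have *: "lam (tau u' v g) * T g w \<Psi> (v + g \<odot> u' - u') (map (tr (- u')) gs) = T g w \<Psi> v gs" for w
    proof -
      have "T g (u' + w) \<Psi> = T g (w + u') \<Psi>" by (simp add: add.commute)
      also have "\<dots> = T g w \<Psi>" by (subst T_T[OF g, symmetric]) (simp add: inv)
      finally show ?thesis using T_apply_T[OF g, of u' v w \<Psi> gs] by simp
    qed
    show ?thesis
      unfolding T_def[of g u' "resolve g u K \<Psi>"] unfolding resolve_def K[OF True]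
      by (simp add: sum_distrib_left *)
  qed
qed

abbreviation "e1 \<equiv> (1, 0) :: int \<times> int"
abbreviation "e2 \<equiv> (0, 1) :: int \<times> int"

lemma surj_S:
  assumes g: "g \<in> \<Gamma>" and n: "n \<noteq> 0 \<or> g \<noteq> mone" and x: "x \<in> graded n"
  shows "\<exists>y\<in>graded n. S g e1 y = x"
    and "S g e1 x = 0 \<Longrightarrow> \<exists>y\<in>graded n. S g e2 y = x \<and> S g e1 y = 0"
proof -
  define a where "a = g \<odot> e1 - e1"
  define b where "b = g \<odot> e2 - e2"
  \<comment> \<open>When there are vertices, a coordinate of the first one gives the height. On the
    empty list the height is the floor of a coordinate of \<open>v\<close> in the basis
    \<open>a\<close>, \<open>b\<close>, by Cramer's rule: the translations \<open>e1\<close> and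
    \<open>e2\<close> move \<open>v\<close> by \<open>a\<close> and \<open>b\<close>.\<close>
  define K1 :: "int \<times> int \<Rightarrow> bidx list \<Rightarrow> int" where
    "K1 v gs = (if gs = [] then wedge v b div wedge a b else - fst (fst (hd gs)))" for v gs
  define K2 :: "int \<times> int \<Rightarrow> bidx list \<Rightarrow> int" where
    "K2 v gs = (if gs = [] then wedge a v div wedge a b else - snd (fst (hd gs)))" for v gs
  \<comment> \<open>This is the determinant of \<open>g - 1\<close>.\<close>
  have D: "wedge a b \<noteq> 0" if "g \<noteq> mone"
  proof -
    have "wedge a b = mdet g + 1 - mtrace g"
      by (simp add: a_def b_def wedge_def mapply_def mdet_def mtrace_def algebra_simps split: prod.splits)
    then show ?thesis using det[OF g] trace[OF g] that by auto
  qed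
  have sh: "v + g \<odot> e1 - e1 = v + a" "v + g \<odot> e2 - e2 = v + b" for v by (simp_all add: a_def b_def)
  have hd: "hd (map (tr u) gs) = tr u (hd gs)" if "gs \<noteq> []" for u gs using that by (simp add: hd_map)
  have K: "K1 (v + g \<odot> e1 - e1) (map (tr (- e1)) gs) = K1 v gs + 1"
    "K2 (v + g \<odot> e2 - e2) (map (tr (- e2)) gs) = K2 v gs + 1"
    "K2 (v + g \<odot> e1 - e1) (map (tr (- e1)) gs) = K2 v gs" if "length gs = n" for v gs
    using D n that unfolding sh by (cases "gs = []"; auto simp: K1_def K2_def hd tr_def)+
  show "\<exists>y\<in>graded n. S g e1 y = x"
    using S_resolve[where K = K1 and u = e1, OF g x K(1)] resolve_graded[OF x] by blast
  show "\<exists>y\<in>graded n. S g e2 y = x \<and> S g e1 y = 0" if "S g e1 x = 0"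
  proof (intro bexI conjI)
    show "S g e2 (resolve g e2 K2 x) = x" by (rule S_resolve[where K = K2 and u = e2, OF g x K(2)])
    have "T g e1 x = x" using that by (simp add: S_def)
    from T_resolve[where K = K2 and u' = e1, OF g x this K(3)] show "S g e1 (resolve g e2 K2 x) = 0" by (simp add: S_def)
  qed (rule resolve_graded[OF x])
qed

lemma dd_T: "dd (T g u \<Phi>) = T g u (dd \<Phi>)"
proof (intro ext)
  fix v gs
  have "dd (T g u \<Phi>) v gs = lam (tau u v g) * bd (\<lambda>l. \<Phi> (v + g \<odot> u - u) (map (tr (- u)) l)) gs"
    by (simp add: dd_def T_def bd_mult)
  also have "\<dots> = T g u (dd \<Phi>) v gs" by (simp add: bd_map T_def dd_def)
  finally show "dd (T g u \<Phi>) v gs = T g u (dd \<Phi>) v gs" .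
qed

lemma dd_diff: "dd (\<Phi> - \<Psi>) = dd \<Phi> - dd \<Psi>"
proof (intro ext)
  fix v gs
  have "dd (\<Phi> - \<Psi>) v gs = bd (\<lambda>l. \<Phi> v l - \<Psi> v l) gs"
    unfolding dd_def by (rule bd_cong) simp
  then show "dd (\<Phi> - \<Psi>) v gs = (dd \<Phi> - dd \<Psi>) v gs" by (simp add: bd_diff dd_def)
qed

lemma chase:
  assumes g: "g \<in> \<Gamma>"
  shows "bicomplex_chase graded dd (S g e1) (S g e2)"
proof
  show "0 \<in> graded n" for n by (simp add: graded_def)
  show "x - y \<in> graded n" if "x \<in> graded n" "y \<in> graded n" for x y n
    using that by (simp add: graded_def)
  show "dd (x - y) = dd x - dd y" for x y by (rule dd_diff)
  show "S g e1 (x - y) = S g e1 x - S g e1 y" "S g e2 (x - y) = S g e2 x - S g e2 y" for x y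
    by (simp_all add: S_def T_diff)
  show "dd x \<in> graded (Suc n)" if "x \<in> graded n" for x n
  proof -
    have "bd (x v) gs = 0" if "length gs \<noteq> Suc n" for v gs
    proof -
      have "bd (x v) gs = bd (\<lambda>_. 0) gs"
        by (rule bd_cong) (use \<open>x \<in> graded n\<close> that in \<open>auto simp: graded_def\<close>)
      then show ?thesis by simp
    qed
    then show ?thesis by (simp add: graded_def dd_def)
  qed
  show "S g e1 x \<in> graded n" "S g e2 x \<in> graded n" if "x \<in> graded n" for x n
    using that T_graded[OF that] by (simp_all add: S_def graded_def)
  show "dd (dd x) = 0" for x by (intro ext) (simp add: dd_def bd_bd)
  show "dd (S g e1 x) = S g e1 (dd x)" "dd (S g e2 x) = S g e2 (dd x)" for x
    by (simp_all add: S_def dd_diff dd_T)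
  show "S g e1 (S g e2 x) = S g e2 (S g e1 x)" for x
    by (simp add: S_def T_diff T_T[OF g])
  show "\<exists>y\<in>graded n. dd y = x" if x: "x \<in> graded (Suc n)" and c: "dd x = 0" for x n
  proof (intro bexI)
    \<comment> \<open>The cone over the base vertex \<open>(0, mone)\<close> contracts the augmented
      complex.\<close>
    let ?y = "\<lambda>v gs. x v ((0, mone) # gs)"
    show "?y \<in> graded n" using x by (simp add: graded_def)
    show "dd ?y = x"
    proof (intro ext)
      fix v gs
      have "dd x v ((0, mone) # gs) = 0" using c by simp
      then show "dd ?y v gs = x v gs" by (simp add: dd_def)
    qed
  qed
  show "x = 0" if x: "x \<in> graded 0" and c: "dd x = 0" for x
  proof (intro ext)
    fix v gs
    have "dd x v [(0, mone)] = 0" using c by simp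
    then show "x v gs = 0 v gs" using x by (cases "gs = []") (simp_all add: dd_def graded_def)
  qed
  show "\<exists>y\<in>graded (Suc n). S g e1 y = x" if "x \<in> graded (Suc n)" for x n
    using surj_S(1)[OF g _ that] by simp
  show "\<exists>y\<in>graded (Suc n). S g e2 y = x \<and> S g e1 y = 0" if "x \<in> graded (Suc n)" "S g e1 x = 0" for x n
    using surj_S(2)[OF g _ that] by simp
qed

section \<open>Obstructions on functions of the lattice part\<close>

definition good :: "mat2 \<Rightarrow> hcochain \<Rightarrow> bool" where
  "good g m \<longleftrightarrow> m \<in> graded 0 \<and> (g = mone \<longrightarrow> m 0 [] = 0)"

text \<open>For \<open>g = mone\<close> the lattice acts diagonally, by characters. The two factors
  vanish together only at \<open>v = 0\<close>, which is the value that \<open>good\<close>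
  controls.\<close>

lemma S_mone: "S mone e1 a v [] = (1 - lam (snd v)) * a v []" "S mone e2 a v [] = (1 - lam (- fst v)) * a v []"
  by (simp_all add: S_def T_def tau_def wedge_def left_diff_distrib)

lemma S_graded0: "a \<in> graded 0 \<Longrightarrow> gs \<noteq> [] \<Longrightarrow> S g u a v gs = 0"
  using T_graded[of a 0 g u] by (simp add: S_def graded_def)

lemma lam_int: "k \<noteq> 0 \<Longrightarrow> 1 - lam (real_of_int k) \<noteq> 0"
  using lam_pow_int_neq_1[OF irrational] by simp

lemma good_coinvariants:
  assumes g: "g \<in> \<Gamma>" and m: "good g m"
  shows "\<exists>a\<in>graded 0. \<exists>b\<in>graded 0. m = S g e1 a + S g e2 b"
proof (cases "g = mone")
  case False
  have m0: "m \<in> graded 0" using m by (simp add: good_def)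
  obtain a where "a \<in> graded 0" "S g e1 a = m" using surj_S(1)[OF g _ m0] False by blast
  moreover have "(0::hcochain) \<in> graded 0" "S g e2 0 = 0"
    by (auto simp: graded_def S_def T_def fun_eq_iff)
  ultimately show ?thesis by (metis add.right_neutral)
next
  case True
  \<comment> \<open>Each point \<open>v \<noteq> 0\<close> is handled by one operator with nonzero
    factor: \<open>S g e1\<close> if \<open>snd v \<noteq> 0\<close>, otherwise
    \<open>S g e2\<close>.\<close>
  define a :: hcochain where "a = (\<lambda>v gs. if gs = [] \<and> snd v \<noteq> 0 then m v [] / (1 - lam (snd v)) else 0 :: complex)"
  define b :: hcochain where "b = (\<lambda>v gs. if gs = [] \<and> snd v = 0 \<and> fst v \<noteq> 0 then m v [] / (1 - lam (- fst v)) else 0 :: complex)"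
  have ab: "a \<in> graded 0" "b \<in> graded 0" by (auto simp: a_def b_def graded_def)
  have m0: "m 0 [] = 0" "m \<in> graded 0" using m True by (simp_all add: good_def)
  have "m v gs = (S mone e1 a + S mone e2 b) v gs" for v gs
  proof (cases "gs = []")
    case False
    then show ?thesis using m0 ab by (simp add: S_graded0 graded_def)
  next
    case gs: True
    consider "snd v \<noteq> 0" | "snd v = 0" "fst v \<noteq> 0" | "v = 0" by (auto simp: prod_eq_iff)
    then show ?thesis
    proof cases
      case 1
      then show ?thesis using lam_int[of "snd v"] by (simp add: gs S_mone) (simp add: a_def b_def)
    next
      case 2
      then show ?thesis using lam_int[of "- fst v"] by (simp add: gs S_mone) (simp add: a_def b_def)
    next
      case 3
      then show ?thesis using m0 by (simp add: gs S_mone)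
    qed
  qed
  then have "m = S g e1 a + S g e2 b" unfolding True by (intro ext)
  then show ?thesis using ab by blast
qed

lemma good_derivation:
  assumes g: "g \<in> \<Gamma>" and m1: "good g m1" and m2: "good g m2" and eq: "S g e2 m1 = S g e1 m2"
  shows "\<exists>a\<in>graded 0. m1 = S g e1 a \<and> m2 = S g e2 a"
proof (cases "g = mone")
  case False
  interpret bicomplex_chase graded dd "S g e1" "S g e2" by (rule chase[OF g])
  have m: "m1 \<in> graded 0" "m2 \<in> graded 0" using m1 m2 by (simp_all add: good_def)
  obtain a where a: "a \<in> graded 0" "S g e1 a = m1" using surj_S(1)[OF g _ m(1)] False by blast
  have r: "m2 - S g e2 a \<in> graded 0" by (intro L_diff S2_L m a)
  have "S g e1 (m2 - S g e2 a) = 0" by (simp add: S1_diff S1_S2 a eq)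
  then obtain c where c: "c \<in> graded 0" "S g e2 c = m2 - S g e2 a" "S g e1 c = 0"
    using surj_S(2)[OF g _ r] False by blast
  have "m1 = S g e1 (a + c)" "m2 = S g e2 (a + c)" by (simp_all add: S1_add S2_add a c)
  then show ?thesis using L_add[OF a(1) c(1)] by blast
next
  case True
  \<comment> \<open>Compatibility makes either quotient solve both equations. On
    \<open>snd v = 0\<close>, \<open>fst v \<noteq> 0\<close> it forces
    \<open>m1 v [] = 0\<close>.\<close>
  define a :: hcochain where "a = (\<lambda>v gs. if gs = [] then if snd v \<noteq> 0 then m1 v [] / (1 - lam (snd v))
     else if fst v \<noteq> 0 then m2 v [] / (1 - lam (- fst v)) else 0 else 0 :: complex)"
  have ag: "a \<in> graded 0" by (auto simp: a_def graded_def)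
  have m0: "m1 0 [] = 0" "m1 \<in> graded 0" "m2 0 [] = 0" "m2 \<in> graded 0"
    using m1 m2 True by (simp_all add: good_def)
  have "m1 v gs = S mone e1 a v gs \<and> m2 v gs = S mone e2 a v gs" for v gs
  proof (cases "gs = []")
    case False
    then show ?thesis using m0 ag by (simp add: S_graded0 graded_def)
  next
    case gs: True
    have e: "(1 - lam (- fst v)) * m1 v [] = (1 - lam (snd v)) * m2 v []"
      using fun_cong[OF fun_cong[OF eq, of v], of "[]"] unfolding True by (simp add: S_mone)
    consider "snd v \<noteq> 0" | "snd v = 0" "fst v \<noteq> 0" | "v = 0" by (auto simp: prod_eq_iff)
    then show ?thesis
    proof cases
      case 1
      then show ?thesis using lam_int[of "snd v"] e by (simp add: gs S_mone) (simp add: a_def field_simps)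
    next
      case 2
      then show ?thesis using lam_int[of "- fst v"] e by (simp add: gs S_mone) (simp add: a_def)
    next
      case 3
      then show ?thesis using m0 by (simp add: gs S_mone)
    qed
  qed
  then have "m1 = S g e1 a" "m2 = S g e2 a" unfolding True by (auto intro!: ext)
  then show ?thesis using ag by blast
qed

lemma T_invariant:
  assumes g: "g \<in> \<Gamma>" and "S g e1 \<Phi> = 0" "S g e2 \<Phi> = 0"
  shows "T g u \<Phi> = \<Phi>"
proof -
  have neg: "T g (- w) \<Phi> = \<Phi>" if "T g w \<Phi> = \<Phi>" for w
  proof -
    have "T g (- w) \<Phi> = T g (- w) (T g w \<Phi>)" by (simp add: that)
    also have "\<dots> = \<Phi>" by (subst T_T[OF g]) simp
    finally show ?thesis .
  qed
  have nat: "T g (sc (int k) w) \<Phi> = \<Phi>" if w: "T g w \<Phi> = \<Phi>" for k w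
  proof (induction k)
    case (Suc k)
    have "T g (sc (int (Suc k)) w) \<Phi> = T g w (T g (sc (int k) w) \<Phi>)"
      by (simp add: T_T[OF g] sc_add)
    then show ?case using Suc w by simp
  qed simp
  have int: "T g (sc k w) \<Phi> = \<Phi>" if w: "T g w \<Phi> = \<Phi>" for k w
  proof (cases k rule: int_cases2)
    case (nonpos n)
    have "sc k w = - sc (int n) w" by (simp add: nonpos sc_def)
    then show ?thesis using neg[OF nat[OF w, of n]] by simp
  qed (use nat[OF w] in simp)
  have "T g e1 \<Phi> = \<Phi>" "T g e2 \<Phi> = \<Phi>" using assms by (simp_all add: S_def)
  from int[OF this(1)] int[OF this(2)] have "T g (sc (fst u) e1) (T g (sc (snd u) e2) \<Phi>) = \<Phi>" by simp
  moreover have "sc (fst u) e1 + sc (snd u) e2 = u" by (simp add: sc_def prod_eq_iff)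
  ultimately show ?thesis by (simp add: T_T[OF g])
qed

section \<open>Averaging and positive degrees\<close>


text \<open>Extending cochains along \<open>retr\<close> to vertices outside \<open>G\<close> turns identities of cochains into equations of
  functions. The retraction commutes with translations, but not with \<open>\<Gamma>\<close>.\<close>

definition retr :: "bidx \<Rightarrow> bidx" where
  "retr p = (fst p, if snd p \<in> \<Gamma> then snd p else mone)"

definition slice :: "(bidx \<Rightarrow> bidx list \<Rightarrow> complex) \<Rightarrow> mat2 \<Rightarrow> hcochain" where
  "slice \<Psi> g = (\<lambda>v gs. \<Psi> (v, g) (map retr gs))"

lemma retr_G: "set (map retr gs) \<subseteq> G"
  by (auto simp: retr_def G_def)

lemma retr_id: "set gs \<subseteq> G \<Longrightarrow> map retr gs = gs"
  by (rule map_idI) (auto simp: retr_def G_def)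

lemma retr_tr: "retr (tr u p) = tr u (retr p)"
  by (simp add: retr_def tr_def)

lemma S_slice:
  assumes "equivariant \<Psi>" "g \<in> \<Gamma>"
  shows "S g u (slice \<Psi> g) = 0"
proof -
  have "T g u (slice \<Psi> g) v gs = slice \<Psi> g v gs" for v gs
    using equivariantD(1)[OF assms tr_G[OF retr_G], of v u "- u" gs]
    by (simp add: T_def slice_def o_def retr_tr tr_tr)
  then show ?thesis by (simp add: S_def fun_eq_iff)
qed

lemma dd_slice: "dd (slice \<Psi> g) v gs = bd (\<Psi> (v, g)) (map retr gs)"
  by (simp add: dd_def slice_def bd_map)

lemma slice_hom_graded: "\<phi> \<in> cochains \<gamma> n \<Longrightarrow> slice (hom \<phi>) g \<in> graded (Suc n)"
  using hom_off[of \<phi> n] by (simp add: graded_def slice_def)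

lemma cocycle_bd:
  assumes "\<phi> \<in> cocycles \<theta> \<gamma> n" "x \<in> G" "set gs \<subseteq> G"
  shows "bd (hom \<phi> x) gs = 0"
proof -
  have "\<phi> \<in> cochains \<gamma> n" "hoch_d \<theta> \<gamma> n \<phi> = (\<lambda>_. 0)" using assms by (simp_all add: cocycles_def)
  then show ?thesis using hom_hoch_d[of \<phi> n x gs] assms by (simp add: hom_def)
qed

lemma dd_slice_cocycle:
  assumes "\<phi> \<in> cocycles \<theta> \<gamma> n" "g \<in> \<Gamma>"
  shows "dd (slice (hom \<phi>) g) = 0"
  using cocycle_bd[OF assms(1) _ retr_G, of "(v, g)" gs for v gs] assms(2)
  by (intro ext) (simp add: dd_slice G_def)

lemma gl_gl: "gl h (gl k p) = gl (mmul h k) p"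
  by (simp add: gl_def mapply_mmul mmul_assoc)

lemma gl_tr: "gl h (tr u p) = tr (h \<odot> u) (gl h p)"
  by (simp add: gl_def tr_def)

lemma tau_mapply: "h \<in> \<Gamma> \<Longrightarrow> g \<in> \<Gamma> \<Longrightarrow> tau (h \<odot> u) (h \<odot> v) g = tau u v g"
  using mapply_commute[of g h u]
  by (simp add: tau_def mapply_linear(1)[symmetric] del: mapply_linear wedge_linear)

text \<open>The given \<open>Y g\<close> need not respect \<open>\<Gamma>\<close>. On lists over
  \<open>G\<close>, where \<open>retr\<close> is the identity, its pullbacks under
  \<open>\<Gamma>\<close> are again translation equivariant primitives, and so is their
  mean.\<close>

lemma average:
  assumes \<Phi>: "equivariant \<Phi>"
    and Y: "\<And>g. g \<in> \<Gamma> \<Longrightarrow> dd (Y g) = slice \<Phi> g" "\<And>g u. g \<in> \<Gamma> \<Longrightarrow> T g u (Y g) = Y g"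
  obtains \<Psi> where "equivariant \<Psi>" "\<And>x gs. x \<in> G \<Longrightarrow> set gs \<subseteq> G \<Longrightarrow> bd (\<Psi> x) gs = \<Phi> x gs"
proof -
  define c where "c = 1 / complex_of_nat (card \<Gamma>)"
  define \<Psi> where "\<Psi> x gs = c * (\<Sum>h\<in>\<Gamma>. Y (snd x) (h \<odot> fst x) (map (gl h) gs))" for x gs
  have "card \<Gamma> > 0" using fin mone_cyc_group[of \<gamma>] by (metis card_gt_0_iff empty_iff)
  then have c: "c * of_nat (card \<Gamma>) = 1" by (simp add: c_def)
  show thesis
  proof
    show "equivariant \<Psi>"
      unfolding equivariant_def
    proof (intro conjI allI impI)
      fix u v g and gs :: "bidx list" assume g: "g \<in> \<Gamma>" and gs: "set gs \<subseteq> G"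
      have "Y g (h \<odot> v) (map (gl h) (map (tr u) gs)) =
          lam (tau u v g) * Y g (h \<odot> (v + g \<odot> u - u)) (map (gl h) gs)" if h: "h \<in> \<Gamma>" for h
      proof -
        let ?gs = "map (tr (h \<odot> u)) (map (gl h) gs)"
        have "Y g (h \<odot> v) (map (gl h) (map (tr u) gs)) = Y g (h \<odot> v) ?gs"
          by (simp add: o_def gl_tr)
        also have "\<dots> = T g (h \<odot> u) (Y g) (h \<odot> v) ?gs" using Y(2)[OF g] by simp
        also have "\<dots> = lam (tau u v g) * Y g (h \<odot> v + g \<odot> h \<odot> u - h \<odot> u) (map (gl h) gs)"
          by (simp add: T_def tau_mapply[OF h g] o_def tr_tr)
        finally show ?thesis by (simp add: mapply_commute[OF g h])
      qed
      then show "\<Psi> (v, g) (map (tr u) gs) = lam (tau u v g) * \<Psi> (v + g \<odot> u - u, g) gs"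
        by (simp add: \<Psi>_def sum_distrib_left mult_ac)
    next
      fix k v g and gs :: "bidx list" assume k: "k \<in> \<Gamma>" and g: "g \<in> \<Gamma>" and gs: "set gs \<subseteq> G"
      have "(\<Sum>h\<in>\<Gamma>. Y g (h \<odot> k \<odot> v) (map (gl h) (map (gl k) gs))) = (\<Sum>h\<in>\<Gamma>. Y g (h \<odot> v) (map (gl h) gs))"
        by (rule sum.reindex_bij_witness[where j = "\<lambda>h. mmul h k" and i = "\<lambda>h. mmul h (minv k)"])
          (use k mmul_minv[OF det[OF k]] in \<open>simp_all add: mmul_assoc mapply_mmul gl_gl o_def mmul_cyc_group minv_closed\<close>)
      then show "\<Psi> (k \<odot> v, g) (map (gl k) gs) = \<Psi> (v, g) gs"
        by (simp add: \<Psi>_def)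
    qed
    fix x gs assume x: "x \<in> G" and gs: "set gs \<subseteq> G"
    obtain v g where vg: "x = (v, g)" by (rule prod.exhaust)
    have g: "g \<in> \<Gamma>" using x vg by (simp add: G_def)
    have "bd (\<Psi> x) gs = c * (\<Sum>h\<in>\<Gamma>. bd (\<lambda>l. Y g (h \<odot> v) (map (gl h) l)) gs)"
      unfolding \<Psi>_def vg by (simp add: bd_mult bd_sum)
    also have "(\<Sum>h\<in>\<Gamma>. bd (\<lambda>l. Y g (h \<odot> v) (map (gl h) l)) gs) = (\<Sum>h\<in>\<Gamma>. \<Phi> (v, g) gs)"
    proof (rule sum.cong[OF refl])
      fix h assume h: "h \<in> \<Gamma>"
      have "bd (\<lambda>l. Y g (h \<odot> v) (map (gl h) l)) gs = dd (Y g) (h \<odot> v) (map (gl h) gs)"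
        by (simp add: bd_map dd_def)
      also have "\<dots> = \<Phi> (h \<odot> v, g) (map (gl h) gs)"
        unfolding Y(1)[OF g] slice_def retr_id[OF gl_G[OF h gs]] ..
      also have "\<dots> = \<Phi> (v, g) gs" by (rule equivariantD(2)[OF \<Phi> g gs h])
      finally show "bd (\<lambda>l. Y g (h \<odot> v) (map (gl h) l)) gs = \<Phi> (v, g) gs" .
    qed
    also have "c * (\<Sum>h\<in>\<Gamma>. \<Phi> (v, g) gs) = \<Phi> x gs"
      using c by (simp add: vg mult.assoc[symmetric])
    finally show "bd (\<Psi> x) gs = \<Phi> x gs" .
  qed
qed

text \<open>Translation invariant primitives may be found for each \<open>g\<close> separately.
  Averaging makes them equivariant, and \<open>hom_surj\<close> turns the result into a Hochschild
  cochain.\<close>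

lemma coboundaryI:
  assumes \<phi>: "\<phi> \<in> cochains \<gamma> (Suc n)"
    and Y: "\<And>g. g \<in> \<Gamma> \<Longrightarrow> \<exists>y. dd y = slice (hom \<phi>) g \<and> S g e1 y = 0 \<and> S g e2 y = 0"
  shows "\<phi> \<in> coboundaries \<theta> \<gamma> (Suc n)"
proof -
  obtain Y where Y: "dd (Y g) = slice (hom \<phi>) g" "S g e1 (Y g) = 0" "S g e2 (Y g) = 0" if "g \<in> \<Gamma>" for g
    using Y by metis
  obtain \<Psi> where \<Psi>: "equivariant \<Psi>" "\<And>x gs. x \<in> G \<Longrightarrow> set gs \<subseteq> G \<Longrightarrow> bd (\<Psi> x) gs = hom \<phi> x gs"
    using average[OF equivariant_hom[OF \<phi>] Y(1) T_invariant[OF _ Y(2,3)]] by metis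
  obtain \<psi> where \<psi>: "\<psi> \<in> cochains \<gamma> n"
    "\<And>x gs. x \<in> G \<Longrightarrow> set gs \<subseteq> G \<Longrightarrow> length gs = Suc n \<Longrightarrow> hom \<psi> x gs = \<Psi> x gs"
    using hom_surj[OF \<Psi>(1), of n] by metis
  have "hoch_d \<theta> \<gamma> n \<psi> = \<phi>"
  proof (rule hom_inj[OF hoch_d_cochains[OF \<psi>(1)] \<phi>])
    fix x gs assume *: "x \<in> G" "set gs \<subseteq> G" "length gs = Suc (Suc n)"
    have "hom (hoch_d \<theta> \<gamma> n \<psi>) x gs = bd (hom \<psi> x) gs" by (rule hom_hoch_d[OF \<psi>(1) *(1,2)])
    also have "\<dots> = bd (\<Psi> x) gs" by (rule bd_cong) (use * \<psi>(2) in auto)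
    also have "\<dots> = hom \<phi> x gs" by (rule \<Psi>(2)[OF *(1,2)])
    finally show "hom (hoch_d \<theta> \<gamma> n \<psi>) x gs = hom \<phi> x gs" .
  qed
  then show ?thesis using \<psi>(1) by auto
qed

lemma cocycle_slice:
  assumes "\<phi> \<in> cocycles \<theta> \<gamma> n" "g \<in> \<Gamma>"
  shows "slice (hom \<phi>) g \<in> graded (Suc n)" "dd (slice (hom \<phi>) g) = 0" "S g u (slice (hom \<phi>) g) = 0"
  using assms slice_hom_graded dd_slice_cocycle S_slice[OF equivariant_hom]
  unfolding cocycles_def by blast+

lemma HH_high: "HH_dim \<theta> \<gamma> (k + 3) 0"
proof -
  have "\<phi> \<in> coboundaries \<theta> \<gamma> (k + 3)" if \<phi>: "\<phi> \<in> cocycles \<theta> \<gamma> (k + 3)" for \<phi>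
  proof -
    have "\<exists>y. dd y = slice (hom \<phi>) g \<and> S g e1 y = 0 \<and> S g e2 y = 0" if g: "g \<in> \<Gamma>" for g
    proof -
      interpret bicomplex_chase graded dd "S g e1" "S g e2" by (rule chase[OF g])
      \<comment> \<open>Hochschild degree \<open>k + 3\<close> means lists of length
        \<open>k + 4\<close>, exactly the range of \<open>exact_ker_S1_S2\<close>.\<close>
      have "slice (hom \<phi>) g \<in> graded (k + 4)" using cocycle_slice(1)[OF \<phi> g] by (simp add: eval_nat_numeral)
      then show ?thesis by (rule exact_ker_S1_S2) (use cocycle_slice[OF \<phi> g] in auto)
    qed
    moreover have "\<phi> \<in> cochains \<gamma> (Suc (k + 2))" using \<phi> by (simp add: cocycles_def eval_nat_numeral)
    ultimately have "\<phi> \<in> coboundaries \<theta> \<gamma> (Suc (k + 2))" by (intro coboundaryI)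
    then show ?thesis by (simp add: eval_nat_numeral del: coboundaries.simps)
  qed
  then show ?thesis unfolding HH_dim_def quot_dim_def by simp
qed

text \<open>The increments of \<open>\<eta>\<close> from the origin form a
  \<open>\<Gamma>\<close>-invariant homomorphism \<open>\<rho>\<close> on the lattice. By
  Cayley-Hamilton \<open>2 \<rho> = tr g \<rho>\<close>, while \<open>tr g \<noteq> 2\<close> for
  some \<open>g\<close>.\<close>

lemma invariant_additive_zero:
  fixes \<eta> :: "bidx \<Rightarrow> complex"
  assumes tr: "\<And>u a b. a \<in> G \<Longrightarrow> b \<in> G \<Longrightarrow> \<eta> (tr u b) - \<eta> (tr u a) = \<eta> b - \<eta> a"
    and gl: "\<And>h a b. h \<in> \<Gamma> \<Longrightarrow> a \<in> G \<Longrightarrow> b \<in> G \<Longrightarrow> \<eta> (gl h b) - \<eta> (gl h a) = \<eta> b - \<eta> a"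
  shows "\<eta> (u, mone) = \<eta> (0, mone)"
proof -
  define \<rho> where "\<rho> u = \<eta> (u, mone) - \<eta> (0, mone)" for u
  have GI: "h \<in> \<Gamma> \<Longrightarrow> (w, h) \<in> G" for w h by (simp add: G_def)
  have add: "\<rho> (u + w) = \<rho> u + \<rho> w" for u w
    using tr[of "(0, mone)" "(w, mone)" u] by (simp add: GI tr_def \<rho>_def algebra_simps)
  \<comment> \<open>Applying \<open>gl h\<close> gives an increment between vertices with component
    \<open>h\<close>; translating the pair \<open>(0, mone)\<close>, \<open>(0, h)\<close> compares
    it with an increment between vertices with component \<open>mone\<close>.\<close>
  have inv: "\<rho> (h \<odot> u) = \<rho> u" if h: "h \<in> \<Gamma>" for h u
    using gl[OF h, of "(0, mone)" "(u, mone)"] tr[of "(0, mone)" "(0, h)" "h \<odot> u"] h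
    by (simp add: GI tr_def gl_def \<rho>_def algebra_simps)
  have nat: "\<rho> (sc (int k) u) = of_nat k * \<rho> u" for k u
    by (induction k) (simp_all add: sc_add add algebra_simps, simp_all add: \<rho>_def)
  have int: "\<rho> (sc k u) = of_int k * \<rho> u" for k u
  proof (cases k rule: int_cases2)
    case (nonpos n)
    have "\<rho> (sc k u) + \<rho> (sc (int n) u) = \<rho> (sc k u + sc (int n) u)" by (simp add: add)
    also have "sc k u + sc (int n) u = 0" by (simp add: sc_add[symmetric] nonpos)
    finally show ?thesis by (simp add: nat nonpos \<rho>_def[of 0] add_eq_0_iff2)
  qed (simp add: nat)
  obtain g where g: "g \<in> \<Gamma>" "g \<noteq> mone" using nontrivial by blast
  have "2 * \<rho> u = \<rho> (g \<odot> u + minv g \<odot> u)" using inv[OF g(1)] inv[OF minv_closed[OF g(1)]] by (simp add: add)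
  also have "\<dots> = of_int (mtrace g) * \<rho> u"
    unfolding mapply_cayley_hamilton[OF det[OF g(1)]] using int[of "mtrace g" u] by (simp add: sc_def)
  finally have "of_int (2 - mtrace g) * \<rho> u = 0" by (simp add: algebra_simps)
  moreover have "2 - mtrace g \<noteq> 0" using trace[OF g(1)] g(2) by auto
  ultimately have "\<rho> u = 0" by (metis mult_eq_0_iff of_int_eq_0_iff)
  then show ?thesis by (simp add: \<rho>_def)
qed

lemma HH_1: "HH_dim \<theta> \<gamma> 1 0"
proof -
  have "\<phi> \<in> coboundaries \<theta> \<gamma> (Suc 0)" if \<phi>: "\<phi> \<in> cocycles \<theta> \<gamma> 1" for \<phi>
  proof (rule coboundaryI)
    show \<phi>1: "\<phi> \<in> cochains \<gamma> (Suc 0)" using \<phi> by (simp add: cocycles_def)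
    fix g assume g: "g \<in> \<Gamma>"
    interpret bicomplex_chase graded dd "S g e1" "S g e2" by (rule chase[OF g])
    have "slice (hom \<phi>) g \<in> graded 2" using cocycle_slice(1)[OF \<phi> g] by (simp add: eval_nat_numeral)
    then obtain h m1 m2 where h: "h \<in> graded 1" "dd h = slice (hom \<phi>) g" "m1 \<in> graded 0" "m2 \<in> graded 0"
      "dd m1 = S g e1 h" "dd m2 = S g e2 h" "S g e2 m1 = S g e1 m2"
      by (rule degree_one_primitive) (use cocycle_slice(2,3)[OF \<phi> g] in blast)+
    \<comment> \<open>At \<open>v = 0\<close> the phases are trivial, and these values are
      increments of the potential \<open>\<eta>\<close> along \<open>e1\<close> and
      \<open>e2\<close>.\<close>
    have good: "m1 0 [] = 0 \<and> m2 0 [] = 0" if gm: "g = mone"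
    proof -
      define \<eta> where "\<eta> p = h 0 [p]" for p
      have \<eta>: "\<eta> b - \<eta> a = hom \<phi> (0, mone) [a, b]" if "a \<in> G" "b \<in> G" for a b
      proof -
        have "dd h 0 [a, b] = hom \<phi> (0, mone) [a, b]"
          using that retr_id[of "[a, b]"] by (simp add: h(2) slice_def gm)
        then show ?thesis by (simp add: dd_def \<eta>_def)
      qed
      note eqv = equivariantD[OF equivariant_hom[OF \<phi>1] mone_cyc_group]
      have E: "\<eta> (u, mone) = \<eta> (0, mone)" for u
      proof (rule invariant_additive_zero)
        fix u a b assume ab: "a \<in> G" "b \<in> G"
        then have "tr u a \<in> G" "tr u b \<in> G" by (simp_all add: G_def tr_def)
        then show "\<eta> (tr u b) - \<eta> (tr u a) = \<eta> b - \<eta> a"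
          using ab eqv(1)[of "[a, b]" 0 u] by (simp add: \<eta>)
      next
        fix k a b assume k: "k \<in> \<Gamma>" and ab: "a \<in> G" "b \<in> G"
        then have "gl k a \<in> G" "gl k b \<in> G" by (simp_all add: G_def gl_def mmul_cyc_group)
        then show "\<eta> (gl k b) - \<eta> (gl k a) = \<eta> b - \<eta> a"
          using k ab eqv(2)[of "[a, b]" k 0] by (simp add: \<eta>)
      qed
      have "S mone u h 0 [(0, mone)] = \<eta> (0, mone) - \<eta> (- u, mone)" for u
        by (simp add: S_def T_def \<eta>_def tr_def)
      then have Sh: "S mone u h 0 [(0, mone)] = 0" for u using E[of "- u"] by simp
      have "dd m1 0 [(0, mone)] = 0" "dd m2 0 [(0, mone)] = 0"
        using h(5,6) Sh by (simp_all add: gm)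
      then show ?thesis by (simp add: dd_def)
    qed
    then have "good g m1" "good g m2" using h(3,4) by (simp_all add: good_def)
    from good_derivation[OF g this h(7)] obtain a where a: "m1 = S g e1 a" "m2 = S g e2 a" by blast
    show "\<exists>y. dd y = slice (hom \<phi>) g \<and> S g e1 y = 0 \<and> S g e2 y = 0"
      by (rule degree_one_exact[OF h(2), of a]) (simp_all only: a[symmetric] h(5,6))
  qed
  then show ?thesis unfolding HH_dim_def quot_dim_def by simp
qed

text \<open>Twice the signed area of the triangle of lattice points, placed at the identity
  conjugacy class.\<close>

definition area :: "bidx \<Rightarrow> bidx list \<Rightarrow> complex" where
  "area x gs = (if x = (0, mone) \<and> length gs = 3
     then of_int (wedge (fst (gs ! 1) - fst (gs ! 0)) (fst (gs ! 2) - fst (gs ! 0))) else 0)"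

lemma mapply_eq_0: "h \<in> \<Gamma> \<Longrightarrow> h \<odot> v = 0 \<longleftrightarrow> v = 0"
  by (metis mapply_linear(4) mapply_minv(2))

lemma equivariant_area: "equivariant area"
  unfolding equivariant_def
proof (intro conjI allI impI)
  fix u v g and gs :: "bidx list"
  show "area (v, g) (map (tr u) gs) = lam (tau u v g) * area (v + g \<odot> u - u, g) gs"
    by (cases "g = mone"; cases "v = 0") (simp_all add: area_def tr_def)
next
  fix h v g and gs :: "bidx list" assume "h \<in> \<Gamma>"
  then show "area (h \<odot> v, g) (map (gl h) gs) = area (v, g) gs"
    by (simp add: area_def gl_def mapply_eq_0 mapply_linear(2)[symmetric] del: mapply_linear wedge_linear)
qed

lemma bd_area: "bd (area x) gs = 0"
proof (cases "length gs = 4")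
  case True
  then obtain a b c d where "gs = [a, b, c, d]" by (auto simp: eval_nat_numeral length_Suc_conv)
  then show ?thesis by (simp add: area_def wedge_def algebra_simps)
next
  case False
  have "bd (area x) gs = bd (\<lambda>_. 0) gs" by (rule bd_cong) (use False in \<open>auto simp: area_def\<close>)
  then show ?thesis by simp
qed

lemma zero_cochain: "(\<lambda>_. 0) \<in> cochains \<gamma> n"
  by (simp add: cochains_def)

lemma hom_zero [simp]: "hom (\<lambda>_. 0) x gs = 0"
  by (simp add: hom_def)

lemma cocycleI:
  assumes \<phi>: "\<phi> \<in> cochains \<gamma> n" and "\<And>x gs. x \<in> G \<Longrightarrow> set gs \<subseteq> G \<Longrightarrow> bd (hom \<phi> x) gs = 0"
  shows "\<phi> \<in> cocycles \<theta> \<gamma> n"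
proof -
  have "hoch_d \<theta> \<gamma> n \<phi> = (\<lambda>_. 0)"
    by (rule hom_inj[OF hoch_d_cochains[OF \<phi>] zero_cochain]) (use assms hom_hoch_d[OF \<phi>] in auto)
  then show ?thesis using \<phi> by (simp add: cocycles_def)
qed

lemma area_cocycle:
  obtains \<phi> where "\<phi> \<in> cocycles \<theta> \<gamma> 2"
    "\<And>x gs. x \<in> G \<Longrightarrow> set gs \<subseteq> G \<Longrightarrow> hom \<phi> x gs = area x gs"
proof -
  obtain \<phi> where \<phi>: "\<phi> \<in> cochains \<gamma> 2"
    "\<And>x gs. x \<in> G \<Longrightarrow> set gs \<subseteq> G \<Longrightarrow> length gs = Suc 2 \<Longrightarrow> hom \<phi> x gs = area x gs"
    using hom_surj[OF equivariant_area, of 2] by metis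
  have eq: "hom \<phi> x gs = area x gs" if "x \<in> G" "set gs \<subseteq> G" for x gs
    using \<phi>(2)[OF that] hom_off[OF \<phi>(1), of gs x] by (cases "length gs = 3") (auto simp: area_def)
  have "bd (hom \<phi> x) gs = 0" if "x \<in> G" "set gs \<subseteq> G" for x gs
  proof -
    have "bd (hom \<phi> x) gs = bd (area x) gs" by (rule bd_cong) (use that eq in auto)
    then show ?thesis by (simp add: bd_area)
  qed
  then have "\<phi> \<in> cocycles \<theta> \<gamma> 2" by (rule cocycleI[OF \<phi>(1)])
  then show thesis using that eq by blast
qed

text \<open>A translation invariant \<open>P\<close> depends only on the difference of its vertices,
  so its coboundary agrees on the two paths from \<open>0\<close> to \<open>e1 + e2\<close> through
  \<open>e1\<close> and through \<open>e2\<close>. The area changes sign between them.\<close>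

lemma area_not_coboundary:
  assumes \<psi>: "\<psi> \<in> cochains \<gamma> 1" and eq: "\<And>x gs. x \<in> G \<Longrightarrow> set gs \<subseteq> G \<Longrightarrow> hom (hoch_d \<theta> \<gamma> 1 \<psi>) x gs = area x gs"
  shows False
proof -
  define P where "P u w = hom \<psi> (0, mone) [(u, mone), (w, mone)]" for u w
  have GI: "(w, mone) \<in> G" for w by (simp add: G_def)
  have area: "of_int (wedge u w) = P u w - P 0 w + P 0 u" for u w
    using eq[of "(0, mone)" "[(0, mone), (u, mone), (w, mone)]"]
      hom_hoch_d[OF \<psi>, of "(0, mone)" "[(0, mone), (u, mone), (w, mone)]"]
    by (simp add: GI area_def P_def)
  have shift: "P u (u + w) = P 0 w" for u w
    using equivariantD(1)[OF equivariant_hom[OF \<psi>] mone_cyc_group, of "[(0, mone), (w, mone)]" 0 u]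
    by (simp add: GI tr_def P_def)
  have "of_int (wedge e1 (e1 + e2)) = (of_int (wedge e2 (e2 + e1)) :: complex)"
    unfolding area shift by (simp add: add.commute)
  then show False by (simp add: wedge_def)
qed

text \<open>For \<open>g \<noteq> mone\<close> every obstruction is removable, so only the value at
  \<open>g = mone\<close>, \<open>v = 0\<close> stands in the way.\<close>

lemma coboundary_2:
  assumes \<phi>: "\<phi> \<in> cocycles \<theta> \<gamma> 2"
    and obs: "bicomplex_chase.obstruction graded dd (S mone e1) (S mone e2) (slice (hom \<phi>) mone) m"
    and m: "m 0 [] = 0"
  shows "\<phi> \<in> coboundaries \<theta> \<gamma> 2"
proof -
  have "\<phi> \<in> coboundaries \<theta> \<gamma> (Suc 1)"
  proof (rule coboundaryI)
    show "\<phi> \<in> cochains \<gamma> (Suc 1)" using \<phi> by (simp add: cocycles_def eval_nat_numeral)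
    fix g assume g: "g \<in> \<Gamma>"
    interpret bicomplex_chase graded dd "S g e1" "S g e2" by (rule chase[OF g])
    have "slice (hom \<phi>) g \<in> graded 3" using cocycle_slice(1)[OF \<phi> g] by (simp add: eval_nat_numeral)
    then obtain m' where "obstruction (slice (hom \<phi>) g) m'"
      using obstruction_exists cocycle_slice[OF \<phi> g] by blast
    then obtain m'' where m'': "obstruction (slice (hom \<phi>) g) m''" "g = mone \<longrightarrow> m'' 0 [] = 0"
      using obs m by (cases "g = mone") auto
    then have "good g m''" by (simp add: good_def obstruction_def)
    then obtain a b where "a \<in> graded 0" "b \<in> graded 0" "m'' = S g e1 a + S g e2 b"
      using good_coinvariants[OF g] by blast
    then show "\<exists>y. dd y = slice (hom \<phi>) g \<and> S g e1 y = 0 \<and> S g e2 y = 0"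
      using exact_if_obstruction_trivial m''(1) by blast
  qed
  then show ?thesis by (simp add: eval_nat_numeral)
qed

lemma dd_scale: "dd (\<lambda>v gs. c * \<Phi> v gs) = (\<lambda>v gs. c * dd \<Phi> v gs)"
  by (intro ext) (simp add: dd_def bd_mult)

lemma S_scale: "S g u (\<lambda>v gs. c * \<Phi> v gs) = (\<lambda>v gs. c * S g u \<Phi> v gs)"
  by (intro ext) (simp add: S_def T_fun right_diff_distrib)

lemma cocycles_lincomb:
  assumes "\<phi> \<in> cocycles \<theta> \<gamma> n" "\<psi> \<in> cocycles \<theta> \<gamma> n"
  shows "(\<lambda>xs. a * \<phi> xs + b * \<psi> xs) \<in> cocycles \<theta> \<gamma> n"
  using assms cochains_lincomb[of \<phi> \<gamma> n \<psi> a b] by (simp add: cocycles_def hoch_d_lincomb)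

lemma HH_2: "HH_dim \<theta> \<gamma> 2 1"
proof -
  interpret bicomplex_chase graded dd "S mone e1" "S mone e2" by (rule chase) simp
  obtain \<phi>0 where \<phi>0: "\<phi>0 \<in> cocycles \<theta> \<gamma> 2"
    "\<And>x gs. x \<in> G \<Longrightarrow> set gs \<subseteq> G \<Longrightarrow> hom \<phi>0 x gs = area x gs"
    using area_cocycle by metis
  have nontriv: "c = 0" if b: "(\<lambda>xs. c * \<phi>0 xs) \<in> coboundaries \<theta> \<gamma> 2" for c
  proof (rule ccontr)
    assume c: "c \<noteq> 0"
    obtain \<psi> where \<psi>: "\<psi> \<in> cochains \<gamma> 1" "(\<lambda>xs. c * \<phi>0 xs) = hoch_d \<theta> \<gamma> 1 \<psi>"
      using b by (auto simp: eval_nat_numeral)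
    let ?\<psi> = "\<lambda>xs. (1 / c) * \<psi> xs + 0 * \<psi> xs"
    have "hoch_d \<theta> \<gamma> 1 ?\<psi> = \<phi>0"
      unfolding hoch_d_lincomb \<psi>(2)[symmetric] using c by simp
    then show False
      using area_not_coboundary[OF cochains_lincomb[OF \<psi>(1) \<psi>(1), of "1 / c" 0]] \<phi>0(2) by simp
  qed
  have ex: "\<exists>m. obstruction (slice (hom \<phi>) mone) m" if "\<phi> \<in> cocycles \<theta> \<gamma> 2" for \<phi>
  proof (rule obstruction_exists)
    show "slice (hom \<phi>) mone \<in> graded 3"
      using cocycle_slice(1)[OF that, of mone] by (simp add: eval_nat_numeral)
  qed (use cocycle_slice[OF that] in auto)
  obtain m0 where m0: "obstruction (slice (hom \<phi>0) mone) m0" using ex[OF \<phi>0(1)] by blast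
  \<comment> \<open>Otherwise \<open>\<phi>0\<close> would be a coboundary. Hence this value can
    serve as the coordinate on degree 2 cohomology.\<close>
  have m0_neq: "m0 0 [] \<noteq> 0"
    using coboundary_2[OF \<phi>0(1) m0] nontriv[of 1] by auto
  have span: "\<exists>c. (\<lambda>xs. z xs - c * \<phi>0 xs) \<in> coboundaries \<theta> \<gamma> 2" if z: "z \<in> cocycles \<theta> \<gamma> 2" for z
  proof -
    obtain m where m: "obstruction (slice (hom z) mone) m" using ex[OF z] by blast
    \<comment> \<open>Chosen so that \<open>z - c \<phi>0\<close> has an obstruction vanishing at
      \<open>v = 0\<close>.\<close>
    define c where "c = m 0 [] / m0 0 []"
    have "obstruction (\<lambda>v gs. c * slice (hom \<phi>0) mone v gs) (\<lambda>v gs. c * m0 v gs)"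
      by (rule obstruction_map[OF m0]) (auto simp: graded_def dd_scale S_scale zero_fun_def)
    from obstruction_diff[OF m this]
    have obs: "obstruction (slice (hom (\<lambda>xs. 1 * z xs + (- c) * \<phi>0 xs)) mone) (m - (\<lambda>v gs. c * m0 v gs))"
      by (simp add: slice_def hom_def fun_diff_def if_distrib cong: if_cong)
    have "(m - (\<lambda>v gs. c * m0 v gs)) 0 [] = 0" using m0_neq by (simp add: c_def)
    from coboundary_2[OF cocycles_lincomb[OF z \<phi>0(1)] obs this] show ?thesis by auto
  qed
  show ?thesis unfolding HH_dim_def quot_dim_def
  proof (rule exI[of _ "\<lambda>_. \<phi>0"], intro conjI allI impI ballI)
    show "\<phi>0 \<in> cocycles \<theta> \<gamma> 2" by (rule \<phi>0(1))
    show "\<exists>c. (\<lambda>xs. z xs - (\<Sum>i<1::nat. c i * \<phi>0 xs)) \<in> coboundaries \<theta> \<gamma> 2" if "z \<in> cocycles \<theta> \<gamma> 2" for z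
    proof -
      from span[OF that] obtain c where "(\<lambda>xs. z xs - c * \<phi>0 xs) \<in> coboundaries \<theta> \<gamma> 2" by blast
      then show ?thesis by (intro exI[of _ "\<lambda>_. c"]) simp
    qed
    show "c i = 0" if "(\<lambda>xs. \<Sum>i<1::nat. c i * \<phi>0 xs) \<in> coboundaries \<theta> \<gamma> 2" "i < 1" for c and i :: nat
      using nontriv[of "c 0"] that by simp
  qed
qed

end

section \<open>Traces\<close>

lemma cyc_group_finite_order:
  assumes "k > 0" "mpow g k = mone"
  shows "cyc_group g = mpow g ` {..<k}"
proof -
  have q: "mpow g (q * k) = mone" for q
    by (induction q) (simp_all add: mpow_add assms(2))
  have "mpow g n = mpow g (n mod k)" for n
    using mpow_add[of g "n div k * k" "n mod k"] q by simp
  then show ?thesis unfolding cyc_group_def using assms(1)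
    by (auto intro!: image_eqI[where f = "mpow g" and x = "n mod k" for n])
qed

text \<open>The quadratic form \<open>v \<and> (1 + g)(g - 1)\<^sup>-\<^sup>1v / 4\<close>, whose increments under \<open>v \<mapsto> v + g u - u\<close> cancel the
  phases \<open>tau\<close> of the twisted conjugation.\<close>

definition quad :: "bidx \<Rightarrow> real" where
  "quad x = - real_of_int (wedge (fst x) (snd x \<odot> fst x)) / (2 * (2 - real_of_int (mtrace (snd x))))"

text \<open>The identity behind \<open>quad\<close>: a polynomial identity modulo
  \<open>a d - b c = 1\<close>, expressing an increment of \<open>v \<and> g v\<close> as a multiple
  of \<open>tau\<close>.\<close>

lemma wedge_translate:
  assumes "mdet g = 1"
  shows "wedge (v + g \<odot> u - u) (g \<odot> (v + g \<odot> u - u)) - wedge v (g \<odot> v) =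
    (2 - mtrace g) * (wedge u (v + g \<odot> u) - wedge v (g \<odot> u))"
proof -
  obtain a b c d where g: "g = (a, b, c, d)" by (metis prod.exhaust)
  obtain x y where u: "u = (x, y)" by (rule prod.exhaust)
  obtain p q where v: "v = (p, q)" by (rule prod.exhaust)
  have "a * d - b * c = 1" using assms by (simp add: g mdet_def)
  then show ?thesis unfolding g u v
    by (simp add: mapply_def wedge_def mtrace_def) algebra
qed

context finite_sl2
begin

lemma quad_translate:
  assumes g: "g \<in> \<Gamma>" "g \<noteq> mone"
  shows "quad (v, g) = tau u v g + quad (v + g \<odot> u - u, g)"
proof -
  define D where "D = 2 - real_of_int (mtrace g)"
  have D: "D \<noteq> 0" using trace[OF g(1)] g(2) unfolding D_def by linarith
  have "real_of_int (wedge (v + g \<odot> u - u) (g \<odot> (v + g \<odot> u - u))) - real_of_int (wedge v (g \<odot> v)) =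
      D * real_of_int (wedge u (v + g \<odot> u) - wedge v (g \<odot> u))"
    using arg_cong[OF wedge_translate[OF det[OF g(1)], of v u], of real_of_int]
    unfolding D_def by (simp del: wedge_linear mapply_linear)
  then show ?thesis using D unfolding quad_def tau_def fst_conv snd_conv D_def[symmetric]
    by (simp add: field_simps del: wedge_linear mapply_linear)
qed

lemma quad_mapply: "h \<in> \<Gamma> \<Longrightarrow> g \<in> \<Gamma> \<Longrightarrow> quad (h \<odot> v, g) = quad (v, g)"
  using mapply_commute[of g h v] by (simp add: quad_def)

lemma equivariant_trace_lincomb:
  assumes "equivariant (\<lambda>x gs. m x)" "\<And>i. i \<in> A \<Longrightarrow> equivariant (\<lambda>x gs. M i x)"
  shows "equivariant (\<lambda>x gs. m x - (\<Sum>i\<in>A. c i * M i x))"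
proof -
  have 1: "(\<Sum>i\<in>A. c i * M i (v, g)) = lam (tau u v g) * (\<Sum>i\<in>A. c i * M i (v + g \<odot> u - u, g))"
    if "g \<in> \<Gamma>" for u v g
    unfolding sum_distrib_left
    by (rule sum.cong[OF refl]) (use equivariantD(1)[OF assms(2) that, of _ "[]"] in \<open>simp add: mult_ac\<close>)
  have 2: "(\<Sum>i\<in>A. c i * M i (h \<odot> v, g)) = (\<Sum>i\<in>A. c i * M i (v, g))" if "g \<in> \<Gamma>" "h \<in> \<Gamma>" for h v g
    by (rule sum.cong[OF refl]) (use equivariantD(2)[OF assms(2) that(1), of _ "[]"] that in simp)
  show ?thesis unfolding equivariant_def
    using equivariantD(1)[OF assms(1), of _ "[]"] equivariantD(2)[OF assms(1), of _ "[]"] 1 2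
    by (simp add: right_diff_distrib)
qed

text \<open>Degree 0 cocycles are equivariant functions of \<open>x\<close> alone, that is, twisted
  traces. A system of points \<open>X\<close> with dual traces \<open>M\<close> gives a basis once
  no nonzero trace vanishes on all of \<open>X\<close>.\<close>

lemma HH_0:
  fixes N :: nat and X :: "nat \<Rightarrow> bidx" and M :: "nat \<Rightarrow> bidx \<Rightarrow> complex"
  assumes X: "\<And>j. j < N \<Longrightarrow> X j \<in> G"
    and M: "\<And>i. i < N \<Longrightarrow> equivariant (\<lambda>x gs. M i x)"
    and dual: "\<And>i j. i < N \<Longrightarrow> j < N \<Longrightarrow> M i (X j) = (if i = j then 1 else 0)"
    and complete: "\<And>m x. equivariant (\<lambda>x gs. m x) \<Longrightarrow> \<forall>j<N. m (X j) = 0 \<Longrightarrow> x \<in> G \<Longrightarrow> m x = 0"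
  shows "HH_dim \<theta> \<gamma> 0 N"
proof -
  let ?o = "(0, mone) :: bidx"
  have "\<exists>\<phi>. \<phi> \<in> cochains \<gamma> 0 \<and> (\<forall>x gs. x \<in> G \<longrightarrow> set gs \<subseteq> G \<longrightarrow> length gs = Suc 0 \<longrightarrow> hom \<phi> x gs = M i x)"
    if "i < N" for i
    by (rule hom_surj[OF M[OF that], of 0]) blast
  then obtain f where f: "f i \<in> cochains \<gamma> 0" "x \<in> G \<Longrightarrow> set gs \<subseteq> G \<Longrightarrow> length gs = Suc 0 \<Longrightarrow> hom (f i) x gs = M i x"
    if "i < N" for i x gs
    by metis
  have f_cocycle: "f i \<in> cocycles \<theta> \<gamma> 0" if i: "i < N" for i
  proof (rule cocycleI[OF f(1)[OF i]])
    fix x gs assume *: "x \<in> G" "set gs \<subseteq> G"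
    have "bd (hom (f i) x) gs = 0" if "length gs = 2"
    proof -
      from that obtain a b where "gs = [a, b]" by (auto simp: eval_nat_numeral length_Suc_conv)
      then show ?thesis using f(2)[OF i] * by simp
    qed
    moreover have "bd (hom (f i) x) gs = bd (\<lambda>_. 0) gs" if "length gs \<noteq> 2"
      by (rule bd_cong, rule hom_off[OF f(1)[OF i]]) (use that in auto)
    ultimately show "bd (hom (f i) x) gs = 0" by fastforce
  qed
  have sum_cochain: "(\<lambda>xs. \<Sum>i\<in>A. c i * f i xs) \<in> cochains \<gamma> 0" if "finite A" "A \<subseteq> {..<N}" for A c
    using that
  proof (induction A rule: finite_induct)
    case (insert i A)
    then have "(\<lambda>xs. c i * f i xs + 1 * (\<Sum>i\<in>A. c i * f i xs)) \<in> cochains \<gamma> 0"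
      by (intro cochains_lincomb f(1)) auto
    then show ?case using insert by simp
  qed (simp add: zero_cochain)
  have hom_sum: "hom (\<lambda>xs. \<Sum>i<N. c i * f i xs) x [p] = (\<Sum>i<N. c i * M i x)" if "x \<in> G" "p \<in> G" for c x p
  proof -
    have "hom (\<lambda>xs. \<Sum>i<N. c i * f i xs) x [p] = (\<Sum>i<N. c i * hom (f i) x [p])" by (simp add: hom_def)
    also have "\<dots> = (\<Sum>i<N. c i * M i x)" by (rule sum.cong[OF refl]) (use f(2) that in simp)
    finally show ?thesis .
  qed
  have o: "?o \<in> G" by (simp add: G_def)
  have span: "\<exists>c. (\<lambda>xs. z xs - (\<Sum>i<N. c i * f i xs)) = (\<lambda>_. 0)" if z: "z \<in> cocycles \<theta> \<gamma> 0" for z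
  proof -
    have zc: "z \<in> cochains \<gamma> 0" using z by (simp add: cocycles_def)
    define m where "m x = hom z x [?o]" for x
    \<comment> \<open>The cocycle identity on \<open>[?o, p]\<close> says that the value does not
      depend on the vertex.\<close>
    have m: "hom z x [p] = m x" if "x \<in> G" "p \<in> G" for x p
      using cocycle_bd[OF z that(1), of "[?o, p]"] that o by (simp add: m_def)
    have "equivariant (\<lambda>x gs. m x)" unfolding equivariant_def
    proof (intro conjI allI impI)
      fix u v g assume "g \<in> \<Gamma>"
      then show "m (v, g) = lam (tau u v g) * m (v + g \<odot> u - u, g)"
        using equivariantD(1)[OF equivariant_hom[OF zc], of g "[?o]" v u] m[of "(v, g)" "tr u ?o"] o
        by (simp add: m_def G_def tr_def)
    next
      fix h v g assume "h \<in> \<Gamma>" "g \<in> \<Gamma>"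
      then show "m (h \<odot> v, g) = m (v, g)"
        using equivariantD(2)[OF equivariant_hom[OF zc], of g "[?o]" h v] m[of "(h \<odot> v, g)" "gl h ?o"] o
        by (simp add: m_def G_def gl_def)
    qed
    then have eq: "equivariant (\<lambda>x gs. m x - (\<Sum>i<N. m (X i) * M i x))"
      by (rule equivariant_trace_lincomb) (use M in simp)
    have "(\<Sum>i<N. m (X i) * M i (X j)) = m (X j)" if "j < N" for j
    proof -
      have "(\<Sum>i<N. m (X i) * M i (X j)) = (\<Sum>i<N. if i = j then m (X i) else 0)"
        by (rule sum.cong[OF refl]) (use dual that in auto)
      then show ?thesis using that by simp
    qed
    then have mx: "m x = (\<Sum>i<N. m (X i) * M i x)" if "x \<in> G" for x
      using complete[OF eq _ that] by simp
    have "z = (\<lambda>xs. \<Sum>i<N. m (X i) * f i xs)"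
    proof (rule hom_inj[OF zc sum_cochain])
      fix x gs assume *: "x \<in> G" "set gs \<subseteq> G" "length gs = Suc 0"
      then obtain p where "gs = [p]" by (auto simp: length_Suc_conv)
      then show "hom z x gs = hom (\<lambda>xs. \<Sum>i<N. m (X i) * f i xs) x gs"
        using * m hom_sum mx by simp
    qed auto
    then have "(\<lambda>xs. z xs - (\<Sum>i<N. m (X i) * f i xs)) = (\<lambda>_. 0)" by (simp add: fun_eq_iff)
    then show ?thesis by (rule exI[of _ "\<lambda>i. m (X i)"])
  qed
  have indep: "c j = 0" if c: "(\<lambda>xs. \<Sum>i<N. c i * f i xs) = (\<lambda>_. 0)" and j: "j < N" for c j
  proof -
    have "0 = (\<Sum>i<N. c i * M i (X j))" using hom_sum[OF X[OF j] o, of c] unfolding c by simp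
    also have "\<dots> = (\<Sum>i<N. if i = j then c i else 0)"
      by (rule sum.cong[OF refl]) (use dual j in auto)
    finally show ?thesis using j by simp
  qed
  show ?thesis unfolding HH_dim_def quot_dim_def
  proof (rule exI[of _ f], intro conjI allI impI ballI)
    show "f i \<in> cocycles \<theta> \<gamma> 0" if "i < N" for i by (rule f_cocycle[OF that])
    show "\<exists>c. (\<lambda>xs. z xs - (\<Sum>i<N. c i * f i xs)) \<in> coboundaries \<theta> \<gamma> 0" if "z \<in> cocycles \<theta> \<gamma> 0" for z
      using span[OF that] by simp
    show "c i = 0" if "(\<lambda>xs. \<Sum>i<N. c i * f i xs) \<in> coboundaries \<theta> \<gamma> 0" "i < N" for c i
      using indep[OF _ that(2), of c] that(1) by simp
  qed
qed

text \<open>Here \<open>\<kappa>\<close> labels conjugacy classes with representatives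
  \<open>X\<close>. If \<open>g \<noteq> mone\<close>, each class supports a trace, since
  \<open>quad\<close> integrates the phases. If \<open>g = mone\<close>, only \<open>v = 0\<close>
  does: at other \<open>v\<close> the lattice acts by a nontrivial character.\<close>

lemma HH_0_classes:
  fixes N :: nat and X :: "nat \<Rightarrow> bidx" and \<kappa> :: "bidx \<Rightarrow> nat"
  assumes N: "0 < N" and X0: "X 0 = (0, mone)"
    and X: "\<And>j. j < N \<Longrightarrow> X j \<in> G \<and> \<kappa> (X j) = j \<and> (snd (X j) = mone \<longrightarrow> fst (X j) = 0)"
    and \<kappa>: "\<And>v u g. g \<in> \<Gamma> \<Longrightarrow> g \<noteq> mone \<Longrightarrow> \<kappa> (v + g \<odot> u - u, g) = \<kappa> (v, g)"
      "\<And>h v g. h \<in> \<Gamma> \<Longrightarrow> g \<in> \<Gamma> \<Longrightarrow> g \<noteq> mone \<Longrightarrow> \<kappa> (h \<odot> v, g) = \<kappa> (v, g)"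
    and cover: "\<And>v g. g \<in> \<Gamma> \<Longrightarrow> g \<noteq> mone \<Longrightarrow>
      \<exists>j h w u. j < N \<and> h \<in> \<Gamma> \<and> X j = (w, g) \<and> v = h \<odot> w + g \<odot> u - u"
  shows "HH_dim \<theta> \<gamma> 0 N"
proof -
  define M :: "nat \<Rightarrow> bidx \<Rightarrow> complex" where
    "M i x = (if \<kappa> x = i \<and> (snd x = mone \<longrightarrow> fst x = 0) then lam (quad x - quad (X i)) else 0)" for i x
  show ?thesis
  proof (rule HH_0[where X = X and M = M])
    show "X j \<in> G" if "j < N" for j using X that by blast
    show "M i (X j) = (if i = j then 1 else 0)" if "i < N" "j < N" for i j
      using X[OF that(2)] by (auto simp: M_def)
  next
    fix i
    have tq: "quad (v, g) - quad (X i) = tau u v g + (quad (v + g \<odot> u - u, g) - quad (X i))"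
      if "g \<in> \<Gamma>" "g \<noteq> mone" for u v g
      using quad_translate[OF that, of v u] by linarith
    show "equivariant (\<lambda>x gs. M i x)" unfolding equivariant_def
    proof (intro conjI allI impI)
      fix u v g assume g: "g \<in> \<Gamma>"
      show "M i (v, g) = lam (tau u v g) * M i (v + g \<odot> u - u, g)"
      proof (cases "g = mone")
        case True
        then show ?thesis by (cases "v = 0") (simp_all add: M_def)
      next
        case False
        show ?thesis unfolding M_def tq[OF g False, of v u] \<kappa>(1)[OF g False]
          using False by (simp add: lam_pow_add)
      qed
    next
      fix h v g assume h: "h \<in> \<Gamma>" and g: "g \<in> \<Gamma>"
      show "M i (h \<odot> v, g) = M i (v, g)"
      proof (cases "g = mone")
        case True
        then show ?thesis using h by (cases "v = 0") (simp_all add: M_def mapply_eq_0)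
      next
        case False
        then show ?thesis unfolding M_def quad_mapply[OF h g] \<kappa>(2)[OF h g False] by simp
      qed
    qed
  next
    fix m :: "bidx \<Rightarrow> complex" and x
    assume m: "equivariant (\<lambda>x gs. m x)" and z: "\<forall>j<N. m (X j) = 0" and x: "x \<in> G"
    note mN = equivariantD(1)[OF m, of _ "[]", simplified] and m\<Gamma> = equivariantD(2)[OF m, of _ "[]", simplified]
    obtain v g where vg: "x = (v, g)" by (rule prod.exhaust)
    have g: "g \<in> \<Gamma>" using x vg by (simp add: G_def)
    show "m x = 0"
    proof (cases "g = mone")
      case False
      obtain j h w u where *: "j < N" "h \<in> \<Gamma>" "X j = (w, g)" "v = h \<odot> w + g \<odot> u - u"
        using cover[OF g False, of v] by blast
      have "0 = m (h \<odot> w, g)" using m\<Gamma>[OF g *(2), of w] z *(1,3) by auto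
      also have "\<dots> = lam (tau u (h \<odot> w) g) * m (v, g)" unfolding *(4) by (rule mN[OF g])
      finally show ?thesis by (simp add: vg)
    next
      case True
      have "m (v, mone) = lam (wedge u v) * m (v, mone)" for u
        using mN[of mone v u] wedge_commute[of v u] by (simp add: tau_def)
      then have "(1 - lam (wedge u v)) * m (v, mone) = 0" for u by (simp add: left_diff_distrib)
      then have *: "wedge u v = 0 \<or> m (v, mone) = 0" for u using lam_int[of "wedge u v"] by fastforce
      show ?thesis
      proof (cases "v = 0")
        case True
        then show ?thesis using z X0 N vg \<open>g = mone\<close> by auto
      next
        case False
        then have "fst v \<noteq> 0 \<or> snd v \<noteq> 0" by (simp add: prod_eq_iff)
        then have "m (v, mone) = 0" using *[of e1] *[of e2] by (auto simp: wedge_def)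
        then show ?thesis using vg \<open>g = mone\<close> by simp
      qed
    qed
  qed
qed

end

section \<open>Explicit lists of the group elements\<close>

lemma cyc_group_Z3: "cyc_group gen_Z3 = {mone, (0, 1, -1, -1), (-1, -1, 1, 0)}"
proof -
  have "cyc_group gen_Z3 = mpow gen_Z3 ` {..<3}"
    by (rule cyc_group_finite_order) (simp_all add: eval_nat_numeral gen_Z3_def mmul_def mone_def)
  also have "\<dots> = {mone, (0, 1, -1, -1), (-1, -1, 1, 0)}"
    by (auto simp: eval_nat_numeral lessThan_Suc gen_Z3_def mmul_def mone_def)
  finally show ?thesis .
qed

lemma cyc_group_Z4: "cyc_group gen_Z4 = {mone, (0, 1, -1, 0), (-1, 0, 0, -1), (0, -1, 1, 0)}"
proof -
  have "cyc_group gen_Z4 = mpow gen_Z4 ` {..<4}"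
    by (rule cyc_group_finite_order) (simp_all add: eval_nat_numeral gen_Z4_def mmul_def mone_def)
  also have "\<dots> = {mone, (0, 1, -1, 0), (-1, 0, 0, -1), (0, -1, 1, 0)}"
    by (auto simp: eval_nat_numeral lessThan_Suc gen_Z4_def mmul_def mone_def)
  finally show ?thesis .
qed

lemma cyc_group_Z6: "cyc_group gen_Z6 = {mone, (0, -1, 1, 1), (-1, -1, 1, 0), (-1, 0, 0, -1), (0, 1, -1, -1), (1, 1, -1, 0)}"
proof -
  have "cyc_group gen_Z6 = mpow gen_Z6 ` {..<6}"
    by (rule cyc_group_finite_order) (simp_all add: eval_nat_numeral gen_Z6_def mmul_def mone_def)
  also have "\<dots> = {mone, (0, -1, 1, 1), (-1, -1, 1, 0), (-1, 0, 0, -1), (0, 1, -1, -1), (1, 1, -1, 0)}"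
    by (auto simp: eval_nat_numeral lessThan_Suc gen_Z6_def mmul_def mone_def)
  finally show ?thesis .
qed

lemma finite_sl2_cases:
  assumes "\<theta> \<notin> \<rat>" "\<gamma> \<in> {gen_Z3, gen_Z4, gen_Z6}"
  shows "finite_sl2 \<theta> \<gamma>"
proof
  show "\<theta> \<notin> \<rat>" by fact
  have "\<gamma> = gen_Z3 \<or> \<gamma> = gen_Z4 \<or> \<gamma> = gen_Z6" using assms by simp
  note cases = this
  show "finite (cyc_group \<gamma>)" using cases by (auto simp: cyc_group_Z3 cyc_group_Z4 cyc_group_Z6)
  show "mdet g = 1" if "g \<in> cyc_group \<gamma>" for g
    using cases that by (auto simp: cyc_group_Z3 cyc_group_Z4 cyc_group_Z6 mdet_def mone_def)
  show "minv g \<in> cyc_group \<gamma>" if "g \<in> cyc_group \<gamma>" for g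
    using cases that by (auto simp: cyc_group_Z3 cyc_group_Z4 cyc_group_Z6 minv_def mone_def)
  show "g = mone" if "g \<in> cyc_group \<gamma>" "mtrace g = 2" for g
    using cases that by (auto simp: cyc_group_Z3 cyc_group_Z4 cyc_group_Z6 mtrace_def mone_def)
  show "\<exists>g\<in>cyc_group \<gamma>. g \<noteq> mone"
    using cases by (auto simp: cyc_group_Z3 cyc_group_Z4 cyc_group_Z6 mone_def)
qed

section \<open>The three groups\<close>

text \<open>For order 3 the image of \<open>g - 1\<close> has index 3, with cosets given by
  \<open>a - b\<close> modulo 3, and \<open>\<Gamma>\<close> fixes them. The count is
  \<open>1 + 3 + 3\<close>.\<close>

lemma HH_0_Z3:
  assumes "\<theta> \<notin> \<rat>"
  shows "HH_dim \<theta> gen_Z3 0 7"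
proof -
  interpret finite_sl2 \<theta> gen_Z3 by (rule finite_sl2_cases) (use assms in auto)
  define X where "X j = ([((0, 0), mone),
     ((0, 0), (0, 1, -1, -1)), ((1, 0), (0, 1, -1, -1)), ((2, 0), (0, 1, -1, -1)),
     ((0, 0), (-1, -1, 1, 0)), ((1, 0), (-1, -1, 1, 0)), ((2, 0), (-1, -1, 1, 0))] :: bidx list) ! j" for j
  define \<kappa> :: "bidx \<Rightarrow> nat" where "\<kappa> x = (if snd x = mone then 0
     else (if snd x = (0, 1, -1, -1) then 1 else 4) + nat ((fst (fst x) - snd (fst x)) mod 3))" for x
  show ?thesis
  proof (rule HH_0_classes[where X = X and \<kappa> = \<kappa>])
    show "X 0 = (0, mone)" by (simp add: X_def zero_prod_def)
    show "X j \<in> G \<and> \<kappa> (X j) = j \<and> (snd (X j) = mone \<longrightarrow> fst (X j) = 0)" if "j < 7" for j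
    proof -
      have "j \<in> {0, 1, 2, 3, 4, 5, 6}" using that by auto
      then show ?thesis
        by (auto simp: X_def G_def \<kappa>_def cyc_group_Z3 mone_def zero_prod_def)
    qed
    show "\<kappa> (v + g \<odot> u - u, g) = \<kappa> (v, g)" if "g \<in> \<Gamma>" "g \<noteq> mone" for v u g
    proof -
      have "(fst (v + g \<odot> u - u) - snd (v + g \<odot> u - u)) mod 3 = (fst v - snd v) mod 3"
        using that by (auto simp: cyc_group_Z3 mapply_def split: prod.splits) presburger+
      then show ?thesis by (simp add: \<kappa>_def)
    qed
    show "\<kappa> (h \<odot> v, g) = \<kappa> (v, g)" if "h \<in> \<Gamma>" "g \<in> \<Gamma>" "g \<noteq> mone" for h v g
    proof -
      have "(fst (h \<odot> v) - snd (h \<odot> v)) mod 3 = (fst v - snd v) mod 3"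
        using that(1) by (auto simp: cyc_group_Z3 mapply_def mone_def split: prod.splits) presburger+
      then show ?thesis by (simp add: \<kappa>_def)
    qed
    fix v :: "int \<times> int" and g :: mat2 assume g: "g \<in> \<Gamma>" "g \<noteq> mone"
    obtain a b where v: "v = (a, b)" by (rule prod.exhaust)
    define r where "r = (a - b) mod 3"
    have r: "r = 0 \<or> r = 1 \<or> r = 2" unfolding r_def by presburger
    define q where "q = (a - b) div 3"
    have ab: "a = b + 3 * q + r" unfolding q_def r_def by presburger
    consider "g = (0, 1, -1, -1)" | "g = (-1, -1, 1, 0)" using g by (auto simp: cyc_group_Z3)
    then show "\<exists>j h w u. j < 7 \<and> h \<in> \<Gamma> \<and> X j = (w, g) \<and> v = h \<odot> w + g \<odot> u - u"
    proof cases
      case 1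
      \<comment> \<open>The witness solves \<open>(g - 1) u = v - (r, 0)\<close>, which is possible
        because \<open>a - b - r = 3 q\<close>.\<close>
      have "v = mone \<odot> (r, 0) + g \<odot> (q - a + r, q) - (q - a + r, q)"
        by (simp add: 1 v ab mapply_def mone_def)
      moreover have "X (1 + nat r) = ((r, 0), g)" "1 + nat r < 7" using r by (auto simp: X_def 1)
      ultimately show ?thesis using mone_cyc_group by blast
    next
      case 2
      have "v = mone \<odot> (r, 0) + g \<odot> (- q, - b - q) - (- q, - b - q)"
        by (simp add: 2 v ab mapply_def mone_def)
      moreover have "X (4 + nat r) = ((r, 0), g)" "4 + nat r < 7" using r by (auto simp: X_def 2)
      ultimately show ?thesis using mone_cyc_group by blast
    qed
  qed simp
qed

text \<open>For order 4 the image of \<open>g - 1\<close> has index 2, detected by the parity of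
  \<open>a + b\<close>. For \<open>g = -1\<close> the cosets are pairs of parities, and
  \<open>\<Gamma>\<close> swaps the two coordinates. The count is
  \<open>1 + 2 + 2 + 3\<close>.\<close>

lemma HH_0_Z4:
  assumes "\<theta> \<notin> \<rat>"
  shows "HH_dim \<theta> gen_Z4 0 8"
proof -
  interpret finite_sl2 \<theta> gen_Z4 by (rule finite_sl2_cases) (use assms in auto)
  define X where "X j = ([((0, 0), mone),
     ((0, 0), (0, 1, -1, 0)), ((1, 0), (0, 1, -1, 0)), ((0, 0), (0, -1, 1, 0)), ((1, 0), (0, -1, 1, 0)),
     ((0, 0), (-1, 0, 0, -1)), ((1, 1), (-1, 0, 0, -1)), ((1, 0), (-1, 0, 0, -1))] :: bidx list) ! j" for j
  define \<kappa> :: "bidx \<Rightarrow> nat" where "\<kappa> x = (if snd x = mone then 0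
     else if snd x = (-1, 0, 0, -1) then
       (if even (fst (fst x)) = even (snd (fst x)) then if even (fst (fst x)) then 5 else 6 else 7)
     else (if snd x = (0, 1, -1, 0) then 1 else 3) + (if even (fst (fst x) + snd (fst x)) then 0 else 1))" for x
  show ?thesis
  proof (rule HH_0_classes[where X = X and \<kappa> = \<kappa>])
    show "X 0 = (0, mone)" by (simp add: X_def zero_prod_def)
    show "X j \<in> G \<and> \<kappa> (X j) = j \<and> (snd (X j) = mone \<longrightarrow> fst (X j) = 0)" if "j < 8" for j
    proof -
      have "j \<in> {0, 1, 2, 3, 4, 5, 6, 7}" using that by auto
      then show ?thesis
        by (auto simp: X_def G_def \<kappa>_def cyc_group_Z4 mone_def zero_prod_def)
    qed
    show "\<kappa> (v + g \<odot> u - u, g) = \<kappa> (v, g)" if g: "g \<in> \<Gamma>" "g \<noteq> mone" for v u g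
    proof -
      have "even (fst (v + g \<odot> u - u) + snd (v + g \<odot> u - u)) \<longleftrightarrow> even (fst v + snd v)"
        using g by (auto simp: cyc_group_Z4 mapply_def split: prod.splits)
      moreover have "even (fst (v + g \<odot> u - u)) \<longleftrightarrow> even (fst v)" "even (snd (v + g \<odot> u - u)) \<longleftrightarrow> even (snd v)"
        if "g = (-1, 0, 0, -1)"
        using that by (auto simp: mapply_def split: prod.splits)
      ultimately show ?thesis unfolding \<kappa>_def fst_conv snd_conv
        by (simp del: fst_add snd_add fst_diff snd_diff even_add)
    qed
    show "\<kappa> (h \<odot> v, g) = \<kappa> (v, g)" if h: "h \<in> \<Gamma>" for h v g
    proof -
      have "h = (0, 1, -1, 0) \<or> h = (0, -1, 1, 0) \<or> even (fst (h \<odot> v)) = even (fst v) \<and> even (snd (h \<odot> v)) = even (snd v)"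
        using h by (auto simp: cyc_group_Z4 mapply_def mone_def split: prod.splits)
      then have "even (fst (h \<odot> v)) = even (snd v) \<and> even (snd (h \<odot> v)) = even (fst v) \<or>
          even (fst (h \<odot> v)) = even (fst v) \<and> even (snd (h \<odot> v)) = even (snd v)"
        by (auto simp: mapply_def split: prod.splits)
      then show ?thesis by (auto simp: \<kappa>_def)
    qed
    fix v :: "int \<times> int" and g :: mat2 assume g: "g \<in> \<Gamma>" "g \<noteq> mone"
    obtain a b where v: "v = (a, b)" by (rule prod.exhaust)
    define r where "r = (a + b) mod 2"
    have r: "r = 0 \<or> r = 1" unfolding r_def by presburger
    define q where "q = (a + b) div 2"
    have ab: "a = 2 * q + r - b" unfolding q_def r_def by presburger
    have cover: "\<exists>j h w u. j < 8 \<and> h \<in> \<Gamma> \<and> X j = (w, g) \<and> v = h \<odot> w + g \<odot> u - u"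
      if "j < 8" "h \<in> \<Gamma>" "X j = (w, g)" "v = h \<odot> w + g \<odot> u - u" for j h w u
      using that by blast
    consider "g = (0, 1, -1, 0)" | "g = (0, -1, 1, 0)" | "g = (-1, 0, 0, -1)" using g by (auto simp: cyc_group_Z4)
    then show "\<exists>j h w u. j < 8 \<and> h \<in> \<Gamma> \<and> X j = (w, g) \<and> v = h \<odot> w + g \<odot> u - u"
    proof cases
      case 1
      have "v = mone \<odot> (r, 0) + g \<odot> (- q, q - b) - (- q, q - b)"
        by (simp add: 1 v ab mapply_def mone_def)
      moreover have "X (1 + nat r) = ((r, 0), g)" "1 + nat r < 8" using r by (auto simp: X_def 1)
      ultimately show ?thesis using mone_cyc_group by blast
    next
      case 2
      have "v = mone \<odot> (r, 0) + g \<odot> (b - q, - q) - (b - q, - q)"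
        by (simp add: 2 v ab mapply_def mone_def)
      moreover have "X (3 + nat r) = ((r, 0), g)" "3 + nat r < 8" using r by (auto simp: X_def 2)
      ultimately show ?thesis using mone_cyc_group by blast
    next
      case 3
      have k: "mone \<in> \<Gamma>" "(0, 1, -1, 0) \<in> \<Gamma>" by (simp_all add: cyc_group_Z4)
      have X: "X 5 = ((0, 0), g)" "X 6 = ((1, 1), g)" "X 7 = ((1, 0), g)" by (simp_all add: X_def 3)
      define c where "c = - (a div 2)"
      define d where "d = - (b div 2)"
      \<comment> \<open>The rotation in \<open>\<Gamma>\<close> takes \<open>(1, 0)\<close> to
        \<open>(0, -1)\<close>, so odd \<open>b\<close> is written as \<open>-1 - 2 d'\<close> in
        the last case.\<close>
      define d' where "d' = d - 1"
      consider "a = - 2 * c" "b = - 2 * d" | "a = 1 - 2 * c" "b = 1 - 2 * d" | "a = 1 - 2 * c" "b = - 2 * d"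
        | "a = - 2 * c" "b = - 1 - 2 * d'"
      proof -
        have "a = - 2 * c \<or> a = 1 - 2 * c" "b = - 2 * d \<or> b = 1 - 2 * d"
          unfolding c_def d_def by presburger+
        then show thesis using that by (auto simp: d'_def)
      qed
      then show ?thesis
      proof cases
        case 1
        then have "v = mone \<odot> (0, 0) + g \<odot> (c, d) - (c, d)" by (simp add: 3 v mapply_def mone_def)
        from cover[OF _ k(1) X(1) this] show ?thesis by simp
      next
        case 2
        then have "v = mone \<odot> (1, 1) + g \<odot> (c, d) - (c, d)" by (simp add: 3 v mapply_def mone_def)
        from cover[OF _ k(1) X(2) this] show ?thesis by simp
      next
        case c: 3
        then have "v = mone \<odot> (1, 0) + g \<odot> (c, d) - (c, d)" by (simp add: 3 v mapply_def mone_def)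
        from cover[OF _ k(1) X(3) this] show ?thesis by simp
      next
        case 4
        then have "v = (0, 1, -1, 0) \<odot> (1, 0) + g \<odot> (c, d') - (c, d')" by (simp add: 3 v mapply_def mone_def)
        from cover[OF _ k(2) X(3) this] show ?thesis by simp
      qed
    qed
  qed simp
qed

text \<open>For order 6 the matrix \<open>g - 1\<close> is invertible, giving one class each. For
  order 3 the residues \<open>1\<close> and \<open>2\<close> of \<open>a - b\<close> are joined by
  \<open>-1\<close>. For \<open>g = -1\<close> the three nonzero parity pairs are permuted
  transitively. The count is \<open>1 + 2 + 4 + 2\<close>.\<close>

lemma HH_0_Z6:
  assumes "\<theta> \<notin> \<rat>"
  shows "HH_dim \<theta> gen_Z6 0 9"
proof -
  interpret finite_sl2 \<theta> gen_Z6 by (rule finite_sl2_cases) (use assms in auto)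
  define X where "X j = ([((0, 0), mone), ((0, 0), (0, -1, 1, 1)), ((0, 0), (1, 1, -1, 0)),
     ((0, 0), (-1, -1, 1, 0)), ((1, 0), (-1, -1, 1, 0)), ((0, 0), (0, 1, -1, -1)), ((1, 0), (0, 1, -1, -1)),
     ((0, 0), (-1, 0, 0, -1)), ((1, 0), (-1, 0, 0, -1))] :: bidx list) ! j" for j
  define \<kappa> :: "bidx \<Rightarrow> nat" where "\<kappa> x = (if snd x = mone then 0 else if snd x = (0, -1, 1, 1) then 1
     else if snd x = (1, 1, -1, 0) then 2
     else if snd x = (-1, 0, 0, -1) then (if even (fst (fst x)) \<and> even (snd (fst x)) then 7 else 8)
     else (if snd x = (-1, -1, 1, 0) then 3 else 5) + (if 3 dvd fst (fst x) - snd (fst x) then 0 else 1))" for x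
  show ?thesis
  proof (rule HH_0_classes[where X = X and \<kappa> = \<kappa>])
    show "X 0 = (0, mone)" by (simp add: X_def zero_prod_def)
    show "X j \<in> G \<and> \<kappa> (X j) = j \<and> (snd (X j) = mone \<longrightarrow> fst (X j) = 0)" if "j < 9" for j
    proof -
      have "j \<in> {0, 1, 2, 3, 4, 5, 6, 7, 8}" using that by auto
      then show ?thesis
        by (auto simp: X_def G_def \<kappa>_def cyc_group_Z6 mone_def zero_prod_def)
    qed
    show "\<kappa> (v + g \<odot> u - u, g) = \<kappa> (v, g)" if g: "g \<in> \<Gamma>" "g \<noteq> mone" for v u g
    proof -
      have "3 dvd fst (v + g \<odot> u - u) - snd (v + g \<odot> u - u) \<longleftrightarrow> 3 dvd fst v - snd v"
        if "g = (-1, -1, 1, 0) \<or> g = (0, 1, -1, -1)"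
        using that by (auto simp: mapply_def split: prod.splits) presburger+
      moreover have "even (fst (v + g \<odot> u - u)) \<longleftrightarrow> even (fst v)" "even (snd (v + g \<odot> u - u)) \<longleftrightarrow> even (snd v)"
        if "g = (-1, 0, 0, -1)"
        using that by (auto simp: mapply_def split: prod.splits)
      ultimately show ?thesis using g unfolding \<kappa>_def fst_conv snd_conv
        by (auto simp: cyc_group_Z6 simp del: fst_add snd_add fst_diff snd_diff)
    qed
    show "\<kappa> (h \<odot> v, g) = \<kappa> (v, g)" if h: "h \<in> \<Gamma>" "g \<in> \<Gamma>" "g \<noteq> mone" for h v g
    proof -
      have "3 dvd fst (h \<odot> v) - snd (h \<odot> v) \<longleftrightarrow> 3 dvd fst v - snd v"
        using h(1) by (auto simp: cyc_group_Z6 mapply_def mone_def split: prod.splits) presburger+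
      moreover have "even (fst (h \<odot> v)) \<and> even (snd (h \<odot> v)) \<longleftrightarrow> even (fst v) \<and> even (snd v)"
        using h(1) by (auto simp: cyc_group_Z6 mapply_def mone_def split: prod.splits)
      ultimately show ?thesis by (simp add: \<kappa>_def)
    qed
    fix v :: "int \<times> int" and g :: mat2 assume g: "g \<in> \<Gamma>" "g \<noteq> mone"
    obtain a b where v: "v = (a, b)" by (rule prod.exhaust)
    have k: "mone \<in> \<Gamma>" "(-1, 0, 0, -1) \<in> \<Gamma>" "(0, -1, 1, 1) \<in> \<Gamma>" "(-1, -1, 1, 0) \<in> \<Gamma>" by (simp_all add: cyc_group_Z6)
    define q where "q = (a - b) div 3"
    \<comment> \<open>Residue 2 is rewritten as \<open>-1\<close>, because \<open>-1\<close> in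
      \<open>\<Gamma>\<close> takes \<open>(1, 0)\<close> to \<open>(-1, 0)\<close>.\<close>
    define q' where "q' = q + 1"
    have ab: "a = b + 3 * q \<or> a = b + 3 * q + 1 \<or> a = b + 3 * q' - 1" unfolding q_def q'_def by presburger
    have cover: "\<exists>j h w u. j < 9 \<and> h \<in> \<Gamma> \<and> X j = (w, g) \<and> v = h \<odot> w + g \<odot> u - u"
      if "j < 9" "h \<in> \<Gamma>" "X j = (w, g)" "v = h \<odot> w + g \<odot> u - u" for j h w u
      using that by blast
    consider "g = (0, -1, 1, 1)" | "g = (1, 1, -1, 0)" | "g = (-1, -1, 1, 0)" | "g = (0, 1, -1, -1)"
      | "g = (-1, 0, 0, -1)" using g by (auto simp: cyc_group_Z6)
    then show "\<exists>j h w u. j < 9 \<and> h \<in> \<Gamma> \<and> X j = (w, g) \<and> v = h \<odot> w + g \<odot> u - u"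
    proof cases
      case 1
      have X: "X 1 = ((0, 0), g)" by (simp add: 1 X_def)
      have "v = mone \<odot> (0, 0) + g \<odot> (b, - a - b) - (b, - a - b)" by (simp add: 1 v mapply_def mone_def)
      from cover[OF _ k(1) X this] show ?thesis by simp
    next
      case 2
      have X: "X 2 = ((0, 0), g)" by (simp add: 2 X_def)
      have "v = mone \<odot> (0, 0) + g \<odot> (- a - b, a) - (- a - b, a)" by (simp add: 2 v mapply_def mone_def)
      from cover[OF _ k(1) X this] show ?thesis by simp
    next
      case 3
      have X: "X 3 = ((0, 0), g)" "X 4 = ((1, 0), g)" by (simp_all add: X_def 3)
      from ab consider "a = b + 3 * q" | "a = b + 3 * q + 1" | "a = b + 3 * q' - 1" by blast
      then show ?thesis
      proof cases
        case 1
        then have "v = mone \<odot> (0, 0) + g \<odot> (- q, - b - q) - (- q, - b - q)" by (simp add: 3 v mapply_def mone_def)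
        from cover[OF _ k(1) X(1) this] show ?thesis by simp
      next
        case 2
        then have "v = mone \<odot> (1, 0) + g \<odot> (- q, - b - q) - (- q, - b - q)" by (simp add: 3 v mapply_def mone_def)
        from cover[OF _ k(1) X(2) this] show ?thesis by simp
      next
        case c: 3
        then have "v = (-1, 0, 0, -1) \<odot> (1, 0) + g \<odot> (- q', - b - q') - (- q', - b - q')" by (simp add: 3 v mapply_def mone_def)
        from cover[OF _ k(2) X(2) this] show ?thesis by simp
      qed
    next
      case 4
      have X: "X 5 = ((0, 0), g)" "X 6 = ((1, 0), g)" by (simp_all add: X_def 4)
      from ab consider "a = b + 3 * q" | "a = b + 3 * q + 1" | "a = b + 3 * q' - 1" by blast
      then show ?thesis
      proof cases
        case 1
        then have "v = mone \<odot> (0, 0) + g \<odot> (- b - 2 * q, q) - (- b - 2 * q, q)" by (simp add: 4 v mapply_def mone_def)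
        from cover[OF _ k(1) X(1) this] show ?thesis by simp
      next
        case 2
        then have "v = mone \<odot> (1, 0) + g \<odot> (- b - 2 * q, q) - (- b - 2 * q, q)" by (simp add: 4 v mapply_def mone_def)
        from cover[OF _ k(1) X(2) this] show ?thesis by simp
      next
        case 3
        then have "v = (-1, 0, 0, -1) \<odot> (1, 0) + g \<odot> (- b - 2 * q', q') - (- b - 2 * q', q')" by (simp add: 4 v mapply_def mone_def)
        from cover[OF _ k(2) X(2) this] show ?thesis by simp
      qed
    next
      case 5
      have X: "X 7 = ((0, 0), g)" "X 8 = ((1, 0), g)" by (simp_all add: X_def 5)
      define c where "c = - (a div 2)"
      define d where "d = - (b div 2)"
      \<comment> \<open>For both coordinates odd the representative is moved by a matrix taking
        \<open>(1, 0)\<close> to \<open>(-1, 1)\<close>, which shifts \<open>c\<close> by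
        one.\<close>
      define c' where "c' = c - 1"
      consider "a = - 2 * c" "b = - 2 * d" | "a = 1 - 2 * c" "b = - 2 * d" | "a = - 2 * c" "b = 1 - 2 * d"
        | "a = - 1 - 2 * c'" "b = 1 - 2 * d"
      proof -
        have "a = - 2 * c \<or> a = 1 - 2 * c" "b = - 2 * d \<or> b = 1 - 2 * d"
          unfolding c_def d_def by presburger+
        then show thesis using that by (auto simp: c'_def)
      qed
      then show ?thesis
      proof cases
        case 1
        then have "v = mone \<odot> (0, 0) + g \<odot> (c, d) - (c, d)" by (simp add: 5 v mapply_def mone_def)
        from cover[OF _ k(1) X(1) this] show ?thesis by simp
      next
        case 2
        then have "v = mone \<odot> (1, 0) + g \<odot> (c, d) - (c, d)" by (simp add: 5 v mapply_def mone_def)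
        from cover[OF _ k(1) X(2) this] show ?thesis by simp
      next
        case 3
        then have "v = (0, -1, 1, 1) \<odot> (1, 0) + g \<odot> (c, d) - (c, d)" by (simp add: 5 v mapply_def mone_def)
        from cover[OF _ k(3) X(2) this] show ?thesis by simp
      next
        case 4
        then have "v = (-1, -1, 1, 0) \<odot> (1, 0) + g \<odot> (c', d) - (c', d)" by (simp add: 5 v mapply_def mone_def)
        from cover[OF _ k(4) X(2) this] show ?thesis by simp
      qed
    qed
  qed simp
qed

theorem theorem2p1:
  fixes \<theta> :: real and \<gamma> :: mat2 and N :: nat
  assumes "\<theta> \<notin> \<rat>"
    and "(\<gamma>, N) \<in> {(gen_Z3, 7), (gen_Z4, 8), (gen_Z6, 9)}"
  shows "HH_dim \<theta> \<gamma> 0 N \<and> HH_dim \<theta> \<gamma> 1 0 \<and> HH_dim \<theta> \<gamma> 2 1 \<and>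
         (\<forall>k>3. HH_dim \<theta> \<gamma> k 0)"
proof -
  interpret finite_sl2 \<theta> \<gamma> by (rule finite_sl2_cases) (use assms in auto)
  have "HH_dim \<theta> \<gamma> 0 N" using assms HH_0_Z3 HH_0_Z4 HH_0_Z6 by auto
  moreover have "HH_dim \<theta> \<gamma> k 0" if "k > 3" for k
    using HH_high[of "k - 3"] that by simp
  ultimately show ?thesis using HH_1 HH_2 by blast
qed

end
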